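(* (i) $\lnot[\mathrm{UVAL}_2]=[\mathrm{UVAL}_2]$. (ii) $\mathrm{MaxVAL}\propto\mathrm{UVAL}_2$.
   Context: $\Sigma=\{0,1\}$; $\Sigma^*$ is the set of finite nonempty binary strings. For $x\in\Sigma^m$ write $x=(x_1,\dots,x_m)$, $\pi_1(x)=x_1$, $\lnot x$ its bitwise complement. $\Sigma^m$ is ordered lexicographically with $x_1$ most significant. Let $\mathbb{P}_+\Sigma=\{\{0\},\{1\},\Sigma\}$ with $\lnot\{0\}=\{1\}$, $\lnot\{1\}=\{0\}$, $\lnot\Sigma=\Sigma$. A promise problem is a function $\phi:\Sigma^*\to\mathbb{P}_+\Sigma$. For promise problems, $\phi_1\propto\phi_2$ means there is a polynomial-time computable $\mu:\Sigma^*\to\Sigma^*$ with $\phi_1(x)\supseteq\phi_2(\mu(x))$ for all $x$; $[\phi]=\{\phi_1:\phi_1\propto\phi\}$; $(\lnot\phi)(x)=\lnot(\phi(x))$ and $\lnot[\phi]:=[\lnot\phi]$. $\mathrm{MaxVAL}$ takes an encoding (e.g. $m$ in binary plus a Boolean formula over $\land,\lor,\lnot$) of $f:\Sigma^m\to\Sigma$ and $\mathrm{MaxVAL}(f)=\{\pi_1\max\{x:f(x)=1\}\}$ if $\exists x:f(x)=1$, and $\Sigma$ otherwise. $\mathrm{UVAL}_2$ takes an encoding of $f:\Sigma^m\times\Sigma^{m'}\to\Sigma$, written $f(x,y)$, and $\mathrm{UVAL}_2(f)=\{\pi_1x:\forall y,\ f(x,y)=1\}$ if there is exactly one $x\in\Sigma^m$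 with $\forall y\in\Sigma^{m'},\ f(x,y)=1$, and $\Sigma$ otherwise. *)

theory Defs
  imports Main "HOL-Library.List_Lexorder"
begin

text \<open>Binary strings are bool lists (False = 0, True = 1); Sigma* is the set of
nonempty bool lists.  A promise problem maps strings to subsets of bool; its values on
nonempty strings must be in P+Sigma = {{False},{True},UNIV}.\<close>

definition promise_problem :: "(bool list \<Rightarrow> bool set) \<Rightarrow> bool" where
  "promise_problem \<phi> \<longleftrightarrow> (\<forall>x. x \<noteq> [] \<longrightarrow> \<phi> x \<in> {{False}, {True}, UNIV})"

definition pneg :: "(bool list \<Rightarrow> bool set) \<Rightarrow> (bool list \<Rightarrow> bool set)" where
  "pneg \<phi> = (\<lambda>x. Not ` \<phi> x)"

datatype sym = Blank | Bit bool
datatype dir = Lft | Rgt | Stay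

text \<open>A machine is (n, h, delta): states 0..<n, start state 0, halting state h,
transition function delta (only its values on states < n matter).\<close>
type_synonym tm = "nat \<times> nat \<times> (nat \<Rightarrow> sym \<Rightarrow> nat \<times> sym \<times> dir)"

text \<open>Configuration (q, ls, rs): state q, tape left of the head reversed in ls,
head cell and the cells to its right in rs (missing cells are blank).\<close>
type_synonym config = "nat \<times> sym list \<times> sym list"

definition valid_tm :: "tm \<Rightarrow> bool" where
  "valid_tm M = (case M of (n, h, \<delta>) \<Rightarrow>
      0 < n \<and> h < n \<and> (\<forall>q<n. \<forall>a. fst (\<delta> q a) < n))"

definition tm_step :: "tm \<Rightarrow> config \<Rightarrow> config" where
  "tm_step M c = (case M of (n, h, \<delta>) \<Rightarrow> (case c of (q, ls, rs) \<Rightarrow>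
     if q = h then c else
     (let a = (case rs of [] \<Rightarrow> Blank | b # _ \<Rightarrow> b);
          (q', b, d) = \<delta> q a;
          rs' = b # tl rs
      in (case d of
            Stay \<Rightarrow> (q', ls, rs')
          | Rgt \<Rightarrow> (q', b # ls, tl rs')
          | Lft \<Rightarrow> (case ls of [] \<Rightarrow> (q', [], Blank # rs')
                              | e # ls' \<Rightarrow> (q', ls', e # rs'))))))"

definition tm_init :: "bool list \<Rightarrow> config" where
  "tm_init x = (0, [], map Bit x)"

definition tm_output :: "config \<Rightarrow> bool list" where
  "tm_output c = map (\<lambda>s. case s of Bit b \<Rightarrow> b | Blank \<Rightarrow> False)
                      (takeWhile (\<lambda>s. s \<noteq> Blank) (snd (snd c)))"

definition computes_in_time :: "tm \<Rightarrow> (bool list \<Rightarrow> bool list) \<Rightarrow> (nat \<Rightarrow> nat) \<Rightarrow> bool" where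
  "computes_in_time M f T \<longleftrightarrow>
     (\<forall>x. \<exists>t \<le> T (length x).
        fst ((tm_step M ^^ t) (tm_init x)) = fst (snd M) \<and>
        tm_output ((tm_step M ^^ t) (tm_init x)) = f x)"

definition poly_time_computable :: "(bool list \<Rightarrow> bool list) \<Rightarrow> bool" where
  "poly_time_computable f \<longleftrightarrow>
     (\<exists>M c k. valid_tm M \<and> computes_in_time M f (\<lambda>n. c * n ^ k + c))"

definition reduces :: "(bool list \<Rightarrow> bool set) \<Rightarrow> (bool list \<Rightarrow> bool set) \<Rightarrow> bool"
  (infix "\<propto>" 50) where
  "\<phi>1 \<propto> \<phi>2 \<longleftrightarrow> (\<exists>\<mu>. poly_time_computable \<mu> \<and>
      (\<forall>x. x \<noteq> [] \<longrightarrow> \<mu> x \<noteq> [] \<and> \<phi>2 (\<mu> x) \<subseteq> \<phi>1 x))"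

definition red_class :: "(bool list \<Rightarrow> bool set) \<Rightarrow> (bool list \<Rightarrow> bool set) set" where
  "red_class \<phi> = {\<phi>1. promise_problem \<phi>1 \<and> \<phi>1 \<propto> \<phi>}"

datatype form = Var nat | Neg form | Conj form form | Disj form form

fun eval :: "form \<Rightarrow> (nat \<Rightarrow> bool) \<Rightarrow> bool" where
  "eval (Var i) \<sigma> = \<sigma> i"
| "eval (Neg p) \<sigma> = (\<not> eval p \<sigma>)"
| "eval (Conj p q) \<sigma> = (eval p \<sigma> \<and> eval q \<sigma>)"
| "eval (Disj p q) \<sigma> = (eval p \<sigma> \<or> eval q \<sigma>)"

fun vars_below :: "nat \<Rightarrow> form \<Rightarrow> bool" where
  "vars_below m (Var i) = (i < m)"
| "vars_below m (Neg p) = vars_below m p"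
| "vars_below m (Conj p q) = (vars_below m p \<and> vars_below m q)"
| "vars_below m (Disj p q) = (vars_below m p \<and> vars_below m q)"

text \<open>Binary representation (most significant bit first, no leading zeros),
made self-delimiting by doubling each bit and terminating with a 0.\<close>
fun bin :: "nat \<Rightarrow> bool list" where
  "bin n = (if n = 0 then [] else bin (n div 2) @ [odd n])"

definition enc_nat :: "nat \<Rightarrow> bool list" where
  "enc_nat n = concat (map (\<lambda>b. [True, b]) (bin n)) @ [False]"

fun enc_form :: "form \<Rightarrow> bool list" where
  "enc_form (Var i) = [False, False] @ enc_nat i"
| "enc_form (Neg p) = [False, True] @ enc_form p"
| "enc_form (Conj p q) = [True, False] @ enc_form p @ enc_form q"
| "enc_form (Disj p q) = [True, True] @ enc_form p @ enc_form q"

text \<open>MaxVAL instance: m (>= 1) and a formula over variables 0..<m (variable i is x_(i+1)).\<close>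
definition enc1 :: "nat \<times> form \<Rightarrow> bool list" where
  "enc1 p = enc_nat (fst p) @ enc_form (snd p)"

definition valid1 :: "nat \<times> form \<Rightarrow> bool" where
  "valid1 p \<longleftrightarrow> 1 \<le> fst p \<and> vars_below (fst p) (snd p)"

text \<open>UVAL_2 instance: m, m' (>= 1) and a formula over variables 0..<m+m';
variables 0..<m are x_1..x_m, variables m..<m+m' are y_1..y_m'.\<close>
definition enc2 :: "nat \<times> nat \<times> form \<Rightarrow> bool list" where
  "enc2 p = enc_nat (fst p) @ enc_nat (fst (snd p)) @ enc_form (snd (snd p))"

definition valid2 :: "nat \<times> nat \<times> form \<Rightarrow> bool" where
  "valid2 p \<longleftrightarrow> 1 \<le> fst p \<and> 1 \<le> fst (snd p) \<and> vars_below (fst p + fst (snd p)) (snd (snd p))"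

text \<open>Sigma^m is bool lists of length m, ordered lexicographically (List_Lexorder,
False < True, first entry most significant); pi_1 is hd.\<close>
definition MaxVAL_fun :: "nat \<Rightarrow> (bool list \<Rightarrow> bool) \<Rightarrow> bool set" where
  "MaxVAL_fun m f =
     (if \<exists>x. length x = m \<and> f x
      then {hd (Max {x. length x = m \<and> f x})} else UNIV)"

definition UVAL2_fun :: "nat \<Rightarrow> nat \<Rightarrow> (bool list \<Rightarrow> bool list \<Rightarrow> bool) \<Rightarrow> bool set" where
  "UVAL2_fun m m' f =
     (if \<exists>!x. length x = m \<and> (\<forall>y. length y = m' \<longrightarrow> f x y)
      then {hd (THE x. length x = m \<and> (\<forall>y. length y = m' \<longrightarrow> f x y))} else UNIV)"

text \<open>Strings that are not encodings of an instance are outside the promise (value UNIV).\<close>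
definition MaxVAL :: "bool list \<Rightarrow> bool set" where
  "MaxVAL s =
     (if \<exists>p. valid1 p \<and> enc1 p = s
      then (let p = (THE p. valid1 p \<and> enc1 p = s)
            in MaxVAL_fun (fst p) (\<lambda>x. eval (snd p) (\<lambda>i. x ! i)))
      else UNIV)"

definition UVAL2 :: "bool list \<Rightarrow> bool set" where
  "UVAL2 s =
     (if \<exists>p. valid2 p \<and> enc2 p = s
      then (let p = (THE p. valid2 p \<and> enc2 p = s)
            in UVAL2_fun (fst p) (fst (snd p)) (\<lambda>x y. eval (snd (snd p)) (\<lambda>i. (x @ y) ! i)))
      else UNIV)"

end

theory Submission
  imports Defs
begin

text \<open>(i) If \<open>p\<^sup>d\<close> is \<open>p\<close> with conjunction and disjunction exchanged, then \<open>\<not> p\<^sup>d\<close> is \<open>p\<close> with all inputs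
  negated, so it has the complemented solutions. This changes the code of an instance by flipping
  some bits and inserting two, which a single sweep over the tape does in place; it can therefore
  be appended to any reduction.

  (ii) For MaxVAL only the first variable matters in the order: the answer is 1 iff some
  satisfying assignment has first bit 1. Hence the assignment to be found may be represented by the
  list \<open>x\<close> of its values at the leaves of the formula, with variable 0 as the first leaf, and
  compared lexicographically in this order; the number of these new variables is linear even if
  \<open>m\<close> is exponential. The list \<open>x\<close> is unique if it satisfies the formula, is consistent, and is not exceeded
  by any satisfying assignment \<open>y\<close>. The last condition is universal in \<open>y\<close>. So is consistency,
  although a formula cannot compare the names of its variables: for all \<open>u\<close>, read as a path in the
  tree of all codes of variables, not both a leaf with value 1 and a leaf with value 0 have their
  code on the path \<open>u\<close>.

  The second reduction is a program for a machine with several stacks whose loops run over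
  stacks that they do not change. The stacks are interleaved on the tape.\<close>

section \<open>Turing machines on functions as tapes\<close>

text \<open>Binary arities shape (ii). A formula of polynomial length cannot mention all
  \<open>m\<close> coordinates, and a coordinate of \<open>x\<close> that it left free would destroy
  uniqueness; hence one coordinate per leaf. Universally quantified coordinates may stay free, so
  \<open>y\<close> can have exponentially many, \<open>2 ^ (2 * n + 1)\<close> for a code of length
  \<open>n\<close>, and can be indexed by the very strings that the machine has just read. The
  translation therefore keeps no table of names and never compares two of them: consistency of
  \<open>x\<close> is enforced by the quantifier, not by the machine. In (i), negating the inputs
  directly would insert bits at each leaf. De Morgan's laws move these negations to the root at the
  price of exchanging the connectives, so that the codes of all leaves keep their length and the
  output merely lags two bits behind. A given reduction is known only as a machine that leaves its
  result somewhere among other data, so the sweep has to bring its own end markers.\<close>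

type_synonym tape = "int \<Rightarrow> sym"

fun shift :: "dir \<Rightarrow> int" where
  "shift Lft = - 1"
| "shift Rgt = 1"
| "shift Stay = 0"

text \<open>With absolute positions the ends of the two lists around the head, where
  \<open>tm_step\<close> supplies missing cells, are no special places, and claims about distant
  cells survive head moves.\<close>

definition atm_step :: "tm \<Rightarrow> nat \<times> tape \<times> int \<Rightarrow> nat \<times> tape \<times> int" where
  "atm_step M a = (case M of (n, h, \<delta>) \<Rightarrow> (case a of (q, T, p) \<Rightarrow>
     if q = h then a
     else (case \<delta> q (T p) of (q', b, d) \<Rightarrow> (q', T(p := b), p + shift d))))"

definition cell :: "sym list \<Rightarrow> nat \<Rightarrow> sym" where
  "cell xs i = (if i < length xs then xs ! i else Blank)"

definition on_tape :: "config \<Rightarrow> nat \<times> tape \<times> int \<Rightarrow> bool" where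
  "on_tape c a \<longleftrightarrow> (case c of (q, ls, rs) \<Rightarrow> case a of (q', T, p) \<Rightarrow>
     q = q' \<and> (\<forall>i. T (p + int i) = cell rs i) \<and> (\<forall>i. T (p - 1 - int i) = cell ls i))"

lemma cell_Nil [simp]: "cell [] i = Blank"
  and cell_Cons_0 [simp]: "cell (x # xs) 0 = x"
  and cell_Cons_Suc [simp]: "cell (x # xs) (Suc i) = cell xs i"
  by (simp_all add: cell_def)

lemma cell_tl: "cell (tl xs) i = cell xs (Suc i)"
  by (cases xs) simp_all

lemma cell_0: "cell rs 0 = (case rs of [] \<Rightarrow> Blank | b # _ \<Rightarrow> b)"
  by (cases rs) simp_all

lemma on_tape_step:
  assumes "on_tape c a"
  shows "on_tape (tm_step M c) (atm_step M a)"
proof -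
  obtain n h \<delta> where M: "M = (n, h, \<delta>)" by (cases M)
  obtain q ls rs where c: "c = (q, ls, rs)" by (cases c)
  obtain T p where a: "a = (q, T, p)" using assms c by (cases a) (auto simp: on_tape_def)
  have R: "T (p + int i) = cell rs i" and L: "T (p - 1 - int i) = cell ls i" for i
    using assms c a by (auto simp: on_tape_def)
  have head: "(case rs of [] \<Rightarrow> Blank | b # _ \<Rightarrow> b) = T p"
    using R[of 0] by (simp add: cell_0)
  obtain q' b d where d: "\<delta> q (T p) = (q', b, d)" by (cases "\<delta> q (T p)")
  have R': "(T(p := b)) (p + int i) = cell (b # tl rs) i" for i
    using R[of i] by (cases i) (auto simp: cell_tl)
  have L': "(T(p := b)) (p - 1 - int i) = cell ls i" for i
    using L[of i] by auto
  show ?thesis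
  proof (cases "q = h")
    case True
    then show ?thesis using assms by (simp add: M c a tm_step_def atm_step_def)
  next
    case False
    show ?thesis
    proof (cases d)
      case Stay
      have "tm_step M c = (q', ls, b # tl rs)" "atm_step M a = (q', T(p := b), p)"
        using False d Stay head by (simp_all add: M c a tm_step_def atm_step_def Let_def)
      then show ?thesis using R' L' by (simp add: on_tape_def del: fun_upd_apply)
    next
      case Rgt
      have 1: "(T(p := b)) (p + 1 + int i) = cell (tl rs) i" for i
        using R'[of "Suc i"] by (simp add: algebra_simps)
      have 2: "(T(p := b)) (p + 1 - 1 - int i) = cell (b # ls) i" for i
        using R'[of 0] L'[of "i - 1"] by (cases i) (auto simp: algebra_simps)
      have "tm_step M c = (q', b # ls, tl rs)" "atm_step M a = (q', T(p := b), p + 1)"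
        using False d Rgt head by (simp_all add: M c a tm_step_def atm_step_def Let_def)
      then show ?thesis using 1 2 by (simp add: on_tape_def del: fun_upd_apply)
    next
      case Lft
      let ?rs = "(case ls of [] \<Rightarrow> Blank | e # _ \<Rightarrow> e) # b # tl rs"
      have 1: "(T(p := b)) (p - 1 + int i) = cell ?rs i" for i
      proof (cases i)
        case 0 then show ?thesis using L'[of 0] by (simp add: cell_0)
      next
        case (Suc j) then show ?thesis using R'[of j] by (simp add: algebra_simps)
      qed
      have 2: "(T(p := b)) (p - 1 - 1 - int i) = cell (tl ls) i" for i
        using L'[of "Suc i"] by (simp add: cell_tl algebra_simps)
      have "tm_step M c = (q', tl ls, ?rs)" "atm_step M a = (q', T(p := b), p - 1)"
        using False d Lft head
        by (auto simp: M c a tm_step_def atm_step_def Let_def split: list.splits)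
      then show ?thesis using 1 2 by (simp add: on_tape_def del: fun_upd_apply)
    qed
  qed
qed

lemma on_tape_steps:
  "on_tape c a \<Longrightarrow> on_tape ((tm_step M ^^ t) c) ((atm_step M ^^ t) a)"
  by (induction t) (simp_all add: on_tape_step)

text \<open>Nothing is required of the cells left of \<open>p\<close> or beyond the first blank, in
  agreement with \<open>tm_output\<close>; a result may stand among the remains of a
  computation.\<close>

definition reads :: "tape \<Rightarrow> int \<Rightarrow> bool list \<Rightarrow> bool" where
  "reads T p y \<longleftrightarrow> (\<forall>i<length y. T (p + int i) = Bit (y ! i)) \<and> T (p + int (length y)) = Blank"

lemma reads_unique:
  assumes "reads T p y" "reads T p z"
  shows "y = z"
proof -
  have "length y = length z"
    using assms unfolding reads_def by (metis linorder_neqE_nat sym.distinct(1))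
  moreover have "y ! i = z ! i" if "i < length y" for i
    using assms that calculation unfolding reads_def by (metis sym.inject)
  ultimately show ?thesis by (simp add: nth_equalityI)
qed

lemma reads_tm_output:
  assumes "on_tape (q, ls, rs) (q', T, p)"
  shows "reads T p (tm_output (q, ls, rs))"
proof -
  have R: "T (p + int i) = cell rs i" for i using assms by (auto simp: on_tape_def)
  let ?w = "takeWhile (\<lambda>s. s \<noteq> Blank) rs"
  have "T (p + int i) = Bit ((tm_output (q, ls, rs)) ! i)" if "i < length ?w" for i
  proof -
    have "rs ! i = ?w ! i" using that by (simp add: takeWhile_nth)
    moreover have "?w ! i \<noteq> Blank" using that nth_mem set_takeWhileD by fastforce
    moreover have "i < length rs" using that length_takeWhile_le order_less_le_trans by blast
    ultimately show ?thesis
      using R[of i] that by (auto simp: tm_output_def cell_def split: sym.splits)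
  qed
  moreover have "T (p + int (length ?w)) = Blank"
    using R[of "length ?w"] nth_length_takeWhile[of "\<lambda>s. s \<noteq> Blank" rs]
    by (auto simp: cell_def)
  ultimately show ?thesis by (simp add: reads_def tm_output_def)
qed

definition input_tape :: "bool list \<Rightarrow> tape" where
  "input_tape x i = (if 0 \<le> i \<and> i < int (length x) then Bit (x ! nat i) else Blank)"

lemma on_tape_init: "on_tape (tm_init x) (0, input_tape x, 0)"
  by (auto simp: on_tape_def tm_init_def input_tape_def cell_def)

lemma computes_in_time_iff:
  "computes_in_time M f T \<longleftrightarrow>
     (\<forall>x. \<exists>t\<le>T (length x). \<exists>T' p. (atm_step M ^^ t) (0, input_tape x, 0) = (fst (snd M), T', p)
        \<and> reads T' p (f x))"
proof -
  have "(fst ((tm_step M ^^ t) (tm_init x)) = fst (snd M) \<and> tm_output ((tm_step M ^^ t) (tm_init x)) = f x)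
    \<longleftrightarrow> (\<exists>T' p. (atm_step M ^^ t) (0, input_tape x, 0) = (fst (snd M), T', p) \<and> reads T' p (f x))" for x t
  proof -
    obtain q ls rs where c: "(tm_step M ^^ t) (tm_init x) = (q, ls, rs)" by (metis prod_cases3)
    obtain q' T' p where a: "(atm_step M ^^ t) (0, input_tape x, 0) = (q', T', p)" by (metis prod_cases3)
    have ot: "on_tape (q, ls, rs) (q', T', p)"
      using on_tape_steps[OF on_tape_init[of x], where M = M and t = t] c a by simp
    then have "q = q'" by (simp add: on_tape_def)
    then show ?thesis using c a reads_tm_output[OF ot] reads_unique by auto
  qed
  then show ?thesis unfolding computes_in_time_def by presburger
qed

section \<open>Structured tape programs and their translation into machines\<close>

datatype 'w tcom =
    Act "'w \<Rightarrow> sym \<Rightarrow> 'w \<times> sym \<times> dir"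
  | TSeq "'w tcom" "'w tcom"
  | TIf "'w \<Rightarrow> sym \<Rightarrow> bool" "'w tcom" "'w tcom"
  | TWhile "'w \<Rightarrow> sym \<Rightarrow> bool" "'w tcom"

type_synonym 'w row = "'w \<Rightarrow> sym \<Rightarrow> nat \<times> 'w \<times> sym \<times> dir"

primrec clen :: "'w tcom \<Rightarrow> nat" where
  "clen (Act f) = 1"
| "clen (TSeq a b) = clen a + clen b"
| "clen (TIf P a b) = clen a + clen b + 2"
| "clen (TWhile P a) = clen a + 2"

text \<open>The rows of a command occupy the addresses from \<open>i\<close> on, and control leaves
  it for address \<open>i + clen c\<close>. Test and jump rows leave tape, head and control as they
  are.\<close>

primrec code :: "nat \<Rightarrow> 'w tcom \<Rightarrow> 'w row list" where
  "code i (Act f) = [\<lambda>w s. (i + 1, f w s)]"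
| "code i (TSeq a b) = code i a @ code (i + clen a) b"
| "code i (TIf P a b) =
     (\<lambda>w s. (if P w s then i + 1 else i + clen a + 2, w, s, Stay)) # code (i + 1) a @
     (\<lambda>w s. (i + clen a + clen b + 2, w, s, Stay)) # code (i + clen a + 2) b"
| "code i (TWhile P a) =
     (\<lambda>w s. (if P w s then i + 1 else i + clen a + 2, w, s, Stay)) # code (i + 1) a @
     [\<lambda>w s. (i, w, s, Stay)]"

lemma length_code [simp]: "length (code i c) = clen c"
  by (induction c arbitrary: i) simp_all

lemma code_target: "r \<in> set (code i c) \<Longrightarrow> fst (r w s) \<le> i + clen c"
proof (induction c arbitrary: i)
  case (TSeq a b) then show ?case by fastforce
next
  case (TIf P a b)
  then show ?case by (fastforce split: if_splits)
next
  case (TWhile P a)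
  then show ?case by (fastforce split: if_splits)
qed simp

definition cstep :: "'w row list \<Rightarrow> nat \<times> 'w \<times> tape \<times> int \<Rightarrow> nat \<times> 'w \<times> tape \<times> int" where
  "cstep cd a = (case a of (pc, w, T, p) \<Rightarrow>
     if pc < length cd
     then (case (cd ! pc) w (T p) of (pc', w', b, d) \<Rightarrow> (pc', w', T(p := b), p + shift d))
     else a)"

text \<open>Addresses are absolute, so a command is judged inside every surrounding program; this
  makes the rules below compositional.\<close>

definition runs :: "'w tcom \<Rightarrow> nat \<Rightarrow> 'w \<times> tape \<times> int \<Rightarrow> 'w \<times> tape \<times> int \<Rightarrow> bool" where
  "runs c B s s' \<longleftrightarrow> (\<forall>pre post. \<exists>t\<le>B.
     (cstep (pre @ code (length pre) c @ post) ^^ t) (length pre, s) = (length pre + clen c, s'))"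

lemma runs_mono: "runs c B s s' \<Longrightarrow> B \<le> B' \<Longrightarrow> runs c B' s s'"
  unfolding runs_def by (meson order_trans)

lemma funpow_trans: "(f ^^ t) a = b \<Longrightarrow> (f ^^ u) b = c \<Longrightarrow> (f ^^ (t + u)) a = c"
  by (subst add.commute) (simp add: funpow_add)

lemma runs_Act:
  assumes "f w (T p) = (w', b, d)"
  shows "runs (Act f) 1 (w, T, p) (w', T(p := b), p + shift d)"
  unfolding runs_def
proof (intro allI exI conjI)
  fix pre post :: "'a row list"
  show "(cstep (pre @ code (length pre) (Act f) @ post) ^^ 1) (length pre, w, T, p)
    = (length pre + clen (Act f), w', T(p := b), p + shift d)"
    using assms by (simp add: cstep_def nth_append)
qed simp

lemma runs_TSeq:
  assumes "runs a A s s'" "runs b B s' s''"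
  shows "runs (TSeq a b) (A + B) s s''"
  unfolding runs_def
proof (intro allI)
  fix pre post :: "'a row list"
  let ?cd = "pre @ code (length pre) (TSeq a b) @ post"
  obtain t where t: "t \<le> A" "(cstep ?cd ^^ t) (length pre, s) = (length pre + clen a, s')"
    using assms(1)[unfolded runs_def, rule_format, of pre "code (length pre + clen a) b @ post"]
    by auto
  obtain u where u: "u \<le> B" "(cstep ?cd ^^ u) (length pre + clen a, s') = (length pre + clen a + clen b, s'')"
    using assms(2)[unfolded runs_def, rule_format, of "pre @ code (length pre) a" post]
    by auto
  show "\<exists>t\<le>A + B. (cstep ?cd ^^ t) (length pre, s) = (length pre + clen (TSeq a b), s'')"
    using funpow_trans[OF t(2) u(2)] t(1) u(1) by (intro exI[of _ "t + u"]) simp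
qed

text \<open>The summand 2 pays for the test and, after the first branch, for the jump over the
  second.\<close>

lemma runs_TIf:
  assumes "if P w (T p) then runs a B (w, T, p) s' else runs b B (w, T, p) s'"
  shows "runs (TIf P a b) (B + 2) (w, T, p) s'"
  unfolding runs_def
proof (intro allI)
  fix pre post :: "'a row list"
  let ?i = "length pre"
  let ?cd = "pre @ code ?i (TIf P a b) @ post"
  let ?test = "\<lambda>w s. (if P w s then ?i + 1 else ?i + clen a + 2, w, s, Stay)"
  let ?jump = "\<lambda>w s. (?i + clen a + clen b + 2, w, s, Stay)"
  have e: "(cstep ?cd ^^ 1) (?i, w, T, p) = (if P w (T p) then ?i + 1 else ?i + clen a + 2, w, T, p)"
    by (simp add: cstep_def nth_append)
  show "\<exists>t\<le>B + 2. (cstep ?cd ^^ t) (?i, w, T, p) = (?i + clen (TIf P a b), s')"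
  proof (cases "P w (T p)")
    case True
    have "?cd = (pre @ [?test]) @ code (?i + 1) a @ (?jump # code (?i + clen a + 2) b @ post)"
      by simp
    then obtain t where t: "t \<le> B" "(cstep ?cd ^^ t) (?i + 1, w, T, p) = (?i + 1 + clen a, s')"
      using assms[unfolded runs_def] True
      by (metis (no_types, lifting) length_append_singleton Suc_eq_plus1)
    have j: "(cstep ?cd ^^ 1) (?i + 1 + clen a, s') = (?i + clen a + clen b + 2, s')"
      by (cases s') (simp add: cstep_def nth_append)
    show ?thesis using funpow_trans[OF funpow_trans[OF e[unfolded if_P[OF True]] t(2)] j] t(1)
      by (intro exI[of _ "1 + t + 1"]) simp
  next
    case False
    have "?cd = (pre @ ?test # code (?i + 1) a @ [?jump]) @ code (?i + clen a + 2) b @ post"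
      by simp
    moreover have "length (pre @ ?test # code (?i + 1) a @ [?jump]) = ?i + clen a + 2" by simp
    ultimately obtain t where t: "t \<le> B"
        "(cstep ?cd ^^ t) (?i + clen a + 2, w, T, p) = (?i + clen a + 2 + clen b, s')"
      using assms[unfolded runs_def] False by (metis (no_types, lifting))
    show ?thesis using funpow_trans[OF e[unfolded if_not_P[OF False]] t(2)] t(1)
      by (intro exI[of _ "1 + t"]) simp
  qed
qed

lemma runs_TWhile_done:
  assumes "\<not> P w (T p)"
  shows "runs (TWhile P a) 1 (w, T, p) (w, T, p)"
  unfolding runs_def
proof (intro allI exI conjI)
  fix pre post :: "'a row list"
  show "(cstep (pre @ code (length pre) (TWhile P a) @ post) ^^ 1) (length pre, w, T, p)
    = (length pre + clen (TWhile P a), w, T, p)"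
    using assms by (simp add: cstep_def nth_append)
qed simp

lemma runs_TWhile_step:
  assumes "P w (T p)" "runs a A (w, T, p) s'" "runs (TWhile P a) B s' s''"
  shows "runs (TWhile P a) (A + B + 2) (w, T, p) s''"
  unfolding runs_def
proof (intro allI)
  fix pre post :: "'a row list"
  let ?i = "length pre"
  let ?cd = "pre @ code ?i (TWhile P a) @ post"
  let ?test = "\<lambda>w s. (if P w s then ?i + 1 else ?i + clen a + 2, w, s, Stay)"
  let ?jump = "\<lambda>w s. (?i, w, s, Stay)"
  have e: "(cstep ?cd ^^ 1) (?i, w, T, p) = (?i + 1, w, T, p)"
    using assms(1) by (simp add: cstep_def nth_append)
  have "?cd = (pre @ [?test]) @ code (?i + 1) a @ (?jump # post)"
    by simp
  then obtain t where t: "t \<le> A" "(cstep ?cd ^^ t) (?i + 1, w, T, p) = (?i + 1 + clen a, s')"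
    using assms(2)[unfolded runs_def]
    by (metis (no_types, lifting) length_append_singleton Suc_eq_plus1)
  have j: "(cstep ?cd ^^ 1) (?i + 1 + clen a, s') = (?i, s')"
    by (cases s') (simp add: cstep_def nth_append)
  obtain u where u: "u \<le> B" "(cstep ?cd ^^ u) (?i, s') = (?i + clen (TWhile P a), s'')"
    using assms(3)[unfolded runs_def] by blast
  show "\<exists>t\<le>A + B + 2. (cstep ?cd ^^ t) (?i, w, T, p) = (?i + clen (TWhile P a), s'')"
    using funpow_trans[OF funpow_trans[OF funpow_trans[OF e t(2)] j] u(2)] t(1) u(1)
    by (intro exI[of _ "1 + t + 1 + u"]) simp
qed

text \<open>A machine state packs address and control into the number \<open>pc * V + e w\<close>.
  There is only one halting state, so the run must end with the fixed control \<open>w0\<close>; the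
  start state 0 stands for address 0 with an unknown control, so the run has to succeed from every
  control.\<close>

lemma tcom_machine:
  fixes c :: "'w::finite tcom" and w0 :: 'w
  obtains M where "valid_tm M"
    "\<And>T p B T' p'. (\<And>w. runs c B (w, T, p) (w0, T', p')) \<Longrightarrow>
      \<exists>t\<le>B. (atm_step M ^^ t) (0, T, p) = (fst (snd M), T', p')"
proof -
  define V where "V = card (UNIV :: 'w set)"
  obtain e :: "'w \<Rightarrow> nat" where e: "bij_betw e UNIV {0..<V}"
    using ex_bij_betw_finite_nat[of "UNIV :: 'w set"] by (auto simp: V_def)
  have inj: "inj e" using e by (simp add: bij_betw_def)
  have eV: "e w < V" for w using e by (auto simp: bij_betw_def)
  define dec where "dec = inv e"
  have dec: "dec (e w) = w" for w by (simp add: dec_def inj)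
  have V0: "V > 0" using eV[of w0] by simp
  have "0 \<in> range e" using e V0 by (simp add: bij_betw_def)
  then have e0: "e (dec 0) = 0" unfolding dec_def by (rule f_inv_into_f)
  define cd where "cd = code 0 c"
  define L where "L = clen c"
  have lcd: "length cd = L" by (simp add: cd_def L_def)
  define st where "st pc w = pc * V + e w" for pc w
  have div_st: "st pc w div V = pc" and mod_st: "st pc w mod V = e w" for pc w
    using eV[of w] by (simp_all add: st_def)
  have st_lt: "st pc w < (L + 1) * V" if "pc \<le> L" for pc w
  proof -
    have "pc * V + e w < pc * V + V" using eV by simp
    also have "\<dots> \<le> (L + 1) * V" using that by (simp add: algebra_simps)
    finally show ?thesis by (simp add: st_def)
  qed
  define h where "h = st L w0"
  define \<delta> where "\<delta> q s = (if q div V < L then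
      (case (cd ! (q div V)) (dec (q mod V)) s of (pc, w, b, d) \<Rightarrow> (st pc w, b, d))
      else (q, s, Stay))" for q s
  define M where "M = ((L + 1) * V, h, \<delta>)"
  have tgt: "fst ((cd ! pc) w s) \<le> L" if "pc < L" for pc w s
    using code_target[of "cd ! pc" 0 c w s] that lcd unfolding cd_def[symmetric] L_def[symmetric]
    by (metis add_0 nth_mem)
  have "valid_tm M"
  proof -
    have "fst (\<delta> q s) < (L + 1) * V" if "q < (L + 1) * V" for q s
    proof (cases "q div V < L")
      case True
      obtain pc w b d where r: "(cd ! (q div V)) (dec (q mod V)) s = (pc, w, b, d)"
        by (metis prod_cases4)
      then have "pc \<le> L" using tgt[OF True, of "dec (q mod V)" s] by simp
      then show ?thesis using True r st_lt by (simp add: \<delta>_def)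
    next
      case False then show ?thesis using that by (simp add: \<delta>_def)
    qed
    moreover have "0 < (L + 1) * V" using V0 by simp
    moreover have "h < (L + 1) * V" unfolding h_def using st_lt by blast
    ultimately show ?thesis unfolding valid_tm_def M_def by auto
  qed
  have sim1: "atm_step M (st pc w, T, p) = (case cstep cd (pc, w, T, p) of (pc', w', T', p') \<Rightarrow> (st pc' w', T', p'))"
    and sim2: "fst (cstep cd (pc, w, T, p)) \<le> L" if "pc \<le> L" for pc w T p
  proof -
    obtain pc' w' b d where r: "(cd ! pc) w (T p) = (pc', w', b, d)" by (metis prod_cases4)
    show "atm_step M (st pc w, T, p) = (case cstep cd (pc, w, T, p) of (pc', w', T', p') \<Rightarrow> (st pc' w', T', p'))"
    proof (cases "pc < L")
      case True
      then have "st pc w \<noteq> h" using div_st h_def by (metis less_irrefl)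
      then show ?thesis using True r
        by (simp add: atm_step_def M_def \<delta>_def div_st mod_st dec cstep_def lcd)
    next
      case False
      then show ?thesis
        by (simp add: atm_step_def M_def \<delta>_def div_st mod_st dec cstep_def lcd)
    qed
    show "fst (cstep cd (pc, w, T, p)) \<le> L"
      using that tgt[of pc w "T p"] r by (auto simp: cstep_def lcd)
  qed
  have sim: "(atm_step M ^^ t) (st 0 w, T, p) = (case (cstep cd ^^ t) (0, w, T, p) of (pc', w', T', p') \<Rightarrow> (st pc' w', T', p'))
      \<and> fst ((cstep cd ^^ t) (0, w, T, p)) \<le> L" for t w T p
  proof (induction t)
    case (Suc t)
    obtain pc' w' T' p' where "(cstep cd ^^ t) (0, w, T, p) = (pc', w', T', p')" by (metis prod_cases4)
    then show ?case using Suc sim1[of pc' w' T' p'] sim2[of pc' w' T' p'] by simp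
  qed simp
  have "\<exists>t\<le>B. (atm_step M ^^ t) (0, T, p) = (fst (snd M), T', p')"
    if run: "\<And>w. runs c B (w, T, p) (w0, T', p')" for T p B T' p'
  proof -
    obtain t where t: "t \<le> B" "(cstep cd ^^ t) (0, dec 0, T, p) = (L, w0, T', p')"
      using run[of "dec 0", unfolded runs_def, rule_format, of "[]" "[]"] by (auto simp: cd_def L_def)
    have "st 0 (dec 0) = 0" by (simp add: st_def e0)
    then show ?thesis using sim[of t "dec 0" T p] t by (auto simp: M_def h_def)
  qed
  then show ?thesis using that \<open>valid_tm M\<close> by blast
qed

section \<open>Polynomial bounds\<close>

definition poly :: "(nat \<Rightarrow> nat) \<Rightarrow> bool" where
  "poly f \<longleftrightarrow> (\<exists>c k. \<forall>n. f n \<le> c * (n + 1) ^ k)"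

lemma poly_const: "poly (\<lambda>n. c)"
  unfolding poly_def by (rule exI[of _ c], rule exI[of _ 0]) simp

lemma poly_id: "poly (\<lambda>n. n)"
  unfolding poly_def by (rule exI[of _ 1], rule exI[of _ 1]) simp

text \<open>The base \<open>n + 1\<close> is positive, so both powers are at most the one with
  exponent \<open>k + l\<close>, also at \<open>n = 0\<close>.\<close>

lemma poly_add:
  assumes "poly f" "poly g" shows "poly (\<lambda>n. f n + g n)"
proof -
  obtain c k d l where f: "\<And>n. f n \<le> c * (n + 1) ^ k" and g: "\<And>n. g n \<le> d * (n + 1) ^ l"
    using assms unfolding poly_def by blast
  have "f n + g n \<le> (c + d) * (n + 1) ^ (k + l)" for n
  proof -
    have "f n \<le> c * (n + 1) ^ (k + l)"
      using f[of n] by (meson mult_le_mono2 order_trans power_increasing le_add1 le_add2)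
    moreover have "g n \<le> d * (n + 1) ^ (k + l)"
      using g[of n] by (meson mult_le_mono2 order_trans power_increasing le_add1 le_add2)
    ultimately show ?thesis by (simp add: algebra_simps)
  qed
  then show ?thesis unfolding poly_def by blast
qed

lemma poly_mult:
  assumes "poly f" "poly g" shows "poly (\<lambda>n. f n * g n)"
proof -
  obtain c k d l where f: "\<And>n. f n \<le> c * (n + 1) ^ k" and g: "\<And>n. g n \<le> d * (n + 1) ^ l"
    using assms unfolding poly_def by blast
  have "f n * g n \<le> (c * d) * (n + 1) ^ (k + l)" for n
    using mult_le_mono[OF f[of n] g[of n]] by (simp add: power_add algebra_simps)
  then show ?thesis unfolding poly_def by blast
qed

lemma poly_compose:
  assumes "poly f" "poly g" shows "poly (\<lambda>n. f (g n))"
proof -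
  obtain c k d l where f: "\<And>n. f n \<le> c * (n + 1) ^ k" and g: "\<And>n. g n \<le> d * (n + 1) ^ l"
    using assms unfolding poly_def by blast
  have "f (g n) \<le> (c * (d + 1) ^ k) * (n + 1) ^ (l * k)" for n
  proof -
    have "1 \<le> (n + 1) ^ l" by simp
    then have "g n + 1 \<le> (d + 1) * (n + 1) ^ l" using g[of n] unfolding add_mult_distrib by linarith
    then have "(g n + 1) ^ k \<le> ((d + 1) * (n + 1) ^ l) ^ k" by (rule power_mono) simp
    also have "\<dots> = (d + 1) ^ k * (n + 1) ^ (l * k)" by (simp only: power_mult_distrib power_mult)
    finally have "c * (g n + 1) ^ k \<le> c * ((d + 1) ^ k * (n + 1) ^ (l * k))" by (rule mult_le_mono2)
    with f[of "g n"] show ?thesis unfolding mult.assoc by (rule order_trans)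
  qed
  then show ?thesis unfolding poly_def by blast
qed

lemma poly_power: "poly (\<lambda>n. n ^ k)"
  by (induction k) (simp_all add: poly_const poly_mult poly_id)

text \<open>For positive \<open>n\<close> the base \<open>n + 1\<close> is at most
  \<open>2 * n\<close>; the added constant covers \<open>n = 0\<close>.\<close>

lemma poly_monomial_bound:
  assumes "poly f"
  shows "\<exists>c k. \<forall>n. f n \<le> c * n ^ k + c"
proof -
  obtain c k where f: "\<And>n. f n \<le> c * (n + 1) ^ k"
    using assms unfolding poly_def by blast
  have "f n \<le> c * 2 ^ k * n ^ k + c * 2 ^ k" for n
  proof -
    have "(n + 1) ^ k \<le> 2 ^ k * n ^ k + 2 ^ k"
    proof (cases "n = 0")
      case False
      then have "(n + 1) ^ k \<le> (2 * n) ^ k" by (intro power_mono) simp_all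
      then show ?thesis by (simp add: power_mult_distrib)
    qed (simp add: Suc_leI)
    then have "c * (n + 1) ^ k \<le> c * (2 ^ k * n ^ k + 2 ^ k)" by (rule mult_le_mono2)
    then show ?thesis using f[of n] by (simp add: algebra_simps)
  qed
  then show ?thesis by blast
qed

lemma poly_time_computableI:
  assumes "valid_tm M" "poly B"
    "\<And>x. \<exists>t\<le>B (length x). \<exists>T p. (atm_step M ^^ t) (0, input_tape x, 0) = (fst (snd M), T, p) \<and> reads T p (f x)"
  shows "poly_time_computable f"
proof -
  obtain c k where "\<And>n. B n \<le> c * n ^ k + c" using poly_monomial_bound[OF assms(2)] by blast
  then have "computes_in_time M f (\<lambda>n. c * n ^ k + c)"
    unfolding computes_in_time_iff using assms(3) by (meson order_trans)
  then show ?thesis unfolding poly_time_computable_def using assms(1) by blast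
qed

section \<open>Composition with a second machine\<close>

definition support :: "tape \<Rightarrow> int set" where
  "support T = {i. T i \<noteq> Blank}"

text \<open>Each step changes one cell. Hence a result is no longer than the input plus the running
  time, which bounds the time of the machine that runs next.\<close>

lemma support_atm_steps:
  assumes "(atm_step M ^^ t) (q, T, p) = (q', T', p')" "finite (support T)"
  shows "finite (support T') \<and> card (support T') \<le> card (support T) + t"
  using assms(1)
proof (induction t arbitrary: q' T' p')
  case (Suc t)
  obtain q1 T1 p1 where 1: "(atm_step M ^^ t) (q, T, p) = (q1, T1, p1)" by (metis prod_cases3)
  have IH: "finite (support T1)" "card (support T1) \<le> card (support T) + t"
    using Suc.IH[OF 1] by auto
  have "atm_step M (q1, T1, p1) = (q', T', p')" using Suc.prems 1 by simp
  then have "support T' \<subseteq> insert p1 (support T1)"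
    by (auto simp: atm_step_def support_def split: prod.splits if_splits)
  then have "card (support T') \<le> card (insert p1 (support T1)) \<and> finite (support T')"
    using IH by (simp add: card_mono finite_subset)
  moreover have "card (insert p1 (support T1)) \<le> Suc (card (support T1))"
    using IH by (simp add: card_insert_if)
  ultimately show ?case using IH by linarith
qed (use assms(2) in simp)

lemma reads_length_le:
  assumes "reads T p y" "finite (support T)"
  shows "length y \<le> card (support T)"
proof -
  have "(\<lambda>i. p + int i) ` {..<length y} \<subseteq> support T"
    using assms(1) by (auto simp: reads_def support_def)
  then have "card ((\<lambda>i. p + int i) ` {..<length y}) \<le> card (support T)"
    using assms(2) by (rule card_mono[rotated])
  moreover have "inj_on (\<lambda>i. p + int i) {..<length y}" by (auto simp: inj_on_def)
  ultimately show ?thesis by (simp add: card_image)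
qed

lemma support_input_tape: "finite (support (input_tape x)) \<and> card (support (input_tape x)) = length x"
proof -
  have "support (input_tape x) = {0..<int (length x)}"
    by (auto simp: support_def input_tape_def)
  then show ?thesis by simp
qed

text \<open>The second machine is started on whatever the first one leaves behind, so it has to work
  on every tape on which its argument can be read, whatever surrounds it.\<close>
lemma poly_time_computable_compose:
  assumes f: "poly_time_computable f"
    and M2: "valid_tm M2" "poly B"
      "\<And>T p y. reads T p y \<Longrightarrow>
        \<exists>t\<le>B (length y). \<exists>T' p'. (atm_step M2 ^^ t) (0, T, p) = (fst (snd M2), T', p') \<and> reads T' p' (g y)"
    and mono: "mono B"
  shows "poly_time_computable (\<lambda>x. g (f x))"
proof -
  obtain M1 c k where M1: "valid_tm M1" "computes_in_time M1 f (\<lambda>n. c * n ^ k + c)"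
    using f unfolding poly_time_computable_def by blast
  define A where "A n = c * n ^ k + c" for n
  obtain n1 h1 \<delta>1 where M1_eq: "M1 = (n1, h1, \<delta>1)" by (cases M1)
  obtain n2 h2 \<delta>2 where M2_eq: "M2 = (n2, h2, \<delta>2)" by (cases M2)
  have v1: "0 < n1" "h1 < n1" "\<And>q a. q < n1 \<Longrightarrow> fst (\<delta>1 q a) < n1"
    using M1(1) by (auto simp: valid_tm_def M1_eq)
  have v2: "0 < n2" "h2 < n2" "\<And>q a. q < n2 \<Longrightarrow> fst (\<delta>2 q a) < n2"
    using M2(1) by (auto simp: valid_tm_def M2_eq)
  \<comment> \<open>The halting state of the first machine becomes a silent move to
    \<open>n1\<close>, the shifted start state of the second.\<close>
  define \<delta> where "\<delta> q a = (if q < n1 then if q = h1 then (n1, a, Stay) else \<delta>1 q a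
     else case \<delta>2 (q - n1) a of (q', b, d) \<Rightarrow> (n1 + q', b, d))" for q a
  define M where "M = (n1 + n2, n1 + h2, \<delta>)"
  have valid: "valid_tm M"
  proof -
    have "fst (\<delta> q a) < n1 + n2" if "q < n1 + n2" for q a
    proof (cases "q < n1")
      case True then show ?thesis using v1(3)[of q a] v2(1) by (auto simp: \<delta>_def)
    next
      case False
      then have "q - n1 < n2" using that by simp
      then show ?thesis using False v2(3)[of "q - n1" a] by (auto simp: \<delta>_def split: prod.splits)
    qed
    then show ?thesis using v1 v2 by (simp add: valid_tm_def M_def)
  qed
  have first: "atm_step M (q, T, p) = atm_step M1 (q, T, p)" "fst (atm_step M1 (q, T, p)) < n1"
    if "q < n1" "q \<noteq> h1" for q T p
    using that v1(3)[of q "T p"] by (auto simp: atm_step_def M_def M1_eq \<delta>_def split: prod.splits)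
  have second: "(atm_step M ^^ t) (n1 + q, T, p) =
      (case (atm_step M2 ^^ t) (q, T, p) of (q', T', p') \<Rightarrow> (n1 + q', T', p'))" for t q T p
  proof (induction t)
    case (Suc t)
    obtain q' T' p' where "(atm_step M2 ^^ t) (q, T, p) = (q', T', p')" by (metis prod_cases3)
    then show ?case using Suc
      by (auto simp: atm_step_def M_def M2_eq \<delta>_def split: prod.splits)
  qed simp
  have "\<exists>t\<le>A n + 1 + B (n + A n). \<exists>T p. (atm_step M ^^ t) (0, input_tape x, 0) = (fst (snd M), T, p) \<and> reads T p (g (f x))"
    if n: "n = length x" for x n
  proof -
    let ?a = "(0, input_tape x, 0)"
    let ?run = "\<lambda>t. (atm_step M1 ^^ t) ?a"
    obtain t1 T1 p1 where t1: "t1 \<le> A n" "?run t1 = (h1, T1, p1)" "reads T1 p1 (f x)"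
      using M1(2) unfolding computes_in_time_iff n A_def M1_eq by force
    \<comment> \<open>The composite machine leaves \<open>h1\<close> at the first visit, whereas
      \<open>t1\<close> is just some time at which \<open>M1\<close> is there. Nothing changes
      between the two times.\<close>
    define u where "u = (LEAST t. fst (?run t) = h1)"
    have u: "fst (?run u) = h1" unfolding u_def by (rule LeastI[of _ t1]) (simp add: t1)
    have before: "fst (?run s) \<noteq> h1" if "s < u" for s using not_less_Least that unfolding u_def by blast
    have ut1: "u \<le> t1" unfolding u_def by (rule Least_le) (simp add: t1)
    have absorb: "(atm_step M1 ^^ s) (h1, T, p) = (h1, T, p)" for s T p
      by (induction s) (simp_all add: atm_step_def M1_eq)
    have u_run: "?run u = (h1, T1, p1)"
    proof -
      obtain T p where e: "?run u = (h1, T, p)" using u by (metis prod_cases3 fst_conv)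
      have "?run (u + (t1 - u)) = (h1, T, p)" using funpow_trans[OF e absorb] .
      then show ?thesis using e t1(2) ut1 by simp
    qed
    have "(atm_step M ^^ s) ?a = ?run s \<and> fst (?run s) < n1" if "s \<le> u" for s
      using that
    proof (induction s)
      case (Suc s)
      then show ?case using before[of s] first by (cases "?run s") auto
    qed (use v1 in simp)
    then have 1: "(atm_step M ^^ u) ?a = (h1, T1, p1)" using u_run by simp
    have 2: "(atm_step M ^^ 1) (h1, T1, p1) = (n1 + 0, T1, p1)"
      using v1 by (simp add: atm_step_def M_def \<delta>_def)
    obtain t2 T2 p2 where t2: "t2 \<le> B (length (f x))"
        "(atm_step M2 ^^ t2) (0, T1, p1) = (h2, T2, p2)" "reads T2 p2 (g (f x))"
      using M2(3)[OF t1(3)] by (auto simp: M2_eq)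
    have 3: "(atm_step M ^^ t2) (n1 + 0, T1, p1) = (n1 + h2, T2, p2)"
      unfolding second t2(2) by simp
    have "length (f x) \<le> n + A n"
      using support_atm_steps[OF t1(2)] support_input_tape[of x] reads_length_le[OF t1(3)] t1(1) n by simp
    then have "B (length (f x)) \<le> B (n + A n)" using mono by (rule monoD[rotated])
    then show ?thesis
      using funpow_trans[OF funpow_trans[OF 1 2] 3] ut1 t1(1) t2
      by (intro exI[of _ "u + 1 + t2"]) (auto simp: M_def)
  qed
  moreover have "poly (\<lambda>n. A n + 1 + B (n + A n))"
    unfolding A_def by (intro poly_add poly_compose[OF M2(2)] poly_const poly_mult poly_power poly_id)
  ultimately show ?thesis
    by (intro poly_time_computableI[OF valid, where B = "\<lambda>n. A n + 1 + B (n + A n)"]) simp_all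
qed

section \<open>Codes\<close>

declare bin.simps [simp del]

lemma bin_0 [simp]: "bin 0 = []"
  by (simp add: bin.simps)

lemma bin_pos: "0 < n \<Longrightarrow> bin n = bin (n div 2) @ [odd n]"
  by (simp add: bin.simps)

lemma bin_inject: "bin m = bin n \<longleftrightarrow> m = n"
proof
  show "bin m = bin n \<Longrightarrow> m = n"
  proof (induction m arbitrary: n rule: less_induct)
    case (less m)
    show ?case
    proof (cases "m = 0 \<or> n = 0")
      case True
      then show ?thesis using less.prems by (metis append_is_Nil_conv bin_0 bin_pos gr_zeroI not_Cons_self2)
    next
      case False
      then have e: "bin (m div 2) = bin (n div 2)" "odd m = odd n"
        using less.prems by (simp_all add: bin_pos)
      have "m div 2 = n div 2" using less.IH[OF _ e(1)] False by simp
      then show ?thesis using e(2) by (metis bit_eq_rec div_by_1 even_iff_mod_2_eq_zero odd_iff_mod_2_eq_one div_mult_mod_eq)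
    qed
  qed
qed simp

lemma enc_digits_append_inject:
  "concat (map (\<lambda>b. [True, b]) xs) @ False # s = concat (map (\<lambda>b. [True, b]) ys) @ False # t
   \<longleftrightarrow> xs = ys \<and> s = t"
proof (induction xs arbitrary: ys)
  case Nil then show ?case by (cases ys) auto
next
  case (Cons x xs) then show ?case by (cases ys) auto
qed

lemma enc_nat_append_inject: "enc_nat m @ s = enc_nat n @ t \<longleftrightarrow> m = n \<and> s = t"
  by (simp add: enc_nat_def enc_digits_append_inject bin_inject)

text \<open>Prefix notation joins the codes of two arguments without a separator, so the induction
  has to carry arbitrary tails.\<close>

lemma enc_form_append_inject: "enc_form p @ s = enc_form q @ t \<longleftrightarrow> p = q \<and> s = t"
proof (induction p arbitrary: q s t)
  case (Var i) then show ?case by (cases q) (auto simp: enc_nat_append_inject)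
next
  case (Neg p) then show ?case by (cases q) auto
next
  case (Conj p1 p2) then show ?case by (cases q) auto
next
  case (Disj p1 p2) then show ?case by (cases q) auto
qed

lemma enc1_inject: "enc1 P = enc1 Q \<longleftrightarrow> P = Q"
  using enc_form_append_inject[of "snd P" "[]" "snd Q" "[]"]
  by (auto simp: enc1_def enc_nat_append_inject prod_eq_iff)

lemma enc2_inject: "enc2 P = enc2 Q \<longleftrightarrow> P = Q"
  using enc_form_append_inject[of "snd (snd P)" "[]" "snd (snd Q)" "[]"]
  by (auto simp: enc2_def enc_nat_append_inject prod_eq_iff)

lemma MaxVAL_enc1:
  "valid1 (m, p) \<Longrightarrow> MaxVAL (enc1 (m, p)) = MaxVAL_fun m (\<lambda>x. eval p (\<lambda>i. x ! i))"
  using the_equality[of "\<lambda>q. valid1 q \<and> q = (m, p)" "(m, p)"]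
  by (simp add: MaxVAL_def enc1_inject)

lemma UVAL2_enc2:
  "valid2 (m, m', p) \<Longrightarrow> UVAL2 (enc2 (m, m', p)) = UVAL2_fun m m' (\<lambda>x y. eval p (\<lambda>i. (x @ y) ! i))"
  using the_equality[of "\<lambda>q. valid2 q \<and> q = (m, m', p)" "(m, m', p)"]
  by (simp add: UVAL2_def enc2_inject)

lemma eval_cong:
  "vars_below m p \<Longrightarrow> (\<And>i. i < m \<Longrightarrow> \<sigma> i = \<tau> i) \<Longrightarrow> eval p \<sigma> = eval p \<tau>"
  by (induction p) auto

text \<open>The states of an automaton reading \<open>enc_form\<close>: at the first or second bit
  of a token, at a continuation bit of a number, at a digit. In prefix notation a completed leaf is
  followed by a new token or the end, so the role of each bit is known without a stack.\<close>

datatype phase = Tok | Tok2 bool | Mark | Digit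

instance phase :: finite
proof
  have "UNIV \<subseteq> {Tok, Tok2 True, Tok2 False, Mark, Digit}"
  proof
    fix x show "x \<in> {Tok, Tok2 True, Tok2 False, Mark, Digit}"
      by (cases x) auto
  qed
  then show "finite (UNIV :: phase set)"
    by (rule finite_subset) simp
qed

fun next_phase :: "phase \<Rightarrow> bool \<Rightarrow> phase" where
  "next_phase Tok b = Tok2 b"
| "next_phase (Tok2 a) b = (if a \<or> b then Tok else Mark)"
| "next_phase Mark b = (if b then Digit else Tok)"
| "next_phase Digit b = Mark"

section \<open>Register programs\<close>

datatype 'v com =
    Upd "'v \<Rightarrow> 'v"
  | Push nat "'v \<Rightarrow> bool"
  | Pop nat "bool option \<Rightarrow> 'v \<Rightarrow> 'v"
  | Seq "'v com" "'v com"
  | Cond "'v \<Rightarrow> bool" "'v com" "'v com"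
  | For nat "bool \<Rightarrow> 'v \<Rightarrow> 'v" "'v com"

type_synonym 'v state = "'v \<times> (nat \<Rightarrow> bool list)"

text \<open>A \<open>For\<close> loop takes the contents of its register at entry, from the top,
  without consuming them. \<open>Pop\<close> on an empty register only reports \<open>None\<close>,
  so it may be repeated too often.\<close>

primrec exec :: "'v com \<Rightarrow> 'v state \<Rightarrow> 'v state" where
  "exec (Upd g) s = (g (fst s), snd s)"
| "exec (Push r f) s = (fst s, (snd s)(r := f (fst s) # snd s r))"
| "exec (Pop r f) s = (case snd s r of [] \<Rightarrow> (f None (fst s), snd s)
     | b # bs \<Rightarrow> (f (Some b) (fst s), (snd s)(r := bs)))"
| "exec (Seq a b) s = exec b (exec a s)"
| "exec (Cond P a b) s = (if P (fst s) then exec a s else exec b s)"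
| "exec (For r f c) s = fold (\<lambda>b s. exec c (f b (fst s), snd s)) (snd s r) s"

primrec regs :: "'v com \<Rightarrow> nat set" where
  "regs (Upd g) = {}"
| "regs (Push r f) = {r}"
| "regs (Pop r f) = {r}"
| "regs (Seq a b) = regs a \<union> regs b"
| "regs (Cond P a b) = regs a \<union> regs b"
| "regs (For r f c) = insert r (regs c)"

primrec writes :: "'v com \<Rightarrow> nat set" where
  "writes (Upd g) = {}"
| "writes (Push r f) = {r}"
| "writes (Pop r f) = {r}"
| "writes (Seq a b) = writes a \<union> writes b"
| "writes (Cond P a b) = writes a \<union> writes b"
| "writes (For r f c) = writes c"

primrec fors :: "'v com \<Rightarrow> nat set" where
  "fors (Upd g) = {}"
| "fors (Push r f) = {}"
| "fors (Pop r f) = {}"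
| "fors (Seq a b) = fors a \<union> fors b"
| "fors (Cond P a b) = fors a \<union> fors b"
| "fors (For r f c) = insert r (fors c)"

text \<open>No loop inside a loop body runs over a register that the body changes; this is what
  makes the running time polynomial.\<close>
primrec wf_com :: "'v com \<Rightarrow> bool" where
  "wf_com (Upd g) = True"
| "wf_com (Push r f) = True"
| "wf_com (Pop r f) = True"
| "wf_com (Seq a b) = (wf_com a \<and> wf_com b)"
| "wf_com (Cond P a b) = (wf_com a \<and> wf_com b)"
| "wf_com (For r f c) = (wf_com c \<and> r \<notin> regs c \<and> writes c \<inter> fors c = {})"

text \<open>The number of register operations, given a bound \<open>M\<close> on the initial lengths of the
  registers in \<open>fors c\<close>.\<close>
primrec cost :: "'v com \<Rightarrow> nat \<Rightarrow> nat" where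
  "cost (Upd g) M = 1"
| "cost (Push r f) M = 1"
| "cost (Pop r f) M = 1"
| "cost (Seq a b) M = cost a M + cost b (M + cost a M)"
| "cost (Cond P a b) M = cost a M + cost b M + 1"
| "cost (For r f c) M = M * (cost c M + 7) + 4"

lemma poly_cost: "poly (cost c)"
proof (induction c)
  case (Seq a b)
  have "poly (\<lambda>M. cost a M + cost b (M + cost a M))"
    by (intro poly_add Seq.IH(1) poly_compose[OF Seq.IH(2)] poly_id)
  then show ?case by simp
next
  case (Cond P a b)
  have "poly (\<lambda>M. cost a M + cost b M + 1)" by (intro poly_add Cond.IH poly_const)
  then show ?case by simp
next
  case (For r f c)
  have "poly (\<lambda>M. M * (cost c M + 7) + 4)" by (intro poly_add poly_mult For.IH poly_const poly_id)
  then show ?case by simp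
qed (simp_all add: poly_const)

lemma writes_subset_regs: "writes c \<subseteq> regs c"
  by (induction c) auto

lemma fors_subset_regs: "fors c \<subseteq> regs c"
  by (induction c) auto

lemma exec_unwritten: "j \<notin> writes c \<Longrightarrow> snd (exec c s) j = snd s j"
proof (induction c arbitrary: s)
  case (For r f c)
  have "snd (fold (\<lambda>b s. exec c (f b (fst s), snd s)) xs s) j = snd s j" for xs
    using For by (induction xs arbitrary: s) simp_all
  then show ?case by simp
qed (auto split: list.splits)

text \<open>During a compiled loop the tape has the loop register partly emptied into a spare one,
  while the abstract state keeps it whole. The body cannot notice the difference.\<close>

lemma exec_frame:
  "r \<notin> regs c \<Longrightarrow> exec c (v, R(r := z)) = (fst (exec c (v, R)), (snd (exec c (v, R)))(r := z))"
proof (induction c arbitrary: v R)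
  case (Seq a b)
  then show ?case by (metis UnCI exec.simps(4) prod.collapse regs.simps(4))
next
  case (For q f c)
  have "fold (\<lambda>b s. exec c (f b (fst s), snd s)) xs (v, R(r := z)) =
     (fst (fold (\<lambda>b s. exec c (f b (fst s), snd s)) xs (v, R)),
      (snd (fold (\<lambda>b s. exec c (f b (fst s), snd s)) xs (v, R)))(r := z))" for xs
    using For by (induction xs arbitrary: v R) simp_all
  from this[of "R q"] show ?case using For.prems by (simp del: fun_upd_apply add: fun_upd_other)
qed (auto split: list.splits simp: fun_upd_twist)

text \<open>Every operation adds at most one bit to a register. In a loop the same \<open>M\<close>
  bounds the inner loop registers in all rounds, since the body does not write them.\<close>

lemma exec_length:
  "wf_com c \<Longrightarrow> (\<And>r. r \<in> fors c \<Longrightarrow> length (snd s r) \<le> M) \<Longrightarrow>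
    length (snd (exec c s) j) \<le> length (snd s j) + cost c M"
proof (induction c arbitrary: s M j)
  case (Seq a b)
  have a: "length (snd (exec a s) j) \<le> length (snd s j) + cost a M" for j
    using Seq by simp
  then have "length (snd (exec a s) r) \<le> M + cost a M" if "r \<in> fors b" for r
    using Seq.prems(2)[of r] that by (simp add: le_trans[OF a])
  then have "length (snd (exec b (exec a s)) j) \<le> length (snd (exec a s) j) + cost b (M + cost a M)"
    using Seq by simp
  then show ?case using a[of j] by simp
next
  case (Cond P a b)
  have "length (snd (exec a s) j) \<le> length (snd s j) + cost a M"
    "length (snd (exec b s) j) \<le> length (snd s j) + cost b M"
    using Cond by simp_all
  then show ?case by simp
next
  case (For r f c)
  have "length (snd (fold (\<lambda>b s. exec c (f b (fst s), snd s)) xs s) j) \<le> length (snd s j) + length xs * cost c M"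
    if "\<And>r. r \<in> fors c \<Longrightarrow> length (snd s r) \<le> M" for xs s
    using that
  proof (induction xs arbitrary: s)
    case (Cons b xs)
    have *: "snd (exec c (f b (fst s), snd s)) r = snd s r" if "r \<in> fors c" for r
      using exec_unwritten[of r c "(f b (fst s), snd s)"] that For.prems(1) by auto
    let ?s = "exec c (f b (fst s), snd s)"
    have "length (snd ?s j) \<le> length (snd s j) + cost c M"
      using For.IH[of "(f b (fst s), snd s)" M j] For.prems(1) Cons.prems by simp
    moreover have "length (snd (fold (\<lambda>b s. exec c (f b (fst s), snd s)) xs ?s) j)
        \<le> length (snd ?s j) + length xs * cost c M"
      by (rule Cons.IH) (simp add: * Cons.prems)
    ultimately show ?case by simp
  qed simp
  then have "length (snd (exec (For r f c) s) j) \<le> length (snd s j) + length (snd s r) * cost c M"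
    using For.prems(2) by simp
  also have "length (snd s r) * cost c M \<le> M * (cost c M + 7)"
    using For.prems(2)[of r] by (intro mult_le_mono) simp_all
  finally show ?case by simp
qed (auto split: list.splits)


subsection \<open>Interleaving the registers on the tape\<close>

text \<open>Register 0 occupies the cells 0, 1, 2, ... and register \<open>j\<close> with \<open>0 < j < K\<close> every
  \<open>K\<close>-th cell to the left, with the bottom of the stack nearest to the middle. Slot 0 of each
  register is always blank, so that the way back can be found.\<close>
definition pos :: "nat \<Rightarrow> nat \<Rightarrow> nat \<Rightarrow> int" where
  "pos K j t = (if j = 0 then int t - 1 else - 1 - int j - int (K * t))"

definition slot :: "bool list \<Rightarrow> nat \<Rightarrow> sym" where
  "slot xs t = (case t of 0 \<Rightarrow> Blank | Suc i \<Rightarrow> if i < length xs then Bit (rev xs ! i) else Blank)"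

definition holds :: "nat \<Rightarrow> (nat \<Rightarrow> bool list) \<Rightarrow> tape \<Rightarrow> bool" where
  "holds K R T \<longleftrightarrow> (\<forall>j<K. \<forall>t. T (pos K j t) = slot (R j) t)"

text \<open>Register 0 extends from cell \<open>- 1\<close> to the right and the others from cell
  \<open>- 2\<close> to the left, where the residue modulo \<open>K\<close> identifies the
  register.\<close>

lemma pos_inject:
  assumes "j < K" "j' < K"
  shows "pos K j t = pos K j' t' \<longleftrightarrow> j = j' \<and> t = t'"
proof
  assume e: "pos K j t = pos K j' t'"
  show "j = j' \<and> t = t'"
  proof (cases "j = 0 \<or> j' = 0")
    case True
    have "0 \<le> int (K * n)" for n by (rule of_nat_0_le_iff)
    from this[of t] this[of t'] show ?thesis using True e unfolding pos_def
      by (auto split: if_splits simp del: of_nat_mult)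
  next
    case False
    then have "int (j + K * t) = int (j' + K * t')" using e by (simp add: pos_def)
    then have "j + K * t = j' + K * t'" by (simp only: of_nat_eq_iff)
    moreover from this have "j = j'" using assms
      by (metis mod_less mod_mult_self2)
    ultimately show ?thesis using assms by auto
  qed
qed simp

lemma slot_0 [simp]: "slot xs 0 = Blank" by (simp add: slot_def)

lemma slot_top [simp]: "slot (x # xs) (Suc (length xs)) = Bit x"
  by (simp add: slot_def nth_append)

lemma slot_beyond [simp]: "slot xs (Suc (length xs)) = Blank"
  by (simp add: slot_def)

lemma slot_nonblank: "slot xs t \<noteq> Blank \<longleftrightarrow> 0 < t \<and> t \<le> length xs"
  by (cases t) (auto simp: slot_def)

lemma slot_Cons: "t \<noteq> Suc (length xs) \<Longrightarrow> slot (x # xs) t = slot xs t"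
  by (cases t) (auto simp: slot_def nth_append)

lemma holds_push:
  assumes "holds K R T" "r < K"
  shows "holds K (R(r := b # R r)) (T(pos K r (Suc (length (R r))) := Bit b))"
  using assms by (auto simp: holds_def pos_inject slot_Cons)

lemma holds_pop:
  assumes "holds K R T" "r < K" "R r = b # bs"
  shows "holds K (R(r := bs)) (T(pos K r (length (R r)) := Blank))"
  using assms by (auto simp: holds_def pos_inject slot_Cons)

primrec movn :: "dir \<Rightarrow> nat \<Rightarrow> 'w tcom" where
  "movn d 0 = Act (\<lambda>w s. (w, s, Stay))"
| "movn d (Suc n) = TSeq (Act (\<lambda>w s. (w, s, d))) (movn d n)"

lemma runs_movn: "runs (movn d n) (n + 1) (w, T, p) (w, T, p + int n * shift d)"
proof (induction n arbitrary: p)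
  case 0
  show ?case using runs_Act[of "\<lambda>w s. (w, s, Stay)" w T p] by simp
next
  case (Suc n)
  have "runs (Act (\<lambda>w s. (w, s, d))) 1 (w, T, p) (w, T, p + shift d)"
    using runs_Act[of "\<lambda>w s. (w, s, d)" w T p] by simp
  from runs_TSeq[OF this Suc.IH] show ?case by (simp add: algebra_simps)
qed

definition fwd :: "nat \<Rightarrow> nat \<Rightarrow> 'w tcom" where
  "fwd K r = (if r = 0 then movn Rgt 1 else movn Lft K)"

definition bwd :: "nat \<Rightarrow> nat \<Rightarrow> 'w tcom" where
  "bwd K r = (if r = 0 then movn Lft 1 else movn Rgt K)"

lemma runs_fwd:
  assumes "0 < K"
  shows "runs (fwd K r) (K + 1) (w, T, pos K r t) (w, T, pos K r (Suc t))"
proof (cases "r = 0")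
  case True
  then show ?thesis using runs_mono[OF runs_movn[of Rgt 1 w T "pos K r t"], of "K + 1"] assms
    by (simp add: fwd_def pos_def del: movn.simps)
next
  case False
  then show ?thesis using runs_movn[of Lft K w T "pos K r t"]
    by (simp add: fwd_def pos_def algebra_simps)
qed

lemma runs_bwd:
  assumes "0 < K"
  shows "runs (bwd K r) (K + 1) (w, T, pos K r (Suc t)) (w, T, pos K r t)"
proof (cases "r = 0")
  case True
  then show ?thesis using runs_mono[OF runs_movn[of Lft 1 w T "pos K r (Suc t)"], of "K + 1"] assms
    by (simp add: bwd_def pos_def del: movn.simps)
next
  case False
  then show ?thesis using runs_movn[of Rgt K w T "pos K r (Suc t)"]
    by (simp add: bwd_def pos_def algebra_simps)
qed

lemma pos_0 [simp]: "pos K r 0 = - 1 - int r"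
  by (simp add: pos_def)

lemma runs_goto: "runs (movn Lft r) (r + 1) (w, T, - 1) (w, T, pos K r 0)"
  using runs_movn[of Lft r w T "-1"] by (simp del: movn.simps)

lemma runs_home: "runs (movn Rgt r) (r + 1) (w, T, pos K r 0) (w, T, - 1)"
  using runs_movn[of Rgt r w T "pos K r 0"] by (simp del: movn.simps)

text \<open>\<open>u\<close> counts the occupied slots still ahead. Each costs \<open>K + 1\<close>
  steps for the move and 2 for the test and the jump back.\<close>

lemma runs_up:
  assumes "holds K R T" "r < K" "n = length (R r)" "u \<le> n"
  shows "runs (TWhile (\<lambda>w s. s \<noteq> Blank) (fwd K r)) ((K + 3) * u + 1)
     (w, T, pos K r (Suc (n - u))) (w, T, pos K r (Suc n))"
  using assms(4)
proof (induction u)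
  case 0
  have "T (pos K r (Suc n)) = Blank" using assms by (simp add: holds_def)
  then have "\<not> T (pos K r (Suc n)) \<noteq> Blank" by simp
  from runs_TWhile_done[of "\<lambda>w s. s \<noteq> Blank" w T "pos K r (Suc n)", OF this] show ?case by simp
next
  case (Suc u)
  have "T (pos K r (Suc (n - Suc u))) = slot (R r) (Suc (n - Suc u))"
    using assms by (simp add: holds_def)
  then have nb: "T (pos K r (Suc (n - Suc u))) \<noteq> Blank"
    using Suc.prems assms(3) by (simp add: slot_nonblank)
  have "Suc (Suc (n - Suc u)) = Suc (n - u)" using Suc.prems by simp
  then have "runs (fwd K r) (K + 1) (w, T, pos K r (Suc (n - Suc u))) (w, T, pos K r (Suc (n - u)))"
    using runs_fwd[of K r w T "Suc (n - Suc u)"] assms(2) by simp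
  from runs_mono[OF runs_TWhile_step[of "\<lambda>w s. s \<noteq> Blank" w T "pos K r (Suc (n - Suc u))", OF nb this Suc.IH]] show ?case
    using Suc.prems by simp
qed

lemma runs_down:
  assumes "holds K R T" "r < K" "u \<le> length (R r)"
  shows "runs (TWhile (\<lambda>w s. s \<noteq> Blank) (bwd K r)) ((K + 3) * u + 1) (w, T, pos K r u) (w, T, pos K r 0)"
  using assms(3)
proof (induction u)
  case 0
  have "\<not> T (pos K r 0) \<noteq> Blank" using assms unfolding holds_def by (metis slot_0)
  from runs_TWhile_done[of "\<lambda>w s. s \<noteq> Blank" w T "pos K r 0", OF this] show ?case by simp
next
  case (Suc u)
  have "T (pos K r (Suc u)) = slot (R r) (Suc u)"
    using assms by (simp add: holds_def)
  then have nb: "T (pos K r (Suc u)) \<noteq> Blank"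
    using Suc.prems by (simp add: slot_nonblank)
  have "runs (bwd K r) (K + 1) (w, T, pos K r (Suc u)) (w, T, pos K r u)"
    using assms(2) by (intro runs_bwd) simp
  from runs_mono[OF runs_TWhile_step[of "\<lambda>w s. s \<noteq> Blank" w T "pos K r (Suc u)", OF nb this Suc.IH]] show ?case
    using Suc.prems by simp
qed

text \<open>Cell \<open>- 1\<close>, slot 0 of register 0, is the home position; slot 0 of register
  \<open>r\<close> lies \<open>r\<close> cells to its left. The first move skips this blank slot, so
  the upward walk stops at the first free one.\<close>

definition tpush :: "nat \<Rightarrow> nat \<Rightarrow> ('w \<Rightarrow> bool) \<Rightarrow> 'w tcom" where
  "tpush K r f = TSeq (movn Lft r) (TSeq (fwd K r) (TSeq (TWhile (\<lambda>w s. s \<noteq> Blank) (fwd K r))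
     (TSeq (Act (\<lambda>w s. (w, Bit (f w), Stay))) (TSeq (TWhile (\<lambda>w s. s \<noteq> Blank) (bwd K r)) (movn Rgt r)))))"

definition bit_of :: "sym \<Rightarrow> bool option" where
  "bit_of s = (case s of Blank \<Rightarrow> None | Bit b \<Rightarrow> Some b)"

text \<open>Below the first free slot lies the top, or slot 0 if the register is empty; a blank
  there tells the cases apart. A move back precedes the downward loop, which would otherwise stop at
  the cell just erased.\<close>

definition tpop :: "nat \<Rightarrow> nat \<Rightarrow> (bool option \<Rightarrow> 'w \<Rightarrow> 'w) \<Rightarrow> 'w tcom" where
  "tpop K r f = TSeq (movn Lft r) (TSeq (fwd K r) (TSeq (TWhile (\<lambda>w s. s \<noteq> Blank) (fwd K r))
     (TSeq (bwd K r)
     (TSeq (TIf (\<lambda>w s. s = Blank) (Act (\<lambda>w s. (f None w, Blank, Stay)))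
        (TSeq (Act (\<lambda>w s. (f (bit_of s) w, Blank, Stay)))
          (TSeq (bwd K r) (TWhile (\<lambda>w s. s \<noteq> Blank) (bwd K r)))))
       (movn Rgt r)))))"

definition op_time :: "nat \<Rightarrow> nat \<Rightarrow> nat" where
  "op_time K B = (6 * K + 20) * (B + 1)"

lemma op_time_ge: "5 \<le> op_time K B" by (simp add: op_time_def)

lemma runs_tpush:
  assumes "holds K R T" "r < K" "length (R r) \<le> B"
  shows "\<exists>T'. runs (tpush K r f) (op_time K B) (w, T, - 1) (w, T', - 1) \<and>
    holds K (R(r := f w # R r)) T'"
proof -
  let ?n = "length (R r)"
  let ?q = "pos K r (Suc ?n)"
  let ?T = "T(?q := Bit (f w))"
  let ?R = "R(r := f w # R r)"
  have h: "holds K ?R ?T" using holds_push[OF assms(1,2)] .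
  have a: "runs (fwd K r) (K + 1) (w, T, pos K r 0) (w, T, pos K r (Suc (?n - ?n)))"
    using assms(2) runs_fwd[of K r w T 0] by simp
  have b: "runs (Act (\<lambda>w s. (w, Bit (f w), Stay))) 1 (w, T, ?q) (w, ?T, ?q)"
    using runs_Act[of "\<lambda>w s. (w, Bit (f w), Stay)" w T ?q] by simp
  have d: "runs (TWhile (\<lambda>w s. s \<noteq> Blank) (bwd K r)) ((K + 3) * Suc ?n + 1) (w, ?T, ?q) (w, ?T, pos K r 0)"
    using runs_down[OF h assms(2), of "Suc ?n"] by simp
  have "runs (tpush K r f) ((r + 1) + ((K + 1) + (((K + 3) * ?n + 1) + (1 + (((K + 3) * Suc ?n + 1) + (r + 1))))))
     (w, T, - 1) (w, ?T, - 1)"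
    unfolding tpush_def
    by (rule runs_TSeq[OF runs_goto[of _ _ _ K] runs_TSeq[OF a runs_TSeq[OF
       runs_up[OF assms(1,2) refl order_refl] runs_TSeq[OF b runs_TSeq[OF d runs_home]]]]])
  moreover have "(r + 1) + ((K + 1) + (((K + 3) * ?n + 1) + (1 + (((K + 3) * Suc ?n + 1) + (r + 1)))))
      \<le> (6 * K + 20) * (?n + 1)"
    using assms(2) by (simp add: algebra_simps)
  moreover have "\<dots> \<le> op_time K B" unfolding op_time_def using assms(3) by (intro mult_le_mono2) simp
  ultimately show ?thesis using h by (meson order_trans runs_mono)
qed

definition opt_hd :: "'a list \<Rightarrow> 'a option" where
  "opt_hd xs = (case xs of [] \<Rightarrow> None | b # _ \<Rightarrow> Some b)"

lemma opt_hd_simps [simp]: "opt_hd [] = None" "opt_hd (x # xs) = Some x"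
  by (simp_all add: opt_hd_def)

lemma runs_tpop:
  assumes "holds K R T" "r < K" "length (R r) \<le> B"
  shows "\<exists>T'. runs (tpop K r f) (op_time K B) (w, T, - 1) (f (opt_hd (R r)) w, T', - 1) \<and>
    holds K (R(r := tl (R r))) T'"
proof -
  let ?n = "length (R r)"
  have a: "runs (fwd K r) (K + 1) (w, T, pos K r 0) (w, T, pos K r (Suc (?n - ?n)))"
    using assms(2) runs_fwd[of K r w T 0] by simp
  have b: "runs (bwd K r) (K + 1) (w, T, pos K r (Suc ?n)) (w, T, pos K r ?n)"
    using assms(2) by (intro runs_bwd) simp
  let ?o = "opt_hd (R r)"
  have "\<exists>T'. runs (TIf (\<lambda>w s. s = Blank) (Act (\<lambda>w s. (f None w, Blank, Stay)))
        (TSeq (Act (\<lambda>w s. (f (bit_of s) w, Blank, Stay)))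
          (TSeq (bwd K r) (TWhile (\<lambda>w s. s \<noteq> Blank) (bwd K r)))))
       (1 + ((K + 1) + ((K + 3) * ?n + 1)) + 2) (w, T, pos K r ?n) (f ?o w, T', pos K r 0) \<and>
       holds K (R(r := tl (R r))) T'"
  proof (cases "R r")
    case Nil
    have "T (pos K r ?n) = Blank" using assms(1,2) Nil unfolding holds_def
      by (metis list.size(3) slot_0)
    moreover from this have "T(pos K r 0 := Blank) = T" using Nil by auto
    ultimately have "runs (Act (\<lambda>w s. (f None w, Blank, Stay))) 1 (w, T, pos K r ?n) (f ?o w, T, pos K r 0)"
      using runs_Act[of "\<lambda>w s. (f None w, Blank, Stay)" w T "pos K r ?n"] Nil by simp
    then have "runs (Act (\<lambda>w s. (f None w, Blank, Stay))) (1 + ((K + 1) + ((K + 3) * ?n + 1)))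
        (w, T, pos K r ?n) (f ?o w, T, pos K r 0)"
      by (rule runs_mono) simp
    then show ?thesis using \<open>T (pos K r ?n) = Blank\<close> assms(1) Nil
      by (intro exI[of _ T] conjI runs_TIf) (simp_all add: fun_upd_idem)
  next
    case (Cons x xs)
    let ?T = "T(pos K r ?n := Blank)"
    have t: "T (pos K r ?n) = Bit x" using assms Cons by (simp add: holds_def)
    have h: "holds K (R(r := xs)) ?T" using holds_pop[OF assms(1,2) Cons] .
    have 1: "runs (Act (\<lambda>w s. (f (bit_of s) w, Blank, Stay))) 1 (w, T, pos K r ?n) (f ?o w, ?T, pos K r (Suc (length xs)))"
      using runs_Act[of "\<lambda>w s. (f (bit_of s) w, Blank, Stay)" w T "pos K r ?n"] Cons t by (simp add: bit_of_def)
    have 2: "runs (bwd K r) (K + 1) (f ?o w, ?T, pos K r (Suc (length xs))) (f ?o w, ?T, pos K r (length xs))"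
      using assms(2) by (intro runs_bwd) simp
    have 3: "runs (TWhile (\<lambda>w s. s \<noteq> Blank) (bwd K r)) ((K + 3) * ?n + 1)
       (f ?o w, ?T, pos K r (length xs)) (f ?o w, ?T, pos K r 0)"
      by (rule runs_mono[OF runs_down[OF h assms(2)]]) (simp_all add: Cons)
    show ?thesis
      by (rule exI[of _ ?T], rule conjI, rule runs_TIf) (use t h Cons runs_TSeq[OF 1 runs_TSeq[OF 2 3]] in simp_all)
  qed
  then obtain T' where T': "runs (TIf (\<lambda>w s. s = Blank) (Act (\<lambda>w s. (f None w, Blank, Stay)))
        (TSeq (Act (\<lambda>w s. (f (bit_of s) w, Blank, Stay)))
          (TSeq (bwd K r) (TWhile (\<lambda>w s. s \<noteq> Blank) (bwd K r)))))
       (1 + ((K + 1) + ((K + 3) * ?n + 1)) + 2) (w, T, pos K r ?n) (f ?o w, T', pos K r 0)"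
       "holds K (R(r := tl (R r))) T'" by blast
  have "runs (tpop K r f) ((r + 1) + ((K + 1) + (((K + 3) * ?n + 1) + ((K + 1) + ((1 + ((K + 1) + ((K + 3) * ?n + 1)) + 2) + (r + 1))))))
     (w, T, - 1) (f ?o w, T', - 1)"
    unfolding tpop_def
    by (rule runs_TSeq[OF runs_goto[of _ _ _ K] runs_TSeq[OF a runs_TSeq[OF
       runs_up[OF assms(1,2) refl order_refl] runs_TSeq[OF b runs_TSeq[OF T'(1) runs_home]]]]])
  moreover have "(r + 1) + ((K + 1) + (((K + 3) * ?n + 1) + ((K + 1) + ((1 + ((K + 1) + ((K + 3) * ?n + 1)) + 2) + (r + 1)))))
      \<le> (6 * K + 20) * (?n + 1)"
    using assms(2) by (simp add: algebra_simps)
  moreover have "\<dots> \<le> op_time K B" unfolding op_time_def using assms(3) by (intro mult_le_mono2) simp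
  ultimately show ?thesis using T'(2) by (meson order_trans runs_mono)
qed


subsection \<open>Compiling register programs\<close>

text \<open>While a loop runs over register \<open>r\<close>, the bits already seen are kept in register \<open>k + r\<close>
  and the last popped bit in the second component of the finite control.\<close>
primrec compile :: "nat \<Rightarrow> 'v com \<Rightarrow> ('v \<times> bool option) tcom" where
  "compile k (Upd g) = Act (\<lambda>w s. ((g (fst w), snd w), s, Stay))"
| "compile k (Push r f) = tpush (2 * k) r (\<lambda>w. f (fst w))"
| "compile k (Pop r f) = tpop (2 * k) r (\<lambda>o' w. (f o' (fst w), snd w))"
| "compile k (Seq a b) = TSeq (compile k a) (compile k b)"
| "compile k (Cond P a b) = TIf (\<lambda>w s. P (fst w)) (compile k a) (compile k b)"
| "compile k (For r f c) =
     (let grab = (\<lambda>q. tpop (2 * k) q (\<lambda>o' w. (fst w, o')));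
          save = (\<lambda>q. tpush (2 * k) q (\<lambda>w. the (snd w)));
          more = (\<lambda>w s. snd w \<noteq> None)
      in TSeq (TSeq (grab r) (TWhile more
            (TSeq (save (k + r)) (TSeq (Act (\<lambda>w s. ((f (the (snd w)) (fst w), snd w), s, Stay)))
              (TSeq (compile k c) (grab r))))))
          (TSeq (grab (k + r)) (TWhile more (TSeq (save r) (grab (k + r))))))"

text \<open>\<open>M\<close> bounds the loop registers at the start and so the number of operations;
  \<open>B\<close> bounds all registers throughout and so the price of one operation. A loop body
  cannot loop over the same register again, so one spare register \<open>k + r\<close> per register
  suffices.\<close>

lemma runs_compile:
  fixes v :: 'v
  assumes "wf_com c" "regs c \<subseteq> {..<k}" "holds (2 * k) R T"
    "\<And>r. r \<in> fors c \<Longrightarrow> R (k + r) = []"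
    "\<And>r. r \<in> fors c \<Longrightarrow> length (R r) \<le> M"
    "\<And>j. j < 2 * k \<Longrightarrow> length (R j) + cost c M \<le> B"
  shows "\<exists>T' x'. runs (compile k c) (cost c M * op_time (2 * k) B) ((v, x), T, - 1)
      ((fst (exec c (v, R)), x'), T', - 1) \<and> holds (2 * k) (snd (exec c (v, R))) T'"
  using assms
proof (induction c arbitrary: v R T x M)
  case (Upd g)
  have "runs (compile k (Upd g)) 1 ((v, x), T, - 1) ((g v, x), T, - 1)"
    using runs_Act[of "\<lambda>w s. ((g (fst w), snd w), s, Stay)" "(v, x)" T "-1"] by simp
  then have "runs (compile k (Upd g)) (op_time (2 * k) B) ((v, x), T, - 1) ((g v, x), T, - 1)"
    by (rule runs_mono) (use op_time_ge[of "2 * k" B] in simp)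
  then show ?case using Upd.prems by auto
next
  case (Push r f)
  have r: "r < 2 * k" "length (R r) \<le> B" using Push.prems(2) Push.prems(6)[of r] by auto
  show ?case
    using runs_tpush[OF Push.prems(3) r, of "\<lambda>w. f (fst w)" "(v, x)"]
    by (auto simp del: fun_upd_apply)
next
  case (Pop r f)
  have r: "r < 2 * k" "length (R r) \<le> B" using Pop.prems(2) Pop.prems(6)[of r] by auto
  show ?case
    using runs_tpop[OF Pop.prems(3) r, of "\<lambda>o' w. (f o' (fst w), snd w)" "(v, x)"]
    by (cases "R r") (auto simp: fun_upd_idem simp del: fun_upd_apply)
next
  case (Seq a b)
  obtain T1 x1 where 1: "runs (compile k a) (cost a M * op_time (2 * k) B) ((v, x), T, - 1)
      ((fst (exec a (v, R)), x1), T1, - 1)" "holds (2 * k) (snd (exec a (v, R))) T1"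
    using Seq.IH(1)[of R T M v x] Seq.prems by fastforce
  let ?R = "snd (exec a (v, R))"
  have len: "length (?R j) \<le> length (R j) + cost a M" for j
    using exec_length[of a "(v, R)" M j] Seq.prems by simp
  have "?R (k + r) = []" if "r \<in> fors b" for r
  proof -
    have "k + r \<notin> writes a" using writes_subset_regs[of a] Seq.prems(2) by auto
    then show ?thesis using that Seq.prems(4) by (simp add: exec_unwritten)
  qed
  moreover have "length (?R r) \<le> M + cost a M" if "r \<in> fors b" for r
    using len[of r] Seq.prems(5)[of r] that by simp
  moreover have "length (?R j) + cost b (M + cost a M) \<le> B" if "j < 2 * k" for j
    using len[of j] Seq.prems(6)[of j] that by simp
  ultimately obtain T2 x2 where 2: "runs (compile k b) (cost b (M + cost a M) * op_time (2 * k) B)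
      ((fst (exec a (v, R)), x1), T1, - 1) ((fst (exec b (exec a (v, R))), x2), T2, - 1)"
      "holds (2 * k) (snd (exec b (exec a (v, R)))) T2"
    using Seq.IH(2)[of ?R T1 "M + cost a M" "fst (exec a (v, R))" x1] 1(2) Seq.prems by auto
  show ?case using runs_TSeq[OF 1(1) 2(1)] 2(2) by (auto simp: algebra_simps)
next
  case (Cond P a b)
  let ?U = "op_time (2 * k) B"
  obtain T1 x1 where 1: "runs (if P v then compile k a else compile k b)
     ((cost a M + cost b M) * ?U) ((v, x), T, - 1)
      ((fst (exec (Cond P a b) (v, R)), x1), T1, - 1)" "holds (2 * k) (snd (exec (Cond P a b) (v, R))) T1"
  proof (cases "P v")
    case True
    obtain T1 x1 where "runs (compile k a) (cost a M * ?U) ((v, x), T, - 1)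
      ((fst (exec a (v, R)), x1), T1, - 1)" "holds (2 * k) (snd (exec a (v, R))) T1"
      using Cond.IH(1)[of R T M v x] Cond.prems by fastforce
    moreover from this(1) have "runs (compile k a) ((cost a M + cost b M) * ?U) ((v, x), T, - 1)
      ((fst (exec a (v, R)), x1), T1, - 1)" by (rule runs_mono) simp
    ultimately show ?thesis using that True by simp
  next
    case False
    obtain T1 x1 where "runs (compile k b) (cost b M * ?U) ((v, x), T, - 1)
      ((fst (exec b (v, R)), x1), T1, - 1)" "holds (2 * k) (snd (exec b (v, R))) T1"
      using Cond.IH(2)[of R T M v x] Cond.prems by fastforce
    moreover from this(1) have "runs (compile k b) ((cost a M + cost b M) * ?U) ((v, x), T, - 1)
      ((fst (exec b (v, R)), x1), T1, - 1)" by (rule runs_mono) simp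
    ultimately show ?thesis using that False by simp
  qed
  have "runs (compile k (Cond P a b)) ((cost a M + cost b M) * ?U + 2) ((v, x), T, - 1)
      ((fst (exec (Cond P a b) (v, R)), x1), T1, - 1)"
    unfolding compile.simps by (rule runs_TIf) (use 1(1) in \<open>simp split: if_splits\<close>)
  then have "runs (compile k (Cond P a b)) (cost (Cond P a b) M * ?U) ((v, x), T, - 1)
      ((fst (exec (Cond P a b) (v, R)), x1), T1, - 1)"
    by (rule runs_mono) (use op_time_ge[of "2 * k" B] in \<open>simp add: algebra_simps\<close>)
  then show ?case using 1(2) by blast
next
  case (For r f c)
  note fun_upd_apply [simp del] fun_upd_same [simp] fun_upd_other [simp]
  let ?K = "2 * k"
  let ?U = "op_time (2 * k) B"
  define grab where "grab = (\<lambda>q. tpop (2 * k) q (\<lambda>o' w. (fst w :: 'v, o' :: bool option)))"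
  define save where "save = (\<lambda>q. tpush (2 * k) q (\<lambda>w. the (snd (w :: 'v \<times> bool option))))"
  define more where "more = (\<lambda>(w :: 'v \<times> bool option) (s :: sym). snd w \<noteq> None)"
  define put where "put = Act (\<lambda>w s. ((f (the (snd w)) (fst w :: 'v), snd w), s, Stay))"
  have r: "r < k" and rc: "r \<notin> regs c" and wf: "wf_com c" and rg: "regs c \<subseteq> {..<k}"
    and wfor: "writes c \<inter> fors c = {}"
    using For.prems by auto
  have krc: "k + q \<notin> regs c" for q using rg by auto
  have U: "5 \<le> ?U" by (rule op_time_ge)
  have grab: "\<exists>T'. runs (grab q) ?U ((v, x), T, - 1) ((v, opt_hd (R q)), T', - 1) \<and> holds ?K (R(q := tl (R q))) T'"
    if "holds ?K R T" "q < ?K" "length (R q) \<le> B" for q v x R T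
    using runs_tpop[OF that, of "\<lambda>o' w. (fst w, o')" "(v, x)"]
    by (simp add: grab_def del: fun_upd_apply)
  have save: "\<exists>T'. runs (save q) ?U ((v, Some b), T, - 1) ((v, Some b), T', - 1) \<and> holds ?K (R(q := b # R q)) T'"
    if "holds ?K R T" "q < ?K" "length (R q) \<le> B" for q v b R T
    using runs_tpush[OF that, of "\<lambda>w. the (snd w)" "(v, Some b)"]
    by (simp add: save_def del: fun_upd_apply)
  let ?body = "TSeq (save (k + r)) (TSeq put (TSeq (compile k c) (grab r)))"
  let ?step = "\<lambda>b s. exec c (f b (fst s), snd s)"
  \<comment> \<open>\<open>R\<close> is the abstract state, with register \<open>r\<close> intact.
    On the tape the bits \<open>seen\<close> lie in \<open>k + r\<close>, the current bit
    \<open>hd ys\<close> is in the control, and only \<open>tl ys\<close> is left in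
    \<open>r\<close>.\<close>
  have loop: "\<exists>T'. runs (TWhile more ?body) ((length ys * (cost c M + 4) + 1) * ?U)
       ((v, opt_hd ys), T, - 1) ((fst (fold ?step ys (v, R)), None), T', - 1)
       \<and> holds ?K ((snd (fold ?step ys (v, R)))(r := [], k + r := rev ys @ seen)) T'"
    if "holds ?K (R(r := tl ys, k + r := seen)) T" "R r = rev seen @ ys"
      "\<And>q. q \<in> fors c \<Longrightarrow> R (k + q) = []" "\<And>q. q \<in> fors c \<Longrightarrow> length (R q) \<le> M"
      "\<And>j. j < ?K \<Longrightarrow> length (R j) + length ys * cost c M \<le> B"
      "length (R r) + cost c M \<le> B"
    for ys seen v R T
    using that
  proof (induction ys arbitrary: seen v R T)
    case Nil
    have "runs (TWhile more ?body) 1 ((v, None), T, - 1) ((v, None), T, - 1)"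
      by (rule runs_TWhile_done) (simp add: more_def)
    then have "runs (TWhile more ?body) ?U ((v, None), T, - 1) ((v, None), T, - 1)"
      by (rule runs_mono) (use U in simp)
    then show ?case using Nil by auto
  next
    case (Cons b ys)
    let ?R = "R(r := ys, k + r := seen)"
    have h: "holds ?K ?R T" using Cons.prems(1) by simp
    have "length seen \<le> B" using Cons.prems(2,6) by simp
    then obtain T1 where 1: "runs (save (k + r)) ?U ((v, Some b), T, - 1) ((v, Some b), T1, - 1)"
        "holds ?K (R(r := ys, k + r := b # seen)) T1"
      using save[OF h, of "k + r" v b] r by auto
    let ?R1 = "R(r := ys, k + r := b # seen)"
    have 2: "runs put 1 ((v, Some b), T1, - 1) ((f b v, Some b), T1, - 1)"
      unfolding put_def using runs_Act[of "\<lambda>w s. ((f (the (snd w)) (fst w :: 'v), snd w), s, Stay)" "(v, Some b)" T1 "-1"]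
      by simp
    obtain v' R' where e: "exec c (f b v, R) = (v', R')" by (cases "exec c (f b v, R)")
    have e1: "exec c (f b v, ?R1) = (v', R'(r := ys, k + r := b # seen))"
      using exec_frame[of "k + r" c "f b v" "R(r := ys)" "b # seen"] krc
        exec_frame[of r c "f b v" R ys] rc e by simp
    have "?R1 (k + q) = []" if "q \<in> fors c" for q
      using Cons.prems(3)[OF that] that rc r fors_subset_regs[of c] by (auto simp: fun_upd_apply)
    moreover have "length (?R1 q) \<le> M" if "q \<in> fors c" for q
      using Cons.prems(4)[OF that] that rc krc[of r] fors_subset_regs[of c] by (auto simp: fun_upd_apply)
    moreover have "length (?R1 j) + cost c M \<le> B" if "j < ?K" for j
      using Cons.prems(2,6) Cons.prems(5)[OF that] by (auto simp: fun_upd_apply)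
    ultimately obtain T2 x2 where 3: "runs (compile k c) (cost c M * ?U) ((f b v, Some b), T1, - 1)
        ((v', x2), T2, - 1)" "holds ?K (R'(r := ys, k + r := b # seen)) T2"
      using For.IH[OF wf rg 1(2), of M "f b v" "Some b"] e1 by auto
    have lenR': "length (R' j) \<le> length (R j) + cost c M" for j
      using exec_length[OF wf, of "(f b v, R)" M j] Cons.prems(4) e by simp
    have R'r: "R' r = R r"
      using exec_unwritten[of r c "(f b v, R)"] rc writes_subset_regs[of c] e by auto
    have "length ys \<le> B" using Cons.prems(2,6) by simp
    then obtain T3 where 4: "runs (grab r) ?U ((v', x2), T2, - 1) ((v', opt_hd ys), T3, - 1)"
        "holds ?K (R'(r := tl ys, k + r := b # seen)) T3"
      using grab[OF 3(2), of r v' x2] r by (auto simp: fun_upd_twist)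
    have "R' (k + q) = []" if "q \<in> fors c" for q
      using exec_unwritten[of "k + q" c "(f b v, R)"] krc[of q] writes_subset_regs[of c] e
        Cons.prems(3)[OF that] by auto
    moreover have "length (R' q) \<le> M" if "q \<in> fors c" for q
    proof -
      have "q \<notin> writes c" using wfor that by blast
      then show ?thesis using exec_unwritten[of q c "(f b v, R)"] e Cons.prems(4)[OF that] by simp
    qed
    moreover have "length (R' j) + length ys * cost c M \<le> B" if "j < ?K" for j
      using lenR'[of j] Cons.prems(5)[OF that] by simp
    ultimately obtain T4 where 5: "runs (TWhile more ?body) ((length ys * (cost c M + 4) + 1) * ?U)
       ((v', opt_hd ys), T3, - 1) ((fst (fold ?step ys (v', R')), None), T4, - 1)"
       "holds ?K ((snd (fold ?step ys (v', R')))(r := [], k + r := rev ys @ b # seen)) T4"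
      using Cons.IH[OF 4(2), of v'] R'r Cons.prems(2,6) by auto
    have m: "more (v, Some b) (T (- 1))" by (simp add: more_def)
    have "runs (TWhile more ?body) ((?U + (1 + (cost c M * ?U + ?U))) + (length ys * (cost c M + 4) + 1) * ?U + 2)
       ((v, Some b), T, - 1) ((fst (fold ?step ys (v', R')), None), T4, - 1)"
      by (rule runs_TWhile_step[OF m runs_TSeq[OF 1(1) runs_TSeq[OF 2 runs_TSeq[OF 3(1) 4(1)]]] 5(1)])
    then have "runs (TWhile more ?body) ((length (b # ys) * (cost c M + 4) + 1) * ?U)
       ((v, Some b), T, - 1) ((fst (fold ?step ys (v', R')), None), T4, - 1)"
      by (rule runs_mono) (use U in \<open>simp add: algebra_simps\<close>)
    then show ?case using 5(2) e by auto
  qed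
  \<comment> \<open>Draining \<open>k + r\<close> into \<open>r\<close> reverses the order a second
    time and so restores \<open>r\<close>.\<close>
  have restore: "\<exists>T'. runs (TWhile more (TSeq (save r) (grab (k + r)))) ((3 * length ys + 1) * ?U)
       ((v, opt_hd ys), T, - 1) ((v, None), T', - 1) \<and> holds ?K (R(r := rev ys @ acc, k + r := [])) T'"
    if "holds ?K (R(r := acc, k + r := tl ys)) T" "length ys + length acc \<le> B"
    for ys acc v R T
    using that
  proof (induction ys arbitrary: acc T)
    case Nil
    have "runs (TWhile more (TSeq (save r) (grab (k + r)))) 1 ((v, None), T, - 1) ((v, None), T, - 1)"
      by (rule runs_TWhile_done) (simp add: more_def)
    then have "runs (TWhile more (TSeq (save r) (grab (k + r)))) ?U ((v, None), T, - 1) ((v, None), T, - 1)"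
      by (rule runs_mono) (use U in simp)
    then show ?case using Nil by auto
  next
    case (Cons b ys)
    have h: "holds ?K (R(r := acc, k + r := ys)) T" using Cons.prems(1) by simp
    obtain T1 where 1: "runs (save r) ?U ((v, Some b), T, - 1) ((v, Some b), T1, - 1)"
        "holds ?K (R(r := b # acc, k + r := ys)) T1"
      using save[OF h, of r v b] r Cons.prems(2) by (auto simp: fun_upd_twist)
    obtain T2 where 2: "runs (grab (k + r)) ?U ((v, Some b), T1, - 1) ((v, opt_hd ys), T2, - 1)"
        "holds ?K (R(r := b # acc, k + r := tl ys)) T2"
      using grab[OF 1(2), of "k + r" v "Some b"] r Cons.prems(2) by auto
    obtain T3 where 3: "runs (TWhile more (TSeq (save r) (grab (k + r)))) ((3 * length ys + 1) * ?U)
       ((v, opt_hd ys), T2, - 1) ((v, None), T3, - 1)" "holds ?K (R(r := rev ys @ b # acc, k + r := [])) T3"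
      using Cons.IH[OF 2(2)] Cons.prems(2) by auto
    have m: "more (v, Some b) (T (- 1))" by (simp add: more_def)
    have "runs (TWhile more (TSeq (save r) (grab (k + r)))) ((?U + ?U) + (3 * length ys + 1) * ?U + 2)
       ((v, Some b), T, - 1) ((v, None), T3, - 1)"
      by (rule runs_TWhile_step[OF m runs_TSeq[OF 1(1) 2(1)] 3(1)])
    then have "runs (TWhile more (TSeq (save r) (grab (k + r)))) ((3 * length (b # ys) + 1) * ?U)
       ((v, Some b), T, - 1) ((v, None), T3, - 1)"
      by (rule runs_mono) (use U in \<open>simp add: algebra_simps\<close>)
    then show ?case using 3(2) by auto
  qed
  let ?L = "R r"
  have L: "length ?L \<le> M" using For.prems(5)[of r] by simp
  have kr0: "R (k + r) = []" using For.prems(4)[of r] by simp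
  have tot: "length (R j) + (M * (cost c M + 7) + 4) \<le> B" if "j < ?K" for j
    using For.prems(6)[OF that] by simp
  \<comment> \<open>For an empty register \<open>M\<close> may be 0, and then \<open>cost\<close>
    allots nothing to the body; that case is treated separately.\<close>
  have LB: "length ?L + cost c M \<le> B" if "?L \<noteq> []"
  proof -
    have "1 \<le> M" using L that by (cases ?L) auto
    then have "1 * cost c M \<le> M * (cost c M + 7)" by (intro mult_le_mono) simp_all
    then show ?thesis using tot[of r] r by simp
  qed
  obtain T1 where 1: "runs (grab r) ?U ((v, x), T, - 1) ((v, opt_hd ?L), T1, - 1)"
      "holds ?K (R(r := tl ?L, k + r := [])) T1"
    using grab[OF For.prems(3), of r v x] r tot[of r] kr0 by (auto simp: fun_upd_idem)
  let ?e = "exec (For r f c) (v, R)"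
  have "\<exists>T'. runs (TWhile more ?body) ((length ?L * (cost c M + 4) + 1) * ?U)
       ((v, opt_hd ?L), T1, - 1) ((fst ?e, None), T', - 1)
       \<and> holds ?K ((snd ?e)(r := [], k + r := rev ?L)) T'"
  proof (cases "?L = []")
    case True
    have "runs (TWhile more ?body) 1 ((v, None), T1, - 1) ((v, None), T1, - 1)"
      by (rule runs_TWhile_done) (simp add: more_def)
    then have "runs (TWhile more ?body) ?U ((v, None), T1, - 1) ((v, None), T1, - 1)"
      by (rule runs_mono) (use U in simp)
    then show ?thesis using 1(2) True by auto
  next
    case False
    have "length (R j) + length ?L * cost c M \<le> B" if "j < ?K" for j
    proof -
      have "length ?L * cost c M \<le> M * (cost c M + 7)" using L by (intro mult_le_mono) simp_all
      then show ?thesis using tot[OF that] by simp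
    qed
    then show ?thesis
      using loop[of R ?L "[]" T1 v] 1(2) For.prems(4,5) LB[OF False] by simp
  qed
  then obtain T2 where 2: "runs (TWhile more ?body) ((length ?L * (cost c M + 4) + 1) * ?U)
       ((v, opt_hd ?L), T1, - 1) ((fst ?e, None), T2, - 1)"
       "holds ?K ((snd ?e)(r := [], k + r := rev ?L)) T2" by blast
  have LB': "length ?L \<le> B" using tot[of r] r by simp
  obtain T3 where 3: "runs (grab (k + r)) ?U ((fst ?e, None), T2, - 1) ((fst ?e, opt_hd (rev ?L)), T3, - 1)"
      "holds ?K ((snd ?e)(r := [], k + r := tl (rev ?L))) T3"
    using grab[OF 2(2), of "k + r" "fst ?e" None] r LB' by auto
  obtain T4 where 4: "runs (TWhile more (TSeq (save r) (grab (k + r)))) ((3 * length ?L + 1) * ?U)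
       ((fst ?e, opt_hd (rev ?L)), T3, - 1) ((fst ?e, None), T4, - 1)"
       "holds ?K ((snd ?e)(r := ?L, k + r := [])) T4"
    using restore[OF 3(2), of "fst ?e"] LB' by auto
  have unw: "snd ?e r = ?L" "snd ?e (k + r) = []"
    using exec_unwritten[of r "For r f c" "(v, R)"] exec_unwritten[of "k + r" "For r f c" "(v, R)"]
      writes_subset_regs[of c] rc krc[of r] kr0 by auto
  have "(snd ?e)(r := ?L, k + r := []) = snd ?e" using unw by (auto simp: fun_upd_apply)
  then have h: "holds ?K (snd ?e) T4" using 4(2) by simp
  have "runs (compile k (For r f c))
     ((?U + (length ?L * (cost c M + 4) + 1) * ?U) + (?U + (3 * length ?L + 1) * ?U))
     ((v, x), T, - 1) ((fst ?e, None), T4, - 1)"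
    using runs_TSeq[OF runs_TSeq[OF 1(1) 2(1)] runs_TSeq[OF 3(1) 4(1)]]
    by (simp only: compile.simps Let_def grab_def save_def more_def put_def)
  \<comment> \<open>Per bit, 4 units cover the moves around the body and 3 the restoration; the
    other 4 are two initial pops and two final tests.\<close>
  moreover have "(?U + (length ?L * (cost c M + 4) + 1) * ?U) + (?U + (3 * length ?L + 1) * ?U)
     = (length ?L * (cost c M + 7) + 4) * ?U" by (simp add: algebra_simps)
  moreover have "\<dots> \<le> cost (For r f c) M * ?U" using L by (simp add: mult_le_mono1)
  ultimately have "runs (compile k (For r f c)) (cost (For r f c) M * ?U) ((v, x), T, - 1) ((fst ?e, None), T4, - 1)"
    by (elim runs_mono) simp
  then show ?case using h by blast
qed

text \<open>The input tape already holds register 0, with the last bit of the input on top, hence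
  \<open>rev\<close>. A first action sets the control, which is arbitrary at the start, and moves to
  the home cell; a last one returns to cell 0, where the output begins, with a fixed
  control.\<close>

theorem com_poly_time:
  fixes c :: "'v::finite com"
  assumes "wf_com c" "regs c \<subseteq> {..<k}" "0 < k"
    "\<And>x. snd (exec c (v, (\<lambda>_. [])(0 := rev x))) 0 = rev (f x)"
  shows "poly_time_computable f"
proof -
  let ?K = "2 * k"
  let ?w = "(v, None) :: 'v \<times> bool option"
  let ?start = "Act (\<lambda>w s. (?w, s, Lft)) :: ('v \<times> bool option) tcom"
  let ?stop = "Act (\<lambda>w s. (?w, s, Rgt)) :: ('v \<times> bool option) tcom"
  let ?p = "TSeq ?start (TSeq (compile k c) ?stop)"
  define time where "time n = 1 + (cost c n * op_time ?K (n + cost c n) + 1)" for n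
  have run: "\<exists>T'. (\<forall>w. runs ?p (time (length x)) (w, input_tape x, 0) (?w, T', 0)) \<and> reads T' 0 (f x)" for x
  proof -
    let ?R = "(\<lambda>_. [])(0 := rev x)"
    let ?T = "input_tape x"
    have h: "holds ?K ?R ?T"
      unfolding holds_def
    proof (intro allI impI)
      fix j t
      show "?T (pos ?K j t) = slot (?R j) t"
      proof (cases "j = 0")
        case True
        then show ?thesis by (cases t) (simp_all add: pos_def slot_def input_tape_def)
      next
        case False
        then have "pos ?K j t < 0" using of_nat_0_le_iff[of "?K * t", where 'a = int]
          by (simp add: pos_def del: of_nat_mult)
        then show ?thesis using False by (simp add: input_tape_def slot_def split: nat.splits)
      qed
    qed
    obtain T' x' where 2: "runs (compile k c) (cost c (length x) * op_time ?K (length x + cost c (length x))) (?w, ?T, - 1)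
        ((fst (exec c (v, ?R)), x'), T', - 1)" "holds ?K (snd (exec c (v, ?R))) T'"
      using runs_compile[OF assms(1,2) h, of "length x" "length x + cost c (length x)" v None] assms(2)
         fors_subset_regs[of c] by fastforce
    have 1: "runs ?start 1 (w, ?T, 0) (?w, ?T, - 1)" for w
      using runs_Act[of "\<lambda>w s. (?w, s, Lft)" w ?T 0] by simp
    have 3: "runs ?stop 1 (w, T', - 1) (?w, T', 0)" for w
      using runs_Act[of "\<lambda>w s. (?w, s, Rgt)" w T' "-1"] by simp
    have "T' (pos ?K 0 (Suc i)) = slot (rev (f x)) (Suc i)" for i
      using 2(2) assms(3,4) unfolding holds_def by (metis mult_pos_pos zero_less_numeral)
    then have "reads T' 0 (f x)" by (simp add: reads_def pos_def slot_def)
    then show ?thesis using runs_TSeq[OF 1 runs_TSeq[OF 2(1) 3]] unfolding time_def by blast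
  qed
  obtain M where M: "valid_tm M" "\<And>T p B T' p'. (\<And>w. runs ?p B (w, T, p) (?w, T', p')) \<Longrightarrow>
      \<exists>t\<le>B. (atm_step M ^^ t) (0, T, p) = (fst (snd M), T', p')"
    using tcom_machine[of ?p ?w] by blast
  have "poly time"
    unfolding time_def op_time_def by (intro poly_add poly_mult poly_cost poly_const poly_id)
  then show ?thesis
  proof (rule poly_time_computableI[OF M(1)])
    fix x
    obtain T' where T': "\<And>w. runs ?p (time (length x)) (w, input_tape x, 0) (?w, T', 0)" "reads T' 0 (f x)"
      using run[of x] by blast
    show "\<exists>t\<le>time (length x). \<exists>T p. (atm_step M ^^ t) (0, input_tape x, 0) = (fst (snd M), T, p) \<and> reads T p (f x)"
      using M(2)[OF T'(1)] T'(2) by blast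
  qed
qed

section \<open>Closure under complement\<close>

primrec mealy :: "('w \<Rightarrow> bool \<Rightarrow> 'w \<times> bool) \<Rightarrow> 'w \<Rightarrow> bool list \<Rightarrow> 'w \<times> bool list" where
  "mealy f w [] = (w, [])"
| "mealy f w (b # bs) =
     (case f w b of (w1, b1) \<Rightarrow> case mealy f w1 bs of (w2, bs2) \<Rightarrow> (w2, b1 # bs2))"

lemma mealy_append:
  "mealy f w (xs @ ys) =
     (case mealy f w xs of (w1, xs1) \<Rightarrow> case mealy f w1 ys of (w2, ys2) \<Rightarrow> (w2, xs1 @ ys2))"
  by (induction xs arbitrary: w) (simp_all add: case_prod_unfold)

lemma length_mealy: "length (snd (mealy f w bs)) = length bs"
  by (induction bs arbitrary: w) (simp_all add: case_prod_unfold)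

primrec put :: "tape \<Rightarrow> int \<Rightarrow> bool list \<Rightarrow> tape" where
  "put T p [] = T"
| "put T p (b # bs) = put (T(p := Bit b)) (p + 1) bs"

lemma put_apply:
  "put T p bs i = (if p \<le> i \<and> i < p + int (length bs) then Bit (bs ! nat (i - p)) else T i)"
proof (induction bs arbitrary: T p)
  case (Cons b bs)
  have "nat (i - p) = Suc (nat (i - (p + 1)))" if "p + 1 \<le> i" using that by simp
  then show ?case using Cons by (auto simp: nth_Cons')
qed auto

lemma reads_ConsD:
  assumes "reads T p (b # bs)"
  shows "T p = Bit b" "reads (T(p := s)) (p + 1) bs"
proof -
  have r: "T (p + int i) = Bit ((b # bs) ! i)" if "i < Suc (length bs)" for i
    using assms that by (simp add: reads_def)
  show "T p = Bit b" using r[of 0] by simp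
  show "reads (T(p := s)) (p + 1) bs"
    using r[of "Suc i" for i] assms by (auto simp: reads_def algebra_simps)
qed

definition sweep :: "('w \<Rightarrow> bool \<Rightarrow> 'w \<times> bool) \<Rightarrow> 'w tcom" where
  "sweep f = TWhile (\<lambda>w s. s \<noteq> Blank)
     (Act (\<lambda>w s. case s of Blank \<Rightarrow> (w, s, Rgt) | Bit b \<Rightarrow> (fst (f w b), Bit (snd (f w b)), Rgt)))"

lemma runs_sweep:
  "reads T p bs \<Longrightarrow> runs (sweep f) (3 * length bs + 1) (w, T, p)
     (fst (mealy f w bs), put T p (snd (mealy f w bs)), p + int (length bs))"
proof (induction bs arbitrary: w T p)
  case Nil
  then have "\<not> T p \<noteq> Blank" by (simp add: reads_def)
  from runs_TWhile_done[of "\<lambda>w s. s \<noteq> Blank" w T p, OF this] show ?case by (simp add: sweep_def)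
next
  case (Cons b bs)
  let ?act = "\<lambda>w s. case s of Blank \<Rightarrow> (w, s, Rgt) | Bit b \<Rightarrow> (fst (f w b), Bit (snd (f w b)), Rgt)"
  let ?T = "T(p := Bit (snd (f w b)))"
  have nb: "T p \<noteq> Blank" using reads_ConsD(1)[OF Cons.prems] by simp
  have "runs (Act ?act) 1 (w, T, p) (fst (f w b), ?T, p + 1)"
    using runs_Act[of ?act w T p] reads_ConsD(1)[OF Cons.prems] by simp
  moreover have "reads ?T (p + 1) bs" by (rule reads_ConsD(2)[OF Cons.prems])
  ultimately have "runs (sweep f) (1 + (3 * length bs + 1) + 2) (w, T, p)
     (fst (mealy f (fst (f w b)) bs), put ?T (p + 1) (snd (mealy f (fst (f w b)) bs)), p + 1 + int (length bs))"
    using runs_TWhile_step[of "\<lambda>w s. s \<noteq> Blank" w T p, OF nb] Cons.IH unfolding sweep_def by blast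
  then have "runs (sweep f) (3 * length (b # bs) + 1) (w, T, p)
     (fst (mealy f (fst (f w b)) bs), put ?T (p + 1) (snd (mealy f (fst (f w b)) bs)), p + 1 + int (length bs))"
    by (rule runs_mono) simp
  then show ?case by (simp add: case_prod_unfold add.assoc)
qed

definition rewind :: "'w tcom" where
  "rewind = TWhile (\<lambda>w s. s \<noteq> Blank) (Act (\<lambda>w s. (w, s, Lft)))"

lemma runs_rewind:
  "(\<And>i. i < n \<Longrightarrow> T (p + 1 + int i) \<noteq> Blank) \<Longrightarrow> T p = Blank \<Longrightarrow>
    runs rewind (3 * n + 1) (w, T, p + int n) (w, T, p)"
proof (induction n)
  case 0
  then have "\<not> T p \<noteq> Blank" by simp
  from runs_TWhile_done[of "\<lambda>w s. s \<noteq> Blank" w T p, OF this] show ?case by (simp add: rewind_def)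
next
  case (Suc n)
  have nb: "T (p + int (Suc n)) \<noteq> Blank" using Suc.prems(1)[of n] by (simp add: algebra_simps)
  have "runs (Act (\<lambda>w s. (w, s, Lft))) 1 (w, T, p + int (Suc n)) (w, T, p + int n)"
    using runs_Act[of "\<lambda>w s. (w, s, Lft)" w T "p + int (Suc n)"] by simp
  moreover have "runs rewind (3 * n + 1) (w, T, p + int n) (w, T, p)"
    using Suc by simp
  ultimately have "runs rewind (1 + (3 * n + 1) + 2) (w, T, p + int (Suc n)) (w, T, p)"
    using runs_TWhile_step[of "\<lambda>w s. s \<noteq> Blank" w T "p + int (Suc n)", OF nb] unfolding rewind_def by blast
  then show ?case by (rule runs_mono) simp
qed

lemma runs_move: "runs (Act (\<lambda>w s. (g w, s, d))) 1 (w, T, p) (g w, T, p + shift d)"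
  using runs_Act[of "\<lambda>w s. (g w, s, d)" w T p] by simp

datatype part = First | Second | Body

instance part :: finite
proof
  show "finite (UNIV :: part set)"
    by (rule finite_subset[of _ "{First, Second, Body}"]) (auto intro: part.exhaust)
qed

text \<open>The tokens with first bit True are those of \<open>Conj\<close> and \<open>Disj\<close>,
  and they differ in the second bit.\<close>

fun dualise :: "phase \<Rightarrow> bool \<Rightarrow> phase \<times> bool" where
  "dualise (Tok2 True) b = (Tok, \<not> b)"
| "dualise ph b = (next_phase ph b, b)"

text \<open>The last two components are the bits that are still to be written: the formula is shifted
  by the two bits of a leading negation.\<close>
type_synonym control = "phase \<times> part \<times> bool \<times> bool"

text \<open>A number ends when the phase returns to \<open>Tok\<close>; both header numbers are
  copied. The buffer is then filled with \<open>False, True\<close>, the token of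
  \<open>Neg\<close>.\<close>

fun negate_step :: "control \<Rightarrow> bool \<Rightarrow> control \<times> bool" where
  "negate_step (ph, First, c, d) b =
     (let ph' = next_phase ph b in
      if ph' = Tok then ((Mark, Second, c, d), b) else ((ph', First, c, d), b))"
| "negate_step (ph, Second, c, d) b =
     (let ph' = next_phase ph b in
      if ph' = Tok then ((Tok, Body, False, True), b) else ((ph', Second, c, d), b))"
| "negate_step (ph, Body, c, d) b =
     (case dualise ph b of (ph', b') \<Rightarrow> ((ph', Body, d, b'), c))"

definition pending :: "control \<Rightarrow> bool list" where
  "pending w = (case w of (ph, t, c, d) \<Rightarrow> if t = Body then [c, d] else [])"

definition negate_start :: control where
  "negate_start = (Mark, First, False, False)"

definition negate_code :: "bool list \<Rightarrow> bool list" where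
  "negate_code y = (case mealy negate_step negate_start y of (w, bs) \<Rightarrow> bs @ pending w)"

text \<open>The surrounding cells are arbitrary, so a blank is written before the string to stop the
  rewinding and another behind the result to end the output. The control is reset because a machine
  halts in a single state.\<close>

definition negate_prog :: "control tcom" where
  "negate_prog = TSeq (TSeq (Act (\<lambda>w s. (negate_start, s, Lft))) (Act (\<lambda>w s. (w, Blank, Rgt))))
    (TSeq (sweep negate_step)
    (TSeq (TIf (\<lambda>w s. pending w = []) (movn Stay 0)
             (TSeq (Act (\<lambda>w s. (w, Bit (pending w ! 0), Rgt))) (Act (\<lambda>w s. (w, Bit (pending w ! 1), Rgt)))))
    (TSeq (Act (\<lambda>w s. (w, Blank, Lft)))
    (TSeq rewind (Act (\<lambda>w s. (negate_start, s, Rgt)))))))"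

lemma runs_negate_prog:
  assumes "reads T p y"
  shows "\<exists>T'. (\<forall>w. runs negate_prog (6 * length y + 20) (w, T, p) (negate_start, T', p)) \<and>
    reads T' p (negate_code y)"
proof -
  let ?n = "length y"
  let ?T1 = "T(p - 1 := Blank)"
  obtain v bs where m: "mealy negate_step negate_start y = (v, bs)"
    by (cases "mealy negate_step negate_start y")
  have lbs: "length bs = ?n" using length_mealy[of negate_step negate_start y] m by simp
  have 1: "runs (TSeq (Act (\<lambda>w s. (negate_start, s, Lft))) (Act (\<lambda>w s. (w, Blank, Rgt)))) (1 + 1)
      (w, T, p) (negate_start, ?T1, p)" for w
    using runs_TSeq[OF runs_Act[of "\<lambda>w s. (negate_start, s, Lft)" w T p negate_start "T p" Lft]
      runs_Act[of "\<lambda>w s. (w, Blank, Rgt)" negate_start "T(p := T p)" "p + shift Lft" negate_start Blank Rgt]]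
    by simp
  have "reads ?T1 p y" using assms by (simp add: reads_def)
  then have 2: "runs (sweep negate_step) (3 * ?n + 1) (negate_start, ?T1, p) (v, put ?T1 p bs, p + int ?n)"
    using runs_sweep[of ?T1 p y negate_step negate_start] m by simp
  let ?cs = "bs @ pending v"
  let ?T2 = "put ?T1 p bs"
  have put_append: "put S q (us @ vs) = put (put S q us) (q + int (length us)) vs" for S q us vs
    by (induction us arbitrary: S q) (simp_all add: algebra_simps)
  have pend: "pending v = [] \<or> (\<exists>c d. pending v = [c, d])"
    by (auto simp: pending_def split: prod.splits)
  have 3: "runs (TIf (\<lambda>w s. pending w = []) (movn Stay 0)
             (TSeq (Act (\<lambda>w s. (w, Bit (pending w ! 0), Rgt))) (Act (\<lambda>w s. (w, Bit (pending w ! 1), Rgt)))))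
       (2 + 2) (v, ?T2, p + int ?n) (v, put ?T1 p ?cs, p + int (length ?cs))"
  proof (rule runs_TIf)
    let ?b = "TSeq (Act (\<lambda>w s. (w, Bit (pending w ! 0), Rgt))) (Act (\<lambda>w s. (w, Bit (pending w ! 1), Rgt)))"
    show "if pending v = []
       then runs (movn Stay 0) 2 (v, ?T2, p + int ?n) (v, put ?T1 p ?cs, p + int (length ?cs))
       else runs ?b 2 (v, ?T2, p + int ?n) (v, put ?T1 p ?cs, p + int (length ?cs))"
    proof (cases "pending v = []")
      case True
      then show ?thesis using runs_mono[OF runs_movn[of Stay 0 v ?T2 "p + int ?n"], of 2] lbs
        by (simp del: movn.simps)
    next
      case False
      then obtain c d where cd: "pending v = [c, d]" using pend by blast
      have "runs ?b (1 + 1) (v, ?T2, p + int ?n)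
          (v, ?T2(p + int ?n := Bit c, p + int ?n + 1 := Bit d), p + int ?n + 1 + 1)"
        using runs_TSeq[OF runs_Act[of "\<lambda>w s. (w, Bit (pending w ! 0), Rgt)" v ?T2 "p + int ?n" v "Bit c" Rgt]
          runs_Act[of "\<lambda>w s. (w, Bit (pending w ! 1), Rgt)" v "?T2(p + int ?n := Bit c)" "p + int ?n + shift Rgt" v "Bit d" Rgt]]
          cd by simp
      then show ?thesis using cd lbs by (simp add: put_append algebra_simps numeral_2_eq_2)
    qed
  qed
  let ?N = "length ?cs"
  let ?T3 = "put ?T1 p ?cs"
  let ?T4 = "?T3(p + int ?N := Blank)"
  have 4: "runs (Act (\<lambda>w s. (w, Blank, Lft))) 1 (v, ?T3, p + int ?N) (v, ?T4, p - 1 + int ?N)"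
    using runs_Act[of "\<lambda>w s. (w, Blank, Lft)" v ?T3 "p + int ?N"] by (simp add: algebra_simps)
  have rd: "reads ?T4 p ?cs" by (simp add: reads_def put_apply)
  have N: "?N \<le> ?n + 2" using pend lbs by auto
  have "runs rewind (3 * ?N + 1) (v, ?T4, p - 1 + int ?N) (v, ?T4, p - 1)"
    by (rule runs_rewind) (simp_all add: put_apply)
  then have 5: "runs rewind (3 * (?n + 2) + 1) (v, ?T4, p - 1 + int ?N) (v, ?T4, p - 1)"
    by (rule runs_mono) (use N in simp)
  have 6: "runs (Act (\<lambda>w s. (negate_start, s, Rgt))) 1 (v, ?T4, p - 1) (negate_start, ?T4, p)"
    using runs_move[of "\<lambda>w. negate_start" Rgt v ?T4 "p - 1"] by simp
  have "runs negate_prog ((1 + 1) + ((3 * ?n + 1) + ((2 + 2) + (1 + ((3 * (?n + 2) + 1) + 1)))))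
      (w, T, p) (negate_start, ?T4, p)" for w
    unfolding negate_prog_def
    by (rule runs_TSeq[OF 1 runs_TSeq[OF 2 runs_TSeq[OF 3 runs_TSeq[OF 4 runs_TSeq[OF 5 6]]]]])
  then have "runs negate_prog (6 * ?n + 20) (w, T, p) (negate_start, ?T4, p)" for w
    by (rule runs_mono) simp
  moreover have "negate_code y = ?cs" by (simp add: negate_code_def m)
  ultimately show ?thesis using rd by metis
qed

lemma poly_time_negate_code:
  assumes "poly_time_computable f"
  shows "poly_time_computable (\<lambda>x. negate_code (f x))"
proof -
  obtain M where M: "valid_tm M" "\<And>T p B T' p'. (\<And>w. runs negate_prog B (w, T, p) (negate_start, T', p')) \<Longrightarrow>
      \<exists>t\<le>B. (atm_step M ^^ t) (0, T, p) = (fst (snd M), T', p')"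
    using tcom_machine[of negate_prog negate_start] by blast
  show ?thesis
  proof (rule poly_time_computable_compose[OF assms M(1)])
    show "poly (\<lambda>n. 6 * n + 20)" by (intro poly_add poly_mult poly_const poly_id)
    show "mono (\<lambda>n. 6 * n + 20 :: nat)" by (simp add: mono_def)
    fix T p y assume "reads T p y"
    then obtain T' where "\<And>w. runs negate_prog (6 * length y + 20) (w, T, p) (negate_start, T', p)"
      "reads T' p (negate_code y)" using runs_negate_prog by metis
    then show "\<exists>t\<le>6 * length y + 20. \<exists>T' p'. (atm_step M ^^ t) (0, T, p) = (fst (snd M), T', p') \<and>
        reads T' p' (negate_code y)" using M(2) by blast
  qed
qed

section \<open>Dual formulas and complemented solutions\<close>

fun dual :: "form \<Rightarrow> form" where
  "dual (Var i) = Var i"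
| "dual (Neg p) = Neg (dual p)"
| "dual (Conj p q) = Disj (dual p) (dual q)"
| "dual (Disj p q) = Conj (dual p) (dual q)"

lemma eval_dual: "eval (dual p) \<sigma> \<longleftrightarrow> \<not> eval p (\<lambda>i. \<not> \<sigma> i)"
  by (induction p) auto

lemma vars_below_dual: "vars_below m (dual p) = vars_below m p"
  by (induction p) auto

lemma mealy_dualise_enc_nat: "mealy dualise Mark (enc_nat n) = (Tok, enc_nat n)"
proof -
  have "mealy dualise Mark (concat (map (\<lambda>b. [True, b]) bs) @ [False]) =
    (Tok, concat (map (\<lambda>b. [True, b]) bs) @ [False])" for bs
    by (induction bs) simp_all
  then show ?thesis by (simp add: enc_nat_def)
qed

lemma mealy_dualise_enc_form: "mealy dualise Tok (enc_form p) = (Tok, enc_form (dual p))"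
  by (induction p) (simp_all add: mealy_append mealy_dualise_enc_nat)

lemma mealy_negate_header:
  "mealy negate_step (Mark, First, c, d) (enc_nat n) = ((Mark, Second, c, d), enc_nat n)"
  "mealy negate_step (Mark, Second, c, d) (enc_nat n) = ((Tok, Body, False, True), enc_nat n)"
proof -
  have "mealy negate_step (Mark, First, c, d) (concat (map (\<lambda>b. [True, b]) bs) @ [False]) =
    ((Mark, Second, c, d), concat (map (\<lambda>b. [True, b]) bs) @ [False])" for bs
    by (induction bs) simp_all
  moreover have "mealy negate_step (Mark, Second, c, d) (concat (map (\<lambda>b. [True, b]) bs) @ [False]) =
    ((Tok, Body, False, True), concat (map (\<lambda>b. [True, b]) bs) @ [False])" for bs
    by (induction bs) simp_all
  ultimately show "mealy negate_step (Mark, First, c, d) (enc_nat n) = ((Mark, Second, c, d), enc_nat n)"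
    "mealy negate_step (Mark, Second, c, d) (enc_nat n) = ((Tok, Body, False, True), enc_nat n)"
    by (simp_all add: enc_nat_def)
qed

lemma mealy_negate_body:
  "(case mealy negate_step (ph, Body, c, d) bs of (w, cs) \<Rightarrow> cs @ pending w) = c # d # snd (mealy dualise ph bs)"
proof (induction bs arbitrary: ph c d)
  case Nil
  show ?case by (simp add: pending_def)
next
  case (Cons b bs)
  obtain ph' b' where "dualise ph b = (ph', b')" by (cases "dualise ph b")
  then show ?case using Cons[of ph' d b'] by (simp add: case_prod_unfold)
qed

lemma negate_code_enc2: "negate_code (enc2 (m, m', p)) = enc2 (m, m', Neg (dual p))"
  using mealy_negate_body[of Tok False True "enc_form p"]
  by (simp add: negate_code_def enc2_def negate_start_def mealy_append mealy_negate_header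
      mealy_dualise_enc_form case_prod_unfold)

lemma Not_image_UNIV: "range Not = UNIV"
  by (auto simp: UNIV_bool)

text \<open>Complementing \<open>y\<close> only permutes the strings over which it ranges, so
  complementing \<open>x\<close> is a bijection between the solutions: uniqueness is preserved and
  the first bit flips. A first bit exists because \<open>m\<close> is positive.\<close>

lemma UVAL2_fun_complement:
  assumes "1 \<le> m" and g: "\<And>x y. length x = m \<Longrightarrow> length y = m' \<Longrightarrow> g x y = f (map Not x) (map Not y)"
  shows "UVAL2_fun m m' g = Not ` UVAL2_fun m m' f"
proof -
  define A where "A f x \<longleftrightarrow> length x = m \<and> (\<forall>y. length y = m' \<longrightarrow> f x y)" for f :: "bool list \<Rightarrow> bool list \<Rightarrow> bool" and x
  have NN: "map Not (map Not x) = x" for x by (induction x) simp_all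
  have AA: "A g x \<longleftrightarrow> A f (map Not x)" for x
  proof (cases "length x = m")
    case True
    have "(\<forall>y. length y = m' \<longrightarrow> f (map Not x) (map Not y)) \<longleftrightarrow> (\<forall>y. length y = m' \<longrightarrow> f (map Not x) y)"
      by (metis NN length_map)
    then show ?thesis using True g by (simp add: A_def)
  qed (simp add: A_def)
  have U: "UVAL2_fun m m' f = (if \<exists>!x. A f x then {hd (THE x. A f x)} else UNIV)" for f
    by (simp add: UVAL2_fun_def A_def)
  show ?thesis
  proof (cases "\<exists>!x. A f x")
    case True
    then obtain x where x: "A f x" "\<And>z. A f z \<Longrightarrow> z = x" by blast
    have "A g (map Not x)" "\<And>z. A g z \<Longrightarrow> z = map Not x"
      using x by (metis AA NN)+
    then have "\<exists>!z. A g z" "(THE z. A g z) = map Not x" by (blast, blast)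
    moreover have "(THE z. A f z) = x" using x by blast
    moreover have "x \<noteq> []" using x(1) assms(1) by (auto simp: A_def)
    ultimately show ?thesis using True by (simp add: U hd_map)
  next
    case False
    then have "\<nexists>!z. A g z" by (metis AA NN)
    then show ?thesis using False by (simp add: U Not_image_UNIV)
  qed
qed

lemma UVAL2_negate_code: "UVAL2 (negate_code s) \<subseteq> pneg UVAL2 s"
proof (cases "\<exists>P. valid2 P \<and> enc2 P = s")
  case True
  then obtain m m' p where v: "valid2 (m, m', p)" and s: "s = enc2 (m, m', p)" by auto
  have v': "valid2 (m, m', Neg (dual p))" using v by (simp add: valid2_def vars_below_dual)
  have "UVAL2 (negate_code s) = UVAL2_fun m m' (\<lambda>x y. eval (Neg (dual p)) (\<lambda>i. (x @ y) ! i))"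
    unfolding s negate_code_enc2 by (rule UVAL2_enc2[OF v'])
  also have "\<dots> = Not ` UVAL2_fun m m' (\<lambda>x y. eval p (\<lambda>i. (x @ y) ! i))"
  proof (rule UVAL2_fun_complement)
    show "1 \<le> m" using v by (simp add: valid2_def)
    fix x y :: "bool list" assume "length x = m" "length y = m'"
    then show "eval (Neg (dual p)) (\<lambda>i. (x @ y) ! i) = eval p (\<lambda>i. (map Not x @ map Not y) ! i)"
      using v by (simp add: eval_dual valid2_def) (rule eval_cong, auto simp: nth_append)
  qed
  also have "\<dots> = pneg UVAL2 s" unfolding s pneg_def using UVAL2_enc2[OF v] by simp
  finally show ?thesis by simp
next
  case False
  then have "UVAL2 s = UNIV" by (auto simp: UVAL2_def)
  then have "pneg UVAL2 s = UNIV" by (simp add: pneg_def Not_image_UNIV)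
  then show ?thesis by simp
qed

lemma negate_code_Nil_iff: "y \<noteq> [] \<Longrightarrow> negate_code y \<noteq> []"
  using length_mealy[of negate_step negate_start y]
  by (cases "mealy negate_step negate_start y") (auto simp: negate_code_def)

text \<open>Both inclusions append the same map to a given reduction: complementing twice is the
  identity on sets of bits, so \<open>negate_code\<close> serves in either direction.\<close>

theorem red_class_pneg_UVAL2: "red_class (pneg UVAL2) = red_class UVAL2"
proof -
  have "\<phi> \<propto> \<psi>'" if "\<phi> \<propto> \<psi>" "\<And>s. \<psi>' (negate_code s) \<subseteq> \<psi> s" for \<phi> \<psi> \<psi>'
  proof -
    obtain \<mu> where \<mu>: "poly_time_computable \<mu>" "\<And>x. x \<noteq> [] \<Longrightarrow> \<mu> x \<noteq> [] \<and> \<psi> (\<mu> x) \<subseteq> \<phi> x"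
      using \<open>\<phi> \<propto> \<psi>\<close> unfolding reduces_def by blast
    then show ?thesis
      unfolding reduces_def using poly_time_negate_code[OF \<mu>(1)] negate_code_Nil_iff that(2)
      by (meson order_trans)
  qed
  moreover have "pneg UVAL2 (negate_code s) \<subseteq> UVAL2 s" for s
  proof -
    have "pneg UVAL2 (negate_code s) \<subseteq> Not ` Not ` UVAL2 s"
      using UVAL2_negate_code[of s] unfolding pneg_def by (rule image_mono)
    then show ?thesis by (auto simp: image_iff)
  qed
  ultimately show ?thesis using UVAL2_negate_code unfolding red_class_def by blast
qed

section \<open>Expressing maximality by a universally quantified formula\<close>

definition num :: "bool list \<Rightarrow> nat" where
  "num bs = foldl (\<lambda>n b. 2 * n + of_bool b) 0 bs"

lemma num_Nil [simp]: "num [] = 0" and num_snoc [simp]: "num (bs @ [b]) = 2 * num bs + of_bool b"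
  by (simp_all add: num_def)

lemma num_less: "num bs < 2 ^ length bs"
  by (induction bs rule: rev_induct) (auto simp: of_bool_def)

lemma num_ge: "2 ^ length bs \<le> num (True # bs)"
proof (induction bs rule: rev_induct)
  case (snoc b bs)
  then show ?case using num_snoc[of "True # bs" b] by simp
qed (simp add: num_def)

text \<open>The leading True preserves initial zeros, so the bit string can be recovered from the
  number.\<close>

lemma bin_num: "bin (num (True # bs)) = True # bs"
proof (induction bs rule: rev_induct)
  case Nil
  show ?case by (simp add: num_def bin_pos)
next
  case (snoc b bs)
  have "0 < num (True # bs)" using num_ge[of bs] by (metis less_le_trans zero_less_numeral zero_less_power)
  then show ?case using snoc num_snoc[of "True # bs" b] bin_pos[of "num (True # bs @ [b])"] by simp
qed

lemma num_power: "num (True # replicate k False) = 2 ^ k"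
proof (induction k)
  case (Suc k)
  have "True # replicate (Suc k) False = (True # replicate k False) @ [False]"
    by (simp add: replicate_append_same)
  then show ?case using Suc by (simp only: num_snoc) simp
qed (simp add: num_def)

lemma length_bin_le: "length (bin k) \<le> k"
proof (induction k rule: less_induct)
  case (less k)
  show ?case
  proof (cases "k = 0")
    case False
    then have "length (bin (k div 2)) \<le> k div 2" by (intro less) simp
    then show ?thesis using False by (simp add: bin_pos)
  qed simp
qed

text \<open>Universally quantified variables are named by bit strings: those of the assignment by the
  codes of the original variables, those that select a leaf by the prefixes of such codes. The
  padding makes all names exceed the number of leaves.\<close>
definition name :: "nat \<Rightarrow> bool list \<Rightarrow> nat" where
  "name n w = num (True # w @ replicate n False)"

lemma name_inject: "name n v = name n w \<longleftrightarrow> v = w"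
proof
  assume "name n v = name n w"
  then have "bin (name n v) = bin (name n w)" by simp
  then show "v = w" by (simp add: name_def bin_num)
qed simp

text \<open>With at most \<open>2 ^ n\<close> leaves, every name lies beyond the coordinates of
  \<open>x\<close> and denotes one of \<open>y\<close>.\<close>

lemma name_ge: "2 ^ n \<le> name n w"
proof -
  have "2 ^ n \<le> (2 :: nat) ^ length (w @ replicate n False)" by (intro power_increasing) simp_all
  then show ?thesis unfolding name_def using num_ge by (rule order_trans)
qed

text \<open>The exponent counts the leading bit, at most \<open>n\<close> bits of \<open>w\<close>
  and \<open>n\<close> bits of padding. It fixes the number of coordinates of
  \<open>y\<close>.\<close>

lemma name_less: "length w \<le> n \<Longrightarrow> name n w < 2 ^ (2 * n + 1)"
proof -
  assume "length w \<le> n"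
  then have "(2 :: nat) ^ length (True # w @ replicate n False) \<le> 2 ^ (2 * n + 1)"
    by (intro power_increasing) simp_all
  with num_less show ?thesis unfolding name_def by (rule less_le_trans)
qed

section \<open>The formula for the lexicographic maximum\<close>

primrec leaves :: "form \<Rightarrow> nat list" where
  "leaves (Var i) = [i]"
| "leaves (Neg p) = leaves p"
| "leaves (Conj p q) = leaves p @ leaves q"
| "leaves (Disj p q) = leaves p @ leaves q"

primrec relabel :: "form \<Rightarrow> nat \<Rightarrow> form" where
  "relabel (Var i) k = Var k"
| "relabel (Neg p) k = Neg (relabel p k)"
| "relabel (Conj p q) k = Conj (relabel p k) (relabel q (k + length (leaves p)))"
| "relabel (Disj p q) k = Disj (relabel p k) (relabel q (k + length (leaves p)))"

primrec rename :: "nat \<Rightarrow> form \<Rightarrow> form" where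
  "rename n (Var i) = Var (name n (enc_nat i))"
| "rename n (Neg p) = Neg (rename n p)"
| "rename n (Conj p q) = Conj (rename n p) (rename n q)"
| "rename n (Disj p q) = Disj (rename n p) (rename n q)"

text \<open>\<open>form\<close> has no constants; variable 0 always exists because arities are
  positive.\<close>

definition tt :: form where "tt = Disj (Var 0) (Neg (Var 0))"
definition ff :: form where "ff = Conj (Var 0) (Neg (Var 0))"

definition lit :: "bool \<Rightarrow> nat \<Rightarrow> form" where
  "lit b i = (if b then Var i else Neg (Var i))"

text \<open>An assignment \<open>u\<close> describes a path in the binary tree: at node
  \<open>v\<close> it continues with the bit \<open>u (name n v)\<close>. The formula says that the
  path continues from \<open>v\<close> along the given bits.\<close>

primrec matches :: "nat \<Rightarrow> bool list \<Rightarrow> bool list \<Rightarrow> form" where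
  "matches n v [] = tt"
| "matches n v (b # bs) = Conj (lit b (name n v)) (matches n (v @ [b]) bs)"

primrec selects :: "nat \<Rightarrow> bool \<Rightarrow> nat list \<Rightarrow> nat \<Rightarrow> form" where
  "selects n b [] k = ff"
| "selects n b (i # is) k = Disj (Conj (matches n [] (enc_nat i)) (lit b k)) (selects n b is (Suc k))"

text \<open>Less at this coordinate, or at most equal and the same for the rest: in this form the
  formula for the remaining leaves occurs only once, which keeps it short.\<close>

primrec lex_ge :: "nat \<Rightarrow> nat list \<Rightarrow> nat \<Rightarrow> form" where
  "lex_ge n [] k = tt"
| "lex_ge n (i # is) k =
     Disj (Conj (Var k) (Neg (Var (name n (enc_nat i)))))
       (Conj (Disj (Var k) (Neg (Var (name n (enc_nat i))))) (lex_ge n is (Suc k)))"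

definition max_form :: "nat \<Rightarrow> form \<Rightarrow> form" where
  "max_form n q = Conj (relabel q 0)
     (Conj (Neg (Conj (selects n True (leaves q) 0) (selects n False (leaves q) 0)))
       (Disj (Neg (rename n q)) (lex_ge n (leaves q) 0)))"

lemma eval_tt [simp]: "eval tt \<sigma>" and eval_ff [simp]: "\<not> eval ff \<sigma>"
  by (simp_all add: tt_def ff_def)

lemma eval_lit [simp]: "eval (lit b i) \<sigma> \<longleftrightarrow> \<sigma> i = b"
  by (simp add: lit_def)

lemma eval_relabel:
  "(\<And>j. j < length (leaves q) \<Longrightarrow> \<sigma> (k + j) = z (leaves q ! j)) \<Longrightarrow> eval (relabel q k) \<sigma> = eval q z"
proof (induction q arbitrary: k)
  case (Var i) then show ?case by simp
next
  case (Neg p) then show ?case by simp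
next
  case (Conj p q)
  have "eval (relabel p k) \<sigma> = eval p z"
    using Conj.prems by (intro Conj.IH(1)) (metis leaves.simps(3) length_append nth_append trans_less_add1)
  moreover have "eval (relabel q (k + length (leaves p))) \<sigma> = eval q z"
  proof (rule Conj.IH(2))
    fix j assume "j < length (leaves q)"
    then show "\<sigma> (k + length (leaves p) + j) = z (leaves q ! j)"
      using Conj.prems[of "length (leaves p) + j"] by (simp add: add.assoc)
  qed
  ultimately show ?case by simp
next
  case (Disj p q)
  have "eval (relabel p k) \<sigma> = eval p z"
    using Disj.prems by (intro Disj.IH(1)) (metis leaves.simps(4) length_append nth_append trans_less_add1)
  moreover have "eval (relabel q (k + length (leaves p))) \<sigma> = eval q z"
  proof (rule Disj.IH(2))
    fix j assume "j < length (leaves q)"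
    then show "\<sigma> (k + length (leaves p) + j) = z (leaves q ! j)"
      using Disj.prems[of "length (leaves p) + j"] by (simp add: add.assoc)
  qed
  ultimately show ?case by simp
qed

lemma eval_rename: "eval (rename n q) \<sigma> = eval q (\<lambda>i. \<sigma> (name n (enc_nat i)))"
  by (induction q) simp_all

lemma eval_matches:
  "eval (matches n v w) \<sigma> \<longleftrightarrow> (\<forall>l<length w. \<sigma> (name n (v @ take l w)) = w ! l)"
  by (induction w arbitrary: v) (auto simp: less_Suc_eq_0_disj)

lemma eval_selects:
  "eval (selects n b is k) \<sigma> \<longleftrightarrow>
     (\<exists>j<length is. eval (matches n [] (enc_nat (is ! j))) \<sigma> \<and> \<sigma> (k + j) = b)"
  by (induction "is" arbitrary: k) (simp_all add: Ex_less_Suc2)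

lemma eval_lex_ge:
  "eval (lex_ge n is k) \<sigma> \<longleftrightarrow>
     map (\<lambda>i. \<sigma> (name n (enc_nat i))) is \<le> map \<sigma> [k..<k + length is]"
proof (induction "is" arbitrary: k)
  case (Cons i "is")
  have "[k..<k + length (i # is)] = k # [Suc k..<Suc k + length is]"
    using upt_conv_Cons[of k "k + length (i # is)"] by simp
  then show ?case using Cons[of "Suc k"] by (auto simp: less_bool_def)
qed simp

text \<open>Two codes on the same path agree up to the shorter length, so one is a prefix of the
  other; but codes are prefix-free.\<close>

lemma matches_unique:
  assumes "eval (matches n [] (enc_nat i)) \<sigma>" "eval (matches n [] (enc_nat j)) \<sigma>"
  shows "i = j"
proof -
  let ?v = "enc_nat i" and ?w = "enc_nat j"
  have v: "\<And>l. l < length ?v \<Longrightarrow> \<sigma> (name n (take l ?v)) = ?v ! l"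
    and w: "\<And>l. l < length ?w \<Longrightarrow> \<sigma> (name n (take l ?w)) = ?w ! l"
    using assms by (auto simp: eval_matches)
  have "take l ?v = take l ?w" if "l \<le> length ?v" "l \<le> length ?w" for l
    using that
  proof (induction l)
    case (Suc l)
    then show ?case using v[of l] w[of l] by (simp add: take_Suc_conv_app_nth)
  qed simp
  then have "\<exists>s t. ?v @ s = ?w @ t"
    by (metis append_take_drop_id linorder_linear order_refl take_all)
  then show ?thesis by (auto simp: enc_nat_append_inject)
qed

text \<open>The assignment directs the path along \<open>w\<close>. Prefixes at distinct positions
  have distinct lengths and so distinct names, hence no node is given two directions.\<close>

lemma matches_exists: "eval (matches n [] w) (\<lambda>v. \<exists>l<length w. v = name n (take l w) \<and> w ! l)"
proof -
  have "l = l'" if "l < length w" "l' < length w" "take l w = take l' w" for l l'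
    using arg_cong[OF that(3), of length] that(1,2) by simp
  then show ?thesis by (auto simp: eval_matches name_inject)
qed

definition with_prefix :: "bool list \<Rightarrow> (nat \<Rightarrow> bool) \<Rightarrow> nat \<Rightarrow> bool" where
  "with_prefix x u i = (if i < length x then x ! i else u i)"

lemma with_prefix_name [simp]: "length x \<le> 2 ^ n \<Longrightarrow> with_prefix x u (name n w) = u (name n w)"
  unfolding with_prefix_def by (rule if_not_P) (meson name_ge leD less_le_trans)

lemma eval_max_form:
  fixes q :: form
  defines "is \<equiv> leaves q"
  assumes x: "length x = length is" and n: "length is \<le> 2 ^ n"
  shows "(\<forall>u. eval (max_form n q) (with_prefix x u)) \<longleftrightarrow>
     (\<exists>z. eval q z \<and> x = map z is) \<and> (\<forall>y. eval q y \<longrightarrow> map y is \<le> x)"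
proof -
  have xn: "length x \<le> 2 ^ n" using x n by simp
  have low: "with_prefix x u j = x ! j" if "j < length is" for j u
    using that x by (simp add: with_prefix_def)
  have high: "eval (rename n q) (with_prefix x u) = eval q (\<lambda>i. u (name n (enc_nat i)))" for u
    using xn by (simp add: eval_rename)
  have sel: "eval (selects n b is 0) (with_prefix x u) \<longleftrightarrow>
      (\<exists>j<length is. eval (matches n [] (enc_nat (is ! j))) u \<and> x ! j = b)" for b u
    using xn low by (auto simp: eval_selects eval_matches)
  have map_low: "map (with_prefix x u) [0..<length is] = x" for u
    using low x by (intro nth_equalityI) simp_all
  have lex: "eval (lex_ge n is 0) (with_prefix x u) \<longleftrightarrow> map (\<lambda>i. u (name n (enc_nat i))) is \<le> x" for u
    using xn map_low[of u] by (simp add: eval_lex_ge)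
  have rel: "eval (relabel q 0) (with_prefix x u) = eval q z" if "x = map z is" for u z
    using that low by (intro eval_relabel) (simp add: is_def)
  show ?thesis
  proof
    assume all: "\<forall>u. eval (max_form n q) (with_prefix x u)"
    \<comment> \<open>Each conjunct may be tested with its own \<open>u\<close>. Two leaves of one
      variable with different values are both selected by the path along its code.\<close>
    have consistent: "x ! j = x ! k" if "j < length is" "k < length is" "is ! j = is ! k" for j k
    proof (rule ccontr)
      assume ne: "x ! j \<noteq> x ! k"
      let ?w = "enc_nat (is ! j)"
      let ?u = "\<lambda>v. \<exists>l<length ?w. v = name n (take l ?w) \<and> ?w ! l"
      have "eval (matches n [] ?w) ?u" by (rule matches_exists)
      then have "eval (selects n b is 0) (with_prefix x ?u)" for b
        unfolding sel
      proof (cases "x ! j = b")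
        case True
        then show "\<exists>j<length is. eval (matches n [] (enc_nat (is ! j))) ?u \<and> x ! j = b"
          using that \<open>eval (matches n [] ?w) ?u\<close> by blast
      next
        case False
        then have "x ! k = b" using ne by blast
        then show "\<exists>j<length is. eval (matches n [] (enc_nat (is ! j))) ?u \<and> x ! j = b"
          using that \<open>eval (matches n [] ?w) ?u\<close> by (intro exI[of _ k]) simp
      qed
      then show False using all[rule_format, of ?u] by (simp add: max_form_def is_def)
    qed
    \<comment> \<open>Consistency makes the value independent of the leaf chosen; a variable at no
      leaf gets False.\<close>
    define z where "z i = (\<exists>j<length is. is ! j = i \<and> x ! j)" for i
    have "x ! j = z (is ! j)" if "j < length is" for j
      unfolding z_def using consistent[OF _ that] that by blast
    then have xz: "x = map z is" using x by (intro nth_equalityI) simp_all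
    have "eval (relabel q 0) (with_prefix x (\<lambda>_. False))" using all by (simp add: max_form_def)
    then have "eval q z" using rel[OF xz] by simp
    moreover have "map y is \<le> x" if "eval q y" for y
    proof -
      \<comment> \<open>The competing assignment \<open>y\<close>, transported to the names of full
        codes; injectivity of names and codes lets it be read back.\<close>
      define u where "u v = (\<exists>i. v = name n (enc_nat i) \<and> y i)" for v
      have u: "u (name n (enc_nat i)) = y i" for i
        using enc_nat_append_inject[of _ "[]" _ "[]"] by (auto simp: u_def name_inject)
      have "eval (rename n q) (with_prefix x u)" unfolding high u using that .
      then have "eval (lex_ge n is 0) (with_prefix x u)" using all[rule_format, of u] by (simp add: max_form_def is_def)
      then show ?thesis unfolding lex u .
    qed
    ultimately show "(\<exists>z. eval q z \<and> x = map z is) \<and> (\<forall>y. eval q y \<longrightarrow> map y is \<le> x)" using xz by blast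
  next
    assume r: "(\<exists>z. eval q z \<and> x = map z is) \<and> (\<forall>y. eval q y \<longrightarrow> map y is \<le> x)"
    then obtain z where z: "eval q z" "x = map z is" by blast
    show "\<forall>u. eval (max_form n q) (with_prefix x u)"
    proof
      fix u
      have "eval (relabel q 0) (with_prefix x u)" using rel[OF z(2)] z(1) by simp
      moreover have "\<not> (eval (selects n True is 0) (with_prefix x u) \<and> eval (selects n False is 0) (with_prefix x u))"
      proof
        assume "eval (selects n True is 0) (with_prefix x u) \<and> eval (selects n False is 0) (with_prefix x u)"
        then obtain j k where "j < length is" "k < length is" "x ! j" "\<not> x ! k" "is ! j = is ! k"
          unfolding sel using matches_unique by metis
        then show False using z(2) by simp
      qed
      moreover have "eval (rename n q) (with_prefix x u) \<Longrightarrow> eval (lex_ge n is 0) (with_prefix x u)"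
        unfolding high lex using r by blast
      ultimately show "eval (max_form n q) (with_prefix x u)" by (auto simp: max_form_def is_def)
    qed
  qed
qed

section \<open>The instance of \<open>UVAL2\<close> and its value\<close>

lemma length_leaves_pos: "0 < length (leaves q)"
  by (induction q) auto

lemma length_leaves_le: "length (leaves q) \<le> length (enc_form q)"
  by (induction q) auto

lemma length_enc_nat_leaves: "i \<in> set (leaves q) \<Longrightarrow> length (enc_nat i) \<le> length (enc_form q)"
  by (induction q) auto

lemma vars_below_max_form:
  assumes "length (enc_form q) \<le> n"
  shows "vars_below (length (leaves q) + 2 ^ (2 * n + 1)) (max_form n q)"
proof -
  define M where "M = length (leaves q) + 2 ^ (2 * n + 1)"
  have nm: "name n w < M" if "length w \<le> n" for w using name_less[OF that] by (simp add: M_def)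
  have m0: "0 < M" by (simp add: M_def)
  have len: "length (enc_nat i) \<le> n" if "i \<in> set (leaves q)" for i
    using length_enc_nat_leaves[OF that] assms by simp
  have tf: "vars_below M tt" "vars_below M ff" using m0 by (simp_all add: tt_def ff_def)
  have 1: "vars_below M (relabel r k)" if "k + length (leaves r) \<le> M" for r k
    using that by (induction r arbitrary: k) (auto simp: add.assoc)
  have 2: "vars_below M (rename n r)" if "set (leaves r) \<subseteq> set (leaves q)" for r
    using that by (induction r) (auto intro!: nm len)
  have 3: "vars_below M (matches n v w)" if "length v + length w \<le> n" for v w
    using that by (induction w arbitrary: v) (auto simp: tf m0 lit_def intro!: nm)
  have 4: "vars_below M (selects n b js k)" if "set js \<subseteq> set (leaves q)" "k + length js \<le> M" for b js k
    using that by (induction js arbitrary: k) (auto simp: tf m0 lit_def intro!: 3 len)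
  have 5: "vars_below M (lex_ge n js k)" if "set js \<subseteq> set (leaves q)" "k + length js \<le> M" for js k
    using that by (induction js arbitrary: k) (auto simp: tf intro!: nm len)
  have "length (leaves q) \<le> M" by (simp add: M_def)
  then show ?thesis unfolding max_form_def M_def[symmetric]
    using 1[of 0 q] 2[of q] 4[of "leaves q" 0] 5[of "leaves q" 0] by simp
qed

lemma UVAL2_fun_max_form:
  fixes q :: form
  defines "S \<equiv> {map z (leaves q) | z. eval q z}"
  assumes n: "length (enc_form q) \<le> n" and sat: "\<exists>z. eval q z"
  shows "UVAL2_fun (length (leaves q)) (2 ^ (2 * n + 1)) (\<lambda>x y. eval (max_form n q) (\<lambda>i. (x @ y) ! i)) = {hd (Max S)}"
proof -
  let ?N = "length (leaves q)" and ?m = "2 ^ (2 * n + 1) :: nat"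
  have N: "?N \<le> 2 ^ n" using length_leaves_le[of q] n less_exp[of n] by linarith
  have S: "finite S" "S \<noteq> {}"
  proof -
    have "S \<subseteq> {x. set x \<subseteq> UNIV \<and> length x = ?N}" by (auto simp: S_def)
    then show "finite S" by (rule finite_subset) (rule finite_lists_length_eq, simp)
    show "S \<noteq> {}" using sat by (auto simp: S_def)
  qed
  have "length x = ?N \<and> (\<forall>y. length y = ?m \<longrightarrow> eval (max_form n q) (\<lambda>i. (x @ y) ! i)) \<longleftrightarrow> x = Max S" for x
  proof (cases "length x = ?N")
    case True
    have "(\<forall>y. length y = ?m \<longrightarrow> eval (max_form n q) (\<lambda>i. (x @ y) ! i)) \<longleftrightarrow>
        (\<forall>u. eval (max_form n q) (with_prefix x u))"
    proof
      assume a: "\<forall>y. length y = ?m \<longrightarrow> eval (max_form n q) (\<lambda>i. (x @ y) ! i)"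
      show "\<forall>u. eval (max_form n q) (with_prefix x u)"
      proof
        fix u :: "nat \<Rightarrow> bool"
        \<comment> \<open>Indices from \<open>?N + ?m\<close> on do not occur in the formula, so a
          list of length \<open>?m\<close> carries all that matters of \<open>u\<close>.\<close>
        let ?y = "map (\<lambda>j. u (?N + j)) [0..<?m]"
        have "eval (max_form n q) (\<lambda>i. (x @ ?y) ! i) = eval (max_form n q) (with_prefix x u)"
          using True by (intro eval_cong[OF vars_below_max_form[OF n]]) (auto simp: with_prefix_def nth_append)
        then show "eval (max_form n q) (with_prefix x u)" using a by simp
      qed
    next
      assume a: "\<forall>u. eval (max_form n q) (with_prefix x u)"
      show "\<forall>y. length y = ?m \<longrightarrow> eval (max_form n q) (\<lambda>i. (x @ y) ! i)"
      proof (intro allI impI)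
        fix y :: "bool list" assume "length y = ?m"
        have "with_prefix x (\<lambda>i. (x @ y) ! i) = (\<lambda>i. (x @ y) ! i)"
          by (auto simp: with_prefix_def nth_append)
        then show "eval (max_form n q) (\<lambda>i. (x @ y) ! i)" using a by metis
      qed
    qed
    also have "\<dots> \<longleftrightarrow> x \<in> S \<and> (\<forall>s\<in>S. s \<le> x)"
      using eval_max_form[OF True N] by (auto simp: S_def)
    also have "\<dots> \<longleftrightarrow> x = Max S" using S by (metis Max_eqI Max_ge Max_in)
    finally show ?thesis using True by simp
  next
    case False
    have "Max S \<in> S" using S by simp
    then show ?thesis using False by (auto simp: S_def)
  qed
  then show ?thesis by (simp add: UVAL2_fun_def)
qed

lemma hd_Max:
  fixes A :: "bool list set"
  assumes "finite A" "A \<noteq> {}" "[] \<notin> A"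
  shows "hd (Max A) \<longleftrightarrow> (\<exists>x\<in>A. hd x)"
proof
  assume "hd (Max A)"
  then show "\<exists>x\<in>A. hd x" using Max_in[OF assms(1,2)] by blast
next
  assume "\<exists>x\<in>A. hd x"
  then obtain x where x: "x \<in> A" "hd x" by blast
  have "x \<le> Max A" using assms(1) x(1) by simp
  moreover have "Max A \<noteq> []" "x \<noteq> []" using Max_in[OF assms(1,2)] assms(3) x(1) by auto
  ultimately show "hd (Max A)" using x(2) by (cases x; cases "Max A") (auto simp: less_bool_def)
qed

text \<open>The first leaf carries the bit that is asked for, and the second one, which no variable of
  \<open>p\<close> shares, makes the added conjunct satisfiable. It is written so that the whole formula is coded by a
  fixed string followed by the code of the instance.\<close>
definition guard :: "nat \<Rightarrow> form \<Rightarrow> form" where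
  "guard m p = Conj (Disj (Var 0) (Var m)) p"

text \<open>In order: the tokens of \<open>Conj\<close> and \<open>Disj\<close>, then
  \<open>Var 0\<close> with its empty numeral, then the token of the second \<open>Var\<close>,
  whose index \<open>m\<close> is the number with which \<open>enc1\<close> begins.\<close>

definition guard_code :: "bool list" where
  "guard_code = [True, False, True, True, False, False, False, False, False]"

lemma enc_form_guard: "enc_form (guard m p) = guard_code @ enc1 (m, p)"
  by (simp add: guard_def guard_code_def enc1_def enc_nat_def)

definition UVAL2_instance :: "nat \<Rightarrow> form \<Rightarrow> nat \<times> nat \<times> form" where
  "UVAL2_instance n q = (length (leaves q), 2 ^ (2 * n + 1), max_form n q)"

text \<open>The two maxima live on lists of different kinds and are compared only through the
  question whether some element starts with True.\<close>

theorem UVAL2_instance_MaxVAL: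
  assumes v: "valid1 (m, p)" and n: "n = length (enc_form (guard m p))"
  shows "UVAL2 (enc2 (UVAL2_instance n (guard m p))) \<subseteq> MaxVAL (enc1 (m, p))"
proof (cases "\<exists>x. length x = m \<and> eval p (\<lambda>i. x ! i)")
  case False
  then have "MaxVAL (enc1 (m, p)) = UNIV"
    unfolding MaxVAL_enc1[OF v] MaxVAL_fun_def by (rule if_not_P)
  then show ?thesis by simp
next
  case True
  let ?q = "guard m p"
  define A where "A = {x :: bool list. length x = m \<and> eval p (\<lambda>i. x ! i)}"
  define S where "S = {map z (leaves ?q) | z. eval ?q z}"
  have m: "1 \<le> m" "vars_below m p" using v by (simp_all add: valid1_def)
  have valid: "valid2 (UVAL2_instance n ?q)"
    using vars_below_max_form[of ?q n] length_leaves_pos[of ?q] n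
    by (simp add: valid2_def UVAL2_instance_def Suc_leI)
  have lift: "\<exists>z. eval ?q z \<and> z 0 = x ! 0" if "x \<in> A" for x
  proof -
    \<comment> \<open>The default True satisfies \<open>Var m\<close>, and with it the added
      disjunction, whatever the first bit is.\<close>
    define z where "z i = (if i < m then x ! i else True)" for i
    have "eval p z = eval p (\<lambda>i. x ! i)" by (rule eval_cong[OF m(2)]) (simp add: z_def)
    then have "eval ?q z" using that by (simp add: guard_def A_def z_def)
    moreover have "z 0 = x ! 0" using m(1) by (simp add: z_def)
    ultimately show ?thesis by blast
  qed
  have drop: "\<exists>x\<in>A. x ! 0 = z 0" if "eval ?q z" for z
  proof -
    have "eval p (\<lambda>i. map z [0..<m] ! i) = eval p z" by (rule eval_cong[OF m(2)]) simp
    then have "map z [0..<m] \<in> A" using that by (simp add: A_def guard_def)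
    moreover have "map z [0..<m] ! 0 = z 0" using m(1) by simp
    ultimately show ?thesis by blast
  qed
  have hd_leaves: "hd (map z (leaves ?q)) = z 0" for z by (simp add: guard_def)
  have fin: "finite {x. length x = k \<and> P x}" for k and P :: "bool list \<Rightarrow> bool"
    by (rule finite_subset[OF _ finite_lists_length_eq[of UNIV k]]) auto
  have A: "finite A" "A \<noteq> {}" "[] \<notin> A" using True m(1) fin by (auto simp: A_def)
  have S: "finite S" "S \<noteq> {}" "[] \<notin> S"
  proof -
    show "finite S" by (rule finite_subset[OF _ fin[of "length (leaves ?q)" "\<lambda>_. True"]]) (auto simp: S_def)
    show "S \<noteq> {}" using lift A(2) by (fastforce simp: S_def)
    show "[] \<notin> S" using length_leaves_pos[of ?q] by (auto simp: S_def)
  qed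
  have "hd (Max S) \<longleftrightarrow> (\<exists>z. eval ?q z \<and> z 0)"
    unfolding hd_Max[OF S] using hd_leaves by (auto simp: S_def)
  also have "\<dots> \<longleftrightarrow> (\<exists>x\<in>A. x ! 0)" using lift drop by metis
  also have "\<dots> \<longleftrightarrow> hd (Max A)"
    unfolding hd_Max[OF A] using A(3) by (metis hd_conv_nth)
  finally have "hd (Max S) = hd (Max A)" .
  moreover have "\<exists>z. eval ?q z" using lift A(2) by blast
  then have "UVAL2 (enc2 (UVAL2_instance n ?q)) = {hd (Max S)}"
    using UVAL2_enc2[OF valid[unfolded UVAL2_instance_def]] UVAL2_fun_max_form[of ?q n] n
    by (simp add: UVAL2_instance_def S_def)
  moreover have "MaxVAL (enc1 (m, p)) = {hd (Max A)}"
    using True by (simp add: MaxVAL_enc1[OF v] MaxVAL_fun_def A_def)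
  ultimately show ?thesis by simp
qed

section \<open>The program for the reduction of MaxVAL\<close>

text \<open>The control consists of the parser phase, the bit of the formula that was read last, the
  bit that was popped last, and a carry.\<close>
type_synonym vars = "phase \<times> bool \<times> bool option \<times> bool"

text \<open>Register 0 takes the output, 2 holds the formula, 3 is a clock of the same length, 4 is the
  leaf counter with its least significant bit on top, 5 is temporary, and 6 holds the part of the
  current leaf that was read. Register 1 stays free, because the simplifier turns 1 into
  \<open>Suc 0\<close>.\<close>
definition rg :: "bool list \<Rightarrow> bool list \<Rightarrow> bool list \<Rightarrow> bool list \<Rightarrow> bool list \<Rightarrow> bool list \<Rightarrow> nat \<Rightarrow> bool list" where
  "rg a b c d e f = (\<lambda>_. [])(0 := a, 2 := b, 3 := c, 4 := d, 5 := e, 6 := f)"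

lemma rg_apply [simp]:
  "rg a b c d e f 0 = a" "rg a b c d e f 2 = b" "rg a b c d e f 3 = c"
  "rg a b c d e f 4 = d" "rg a b c d e f 5 = e" "rg a b c d e f 6 = f"
  by (simp_all add: rg_def)

lemma rg_upd [simp]:
  "(rg a b c d e f)(0 := x) = rg x b c d e f" "(rg a b c d e f)(2 := x) = rg a x c d e f"
  "(rg a b c d e f)(3 := x) = rg a b x d e f" "(rg a b c d e f)(4 := x) = rg a b c x e f"
  "(rg a b c d e f)(5 := x) = rg a b c d x f" "(rg a b c d e f)(6 := x) = rg a b c d e x"
  by (auto simp: rg_def)

section \<open>Clocked loops, the leaf counter and names\<close>

definition skip :: "vars com" where
  "skip = Upd (\<lambda>v. v)"

definition pushes :: "nat \<Rightarrow> bool list \<Rightarrow> vars com" where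
  "pushes r bs = foldr (\<lambda>b. Seq (Push r (\<lambda>_. b))) bs skip"

abbreviation emit :: "bool list \<Rightarrow> vars com" where
  "emit \<equiv> pushes 0"

text \<open>A loop may not run over a register that its body changes, so a register is drained by a
  loop over the clock. The clock is long enough, and surplus rounds meet an empty register and do
  nothing.\<close>

definition repeat :: "vars com \<Rightarrow> vars com" where
  "repeat c = For 3 (\<lambda>_ v. v) c"

definition xfer :: "nat \<Rightarrow> vars com \<Rightarrow> vars com" where
  "xfer r c = Seq (Pop r (\<lambda>t' (ph, c, t, y). (ph, c, t', y)))
     (Cond (\<lambda>(ph, c, t, y). t \<noteq> None) (Seq c (Upd (\<lambda>(ph, c, t, y). (ph, c, None, y)))) skip)"

definition put_popped :: "nat \<Rightarrow> vars com" where
  "put_popped r = Push r (\<lambda>(ph, c, t, y). the t)"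

definition clear :: "nat \<Rightarrow> vars com" where
  "clear r = repeat (Pop r (\<lambda>_ v. v))"

definition emit_popped :: "nat \<Rightarrow> vars com" where
  "emit_popped r = Seq (put_popped r) (Seq (emit [True]) (put_popped 0))"

text \<open>Numerals are written from the most significant bit, which lies at the bottom of register
  4. The detour through register 5 reverses the order, and the counter is restored while it is
  written.\<close>

definition emit_counter :: "vars com" where
  "emit_counter = Seq (repeat (xfer 4 (put_popped 5)))
     (Seq (repeat (xfer 5 (emit_popped 4))) (emit [False]))"

text \<open>The pair \<open>True, True\<close> codes the leading digit 1 of a name, and the loop
  over the clock writes the zeros of the padding.\<close>

definition emit_name :: "vars com" where
  "emit_name = Seq (repeat (xfer 6 (put_popped 5))) (Seq (emit [True, True])
     (Seq (repeat (xfer 5 (emit_popped 6))) (Seq (repeat (emit [True, False])) (emit [False]))))"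

text \<open>Ripple carry from the least significant bit; a carry that survives becomes a new leading
  digit.\<close>

definition increment :: "vars com" where
  "increment = Seq (Upd (\<lambda>(ph, c, t, y). (ph, c, t, True)))
     (Seq (repeat (xfer 4 (Seq (Push 5 (\<lambda>(ph, c, t, y). the t \<noteq> y))
         (Upd (\<lambda>(ph, c, t, y). (ph, c, t, the t \<and> y))))))
     (Seq (Cond (\<lambda>(ph, c, t, y). y) (Push 5 (\<lambda>_. True)) skip)
     (Seq (Upd (\<lambda>(ph, c, t, y). (ph, c, t, False))) (repeat (xfer 5 (put_popped 4))))))"

definition set_current :: "bool \<Rightarrow> vars \<Rightarrow> vars" where
  "set_current b = (\<lambda>(ph, c, t, y). (ph, b, t, y))"

definition push_current :: "nat \<Rightarrow> vars com" where
  "push_current r = Push r (\<lambda>(ph, c, t, y). c)"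

definition if_current :: "vars com \<Rightarrow> vars com \<Rightarrow> vars com" where
  "if_current a b = Cond (\<lambda>(ph, c, t, y). c) a b"

definition advance :: "vars com" where
  "advance = Upd (\<lambda>(ph, c, t, y). (next_phase ph c, c, t, y))"

text \<open>A token is handled at its second bit. \<open>on_bit\<close> sees every bit of a number,
  continuation bits and the final False included, since the nodes of the tree are prefixes of the
  whole code.\<close>

definition pass_body :: "(bool \<Rightarrow> bool \<Rightarrow> bool list) \<Rightarrow> vars com \<Rightarrow> vars com \<Rightarrow> vars com" where
  "pass_body tok on_bit on_leaf =
     Cond (\<lambda>(ph, c, t, y). ph = Mark \<or> ph = Digit)
       (Seq on_bit (Cond (\<lambda>(ph, c, t, y). ph = Mark \<and> \<not> c) (Seq on_leaf advance) advance))
       (Seq (Cond (\<lambda>(ph, c, t, y). ph = Tok2 True)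
              (if_current (emit (tok True True)) (emit (tok True False)))
              (Cond (\<lambda>(ph, c, t, y). ph = Tok2 False)
                (if_current (emit (tok False True)) (emit (tok False False))) skip))
         advance)"

definition pass :: "(bool \<Rightarrow> bool \<Rightarrow> bool list) \<Rightarrow> vars com \<Rightarrow> vars com \<Rightarrow> vars com" where
  "pass tok on_bit on_leaf = For 2 set_current (pass_body tok on_bit on_leaf)"

text \<open>The normal form between operations: nothing popped, no carry, register 5 empty. Output
  and current leaf are reversed because their newest bit is on top.\<close>

definition st :: "phase \<Rightarrow> bool \<Rightarrow> bool list \<Rightarrow> bool list \<Rightarrow> bool list \<Rightarrow> nat \<Rightarrow> bool list \<Rightarrow> vars state" where
  "st ph c out F C k w = ((ph, c, None, False), rg (rev out) F C (rev (bin k)) [] (rev w))"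

definition digits :: "bool list \<Rightarrow> bool list" where
  "digits bs = concat (map (\<lambda>b. [True, b]) bs)"

lemma digits_simps [simp]:
  "digits [] = []" "digits (b # bs) = True # b # digits bs" "digits (bs @ cs) = digits bs @ digits cs"
  by (simp_all add: digits_def)

lemma enc_nat_digits: "enc_nat n = digits (bin n) @ [False]"
  by (simp add: enc_nat_def digits_def)

lemma exec_skip [simp]: "exec skip s = s"
  by (simp add: skip_def)

lemma exec_pushes: "exec (pushes r bs) s = (fst s, (snd s)(r := rev bs @ snd s r))"
  by (induction bs arbitrary: s) (simp_all add: pushes_def skip_def)

lemma exec_repeat: "exec (repeat c) s = (exec c ^^ length (snd s 3)) s"
proof -
  have "fold (\<lambda>b s. exec c (fst s, snd s)) xs s = (exec c ^^ length xs) s" for xs s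
    by (induction xs arbitrary: s) (simp_all add: funpow_swap1)
  then show ?thesis by (simp add: repeat_def)
qed

text \<open>\<open>S xs a\<close> is a state with \<open>xs\<close> still to be drained and
  \<open>a\<close> accumulated. The second assumption absorbs the surplus rounds of the
  clock.\<close>

lemma funpow_drain:
  assumes "\<And>x xs a. f (S (x # xs) a) = S xs (g x a)" "\<And>a. f (S [] a) = S [] a" "length xs \<le> n"
  shows "(f ^^ n) (S xs a) = S [] (fold g xs a)"
  using assms(3)
proof (induction n arbitrary: xs a)
  case (Suc n)
  then show ?case by (cases xs) (simp_all add: assms funpow_swap1[symmetric] del: funpow.simps add: funpow_Suc_right)
qed simp

lemma exec_put_popped [simp]:
  "exec (put_popped r) ((ph, c, Some b, y), R) = ((ph, c, Some b, y), R(r := b # R r))"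
  by (simp add: put_popped_def)

lemma exec_xfer:
  "R r = [] \<Longrightarrow> exec (xfer r a) ((ph, c, None, y), R) = ((ph, c, None, y), R)"
  "R r = b # bs \<Longrightarrow> exec (xfer r a) ((ph, c, None, y), R) =
     (case exec a ((ph, c, Some b, y), R(r := bs)) of ((ph, c, t, y), R') \<Rightarrow> ((ph, c, None, y), R'))"
  by (simp_all add: xfer_def case_prod_unfold)

lemma exec_clear:
  assumes "length x \<le> length C"
  shows "exec (clear 4) (v, rg out F C x e w) = (v, rg out F C [] e w)"
    "exec (clear 6) (v, rg out F C d e x) = (v, rg out F C d e [])"
    "exec (clear 0) (v, rg x F C d e w) = (v, rg [] F C d e w)"
proof -
  show "exec (clear 4) (v, rg out F C x e w) = (v, rg out F C [] e w)"
    using funpow_drain[of "exec (Pop 4 (\<lambda>_ v. v))" "\<lambda>x a. (v, rg out F C x e w)" "\<lambda>_ a. a" x "length C" "()"] assms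
    by (simp add: clear_def exec_repeat)
  show "exec (clear 6) (v, rg out F C d e x) = (v, rg out F C d e [])"
    using funpow_drain[of "exec (Pop 6 (\<lambda>_ v. v))" "\<lambda>x a. (v, rg out F C d e x)" "\<lambda>_ a. a" x "length C" "()"] assms
    by (simp add: clear_def exec_repeat)
  show "exec (clear 0) (v, rg x F C d e w) = (v, rg [] F C d e w)"
    using funpow_drain[of "exec (Pop 0 (\<lambda>_ v. v))" "\<lambda>x a. (v, rg x F C d e w)" "\<lambda>_ a. a" x "length C" "()"] assms
    by (simp add: clear_def exec_repeat)
qed

lemma exec_move:
  assumes "length x \<le> length C"
  shows "exec (repeat (xfer 4 (put_popped 5))) ((ph, c, None, y), rg out F C x e w) =
      ((ph, c, None, y), rg out F C [] (rev x @ e) w)"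
    "exec (repeat (xfer 6 (put_popped 5))) ((ph, c, None, y), rg out F C d e x) =
      ((ph, c, None, y), rg out F C d (rev x @ e) [])"
    "exec (repeat (xfer 5 (put_popped 4))) ((ph, c, None, y), rg out F C d x w) =
      ((ph, c, None, y), rg out F C (rev x @ d) [] w)"
proof -
  let ?v = "(ph, c, None, y)"
  show "exec (repeat (xfer 4 (put_popped 5))) (?v, rg out F C x e w) = (?v, rg out F C [] (rev x @ e) w)"
    using funpow_drain[of "exec (xfer 4 (put_popped 5))" "\<lambda>x e. (?v, rg out F C x e w)" Cons x "length C" e] assms
    by (simp add: exec_repeat exec_xfer fold_Cons_rev)
  show "exec (repeat (xfer 6 (put_popped 5))) (?v, rg out F C d e x) = (?v, rg out F C d (rev x @ e) [])"
    using funpow_drain[of "exec (xfer 6 (put_popped 5))" "\<lambda>x e. (?v, rg out F C d e x)" Cons x "length C" e] assms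
    by (simp add: exec_repeat exec_xfer fold_Cons_rev)
  show "exec (repeat (xfer 5 (put_popped 4))) (?v, rg out F C d x w) = (?v, rg out F C (rev x @ d) [] w)"
    using funpow_drain[of "exec (xfer 5 (put_popped 4))" "\<lambda>x d. (?v, rg out F C d x w)" Cons x "length C" d] assms
    by (simp add: exec_repeat exec_xfer fold_Cons_rev)
qed

lemma exec_move_emit:
  assumes "length x \<le> length C"
  shows "exec (repeat (xfer 5 (emit_popped 4))) ((ph, c, None, y), rg out F C d x w) =
      ((ph, c, None, y), rg (rev (digits x) @ out) F C (rev x @ d) [] w)"
    "exec (repeat (xfer 5 (emit_popped 6))) ((ph, c, None, y), rg out F C d x w) =
      ((ph, c, None, y), rg (rev (digits x) @ out) F C d [] (rev x @ w))"
proof -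
  let ?v = "(ph, c, None, y)"
  let ?g = "\<lambda>b (d, out). (b # d, b # True # out)"
  have g: "fold ?g x (d, out) = (rev x @ d, rev (digits x) @ out)" for x d out
    by (induction x arbitrary: d out) simp_all
  show "exec (repeat (xfer 5 (emit_popped 4))) (?v, rg out F C d x w) =
      (?v, rg (rev (digits x) @ out) F C (rev x @ d) [] w)"
    using funpow_drain[of "exec (xfer 5 (emit_popped 4))" "\<lambda>x (d, out). (?v, rg out F C d x w)" ?g x "length C" "(d, out)"] assms
    by (simp add: exec_repeat exec_xfer emit_popped_def exec_pushes g split_beta)
  show "exec (repeat (xfer 5 (emit_popped 6))) (?v, rg out F C d x w) =
      (?v, rg (rev (digits x) @ out) F C d [] (rev x @ w))"
    using funpow_drain[of "exec (xfer 5 (emit_popped 6))" "\<lambda>x (w, out). (?v, rg out F C d x w)" ?g x "length C" "(w, out)"] assms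
    by (simp add: exec_repeat exec_xfer emit_popped_def exec_pushes g split_beta)
qed

lemma exec_emit_counter:
  assumes "k \<le> length C"
  shows "exec emit_counter (st ph c out F C k w) = st ph c (out @ enc_nat k) F C k w"
proof -
  have "length (bin k) \<le> length C" using assms length_bin_le[of k] by simp
  then show ?thesis by (simp add: emit_counter_def st_def exec_pushes exec_move exec_move_emit enc_nat_digits)
qed

lemma exec_repeat_emit:
  "exec (repeat (emit bs)) (v, rg out F C d e w) =
     (v, rg (rev (concat (replicate (length C) bs)) @ out) F C d e w)"
proof -
  have "(exec (emit bs) ^^ n) (v, rg out F C d e w) = (v, rg (concat (replicate n (rev bs)) @ out) F C d e w)" for n
    by (induction n) (simp_all add: exec_pushes)
  then show ?thesis by (simp add: exec_repeat rev_concat)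
qed

lemma exec_emit_name:
  assumes "length w \<le> length C"
  shows "exec emit_name (st ph c out F C k w) = st ph c (out @ enc_nat (name (length C) w)) F C k w"
proof -
  have "concat (replicate n [True, False]) = digits (replicate n False)" for n
    by (induction n) simp_all
  then show ?thesis using assms
    by (simp add: emit_name_def st_def exec_pushes exec_move exec_move_emit exec_repeat_emit enc_nat_digits name_def bin_num)
qed

text \<open>\<open>b = (\<not> y)\<close> is the sum bit. Without carry the digits are copied; with
  carry an odd \<open>k\<close> passes it on to \<open>k div 2\<close>, in step with the recursion
  of \<open>bin\<close>.\<close>

lemma fold_increment:
  "fold (\<lambda>b (e, y). ((b = (\<not> y)) # e, b \<and> y)) (rev (bin k)) (e, False) = (bin k @ e, False)"
  "(case fold (\<lambda>b (e, y). ((b = (\<not> y)) # e, b \<and> y)) (rev (bin k)) (e, True) of (e', y') \<Rightarrow>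
     if y' then True # e' else e') = bin (Suc k) @ e"
proof -
  let ?g = "\<lambda>b (e, y). ((b = (\<not> y)) # e, b \<and> y)"
  have 1: "fold ?g xs (e, False) = (rev xs @ e, False)" for xs e
    by (induction xs arbitrary: e) simp_all
  then show "fold ?g (rev (bin k)) (e, False) = (bin k @ e, False)" by simp
  show "(case fold ?g (rev (bin k)) (e, True) of (e', y') \<Rightarrow> if y' then True # e' else e') = bin (Suc k) @ e"
  proof (induction k arbitrary: e rule: less_induct)
    case (less k)
    show ?case
    proof (cases "k = 0")
      case True
      then show ?thesis by (simp add: bin_pos)
    next
      case False
      then have k: "bin k = bin (k div 2) @ [odd k]" "k div 2 < k" by (simp_all add: bin_pos)
      have s: "bin (Suc k) = bin (Suc k div 2) @ [even k]" by (simp add: bin_pos)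
      show ?thesis
      proof (cases "odd k")
        case True
        then have "Suc k div 2 = Suc (k div 2)" by simp
        then show ?thesis using True less.IH[OF k(2), of "False # e"] k(1) s by simp
      next
        case False
        then have "Suc k div 2 = k div 2" by simp
        then show ?thesis using False k(1) s by (simp add: 1)
      qed
    qed
  qed
qed

lemma exec_increment:
  assumes "Suc k \<le> length C"
  shows "exec increment (st ph c out F C k w) = st ph c out F C (Suc k) w"
proof -
  let ?g = "\<lambda>b (e, y). ((b = (\<not> y)) # e, b \<and> y)"
  let ?a = "xfer 4 (Seq (Push 5 (\<lambda>(ph, c, t, y). the t \<noteq> y)) (Upd (\<lambda>(ph, c, t, y). (ph, c, t, the t \<and> y))))"
  obtain e y where e: "fold ?g (rev (bin k)) ([], True) = (e, y)" by (cases "fold ?g (rev (bin k)) ([], True)")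
  have b: "(if y then True # e else e) = bin (Suc k)" using fold_increment(2)[of k "[]"] e by simp
  have l: "length (bin k) \<le> length C" "length (bin (Suc k)) \<le> length C"
    using assms length_bin_le[of k] length_bin_le[of "Suc k"] by simp_all
  have "(exec ?a ^^ length C) ((ph, c, None, True), rg (rev out) F C (rev (bin k)) [] (rev w)) =
     ((ph, c, None, y), rg (rev out) F C [] e (rev w))"
    using funpow_drain[of "exec ?a" "\<lambda>x (e, y). ((ph, c, None, y), rg (rev out) F C x e (rev w))" ?g
        "rev (bin k)" "length C" "([], True)"] l e
    by (simp add: exec_xfer split_beta)
  moreover have "exec (repeat (xfer 5 (put_popped 4))) ((ph, c, None, False), rg (rev out) F C [] (bin (Suc k)) (rev w)) =
     st ph c out F C (Suc k) w"
    using l by (simp add: exec_move st_def)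
  ultimately show ?thesis using b by (auto simp: increment_def st_def exec_repeat split: if_splits)
qed

text \<open>\<open>bit_out w b\<close> is written when bit \<open>b\<close> is read after the part \<open>w\<close> of a leaf, and
  \<open>leaf_out w k\<close> at the end of the \<open>k\<close>-th leaf \<open>w\<close>.\<close>
definition handles :: "nat \<Rightarrow> vars com \<Rightarrow> vars com \<Rightarrow> (bool list \<Rightarrow> bool \<Rightarrow> bool list) \<Rightarrow>
    (bool list \<Rightarrow> nat \<Rightarrow> bool list) \<Rightarrow> bool" where
  "handles n on_bit on_leaf bit_out leaf_out \<longleftrightarrow>
     (\<forall>ph c out F C k w. length C = n \<longrightarrow> length w < n \<longrightarrow>
        exec on_bit (st ph c out F C k w) = st ph c (out @ bit_out w c) F C k (w @ [c])) \<and>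
     (\<forall>ph c out F C k w. length C = n \<longrightarrow> length w \<le> n \<longrightarrow> k < n \<longrightarrow>
        exec on_leaf (st ph c out F C k w) = st ph c (out @ leaf_out w k) F C (Suc k) [])"

primrec bits_out :: "(bool list \<Rightarrow> bool \<Rightarrow> bool list) \<Rightarrow> bool list \<Rightarrow> bool list \<Rightarrow> bool list" where
  "bits_out f w [] = []"
| "bits_out f w (b # bs) = f w b @ bits_out f (w @ [b]) bs"

primrec pass_out :: "(bool \<Rightarrow> bool \<Rightarrow> bool list) \<Rightarrow> (bool list \<Rightarrow> bool \<Rightarrow> bool list) \<Rightarrow>
    (bool list \<Rightarrow> nat \<Rightarrow> bool list) \<Rightarrow> form \<Rightarrow> nat \<Rightarrow> bool list" where
  "pass_out tok f g (Var i) k = tok False False @ bits_out f [] (enc_nat i) @ g (enc_nat i) k"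
| "pass_out tok f g (Neg p) k = tok False True @ pass_out tok f g p k"
| "pass_out tok f g (Conj p q) k =
     tok True False @ pass_out tok f g p k @ pass_out tok f g q (k + length (leaves p))"
| "pass_out tok f g (Disj p q) k =
     tok True True @ pass_out tok f g p k @ pass_out tok f g q (k + length (leaves p))"

lemma exec_emit_st: "exec (emit bs) (st ph c out F C k w) = st ph c (out @ bs) F C k w"
  by (simp add: st_def exec_pushes)

lemma fst_st: "fst (st ph c out F C k w) = (ph, c, None, False)"
  by (simp add: st_def)

lemma exec_pass:
  assumes h: "handles n on_bit on_leaf f g" and n: "length C = n" "length (enc_form q) \<le> n"
  shows "exec (pass tok on_bit on_leaf) (st Tok False out (enc_form q) C 0 []) =
    st Tok False (out @ pass_out tok f g q 0) (enc_form q) C (length (leaves q)) []"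
proof -
  define F where "F = enc_form q"
  define step where "step = (\<lambda>b s. exec (pass_body tok on_bit on_leaf) (set_current b (fst s), snd s))"
  have cur: "(set_current b (fst (st ph c out F C k w)), snd (st ph c out F C k w)) = st ph b out F C k w"
    for b ph c out k w by (simp add: set_current_def st_def)
  have adv: "exec advance (st ph c out F C k w) = st (next_phase ph c) c out F C k w" for ph c out k w
    by (simp add: advance_def st_def)
  have bit: "exec on_bit (st ph c out F C k w) = st ph c (out @ f w c) F C k (w @ [c])"
    if "length w < n" for ph c out k w using h n(1) that by (simp add: handles_def)
  have leaf: "exec on_leaf (st ph c out F C k w) = st ph c (out @ g w k) F C (Suc k) []"
    if "length w \<le> n" "k < n" for ph c out k w using h n(1) that by (simp add: handles_def)
  have step: "step b (st ph c out F C k w) = exec (pass_body tok on_bit on_leaf) (st ph b out F C k w)" for b ph c out k w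
    unfolding step_def cur by (rule refl)
  note body = step pass_body_def if_current_def fst_st adv exec_emit_st bit leaf
  have tok: "step b (st Tok c out F C k w) = st (Tok2 b) b out F C k w" for b c out k w
    by (simp add: body)
  have tok2: "step b (st (Tok2 a) c out F C k w) = st (if a \<or> b then Tok else Mark) b (out @ tok a b) F C k w"
    for a b c out k w
    by (cases a; cases b) (simp_all add: body)
  have mark: "step True (st Mark c out F C k w) = st Digit True (out @ f w True) F C k (w @ [True])"
    if "length w < n" for c out k w
    using that by (simp add: body)
  have digit: "step b (st Digit c out F C k w) = st Mark b (out @ f w b) F C k (w @ [b])"
    if "length w < n" for b c out k w
    using that by (simp add: body)
  have last: "step False (st Mark c out F C k w) = st Tok False (out @ f w False @ g (w @ [False]) k) F C (Suc k) []"
    if "length w < n" "k < n" for c out k w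
    using that by (simp add: body)
  have nat: "fold step (digits bs @ [False]) (st Mark c out F C k w) =
      st Tok False (out @ bits_out f w (digits bs @ [False]) @ g (w @ digits bs @ [False]) k) F C (Suc k) []"
    if "length w + length (digits bs) < n" "k < n" for bs c out k w
    using that
  proof (induction bs arbitrary: c out w)
    case Nil
    then show ?case by (simp add: last)
  next
    case (Cons b bs)
    then show ?case using Cons.IH[of "w @ [True, b]" b "out @ f w True @ f (w @ [True]) b"]
      by (simp add: mark digit)
  qed
  have "fold step (enc_form r) (st Tok c out F C k []) =
      st Tok False (out @ pass_out tok f g r k) F C (k + length (leaves r)) []"
    if "length (enc_form r) \<le> n" "k + length (leaves r) \<le> n" for r c out k
    using that
  proof (induction r arbitrary: c out k)
    case (Var i)
    then show ?case using nat[of "[]" "bin i" k] by (simp add: tok tok2 enc_nat_digits)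
  next
    case (Neg p)
    then show ?case by (simp add: tok tok2)
  next
    case (Conj p q)
    then show ?case by (simp add: tok tok2 add.assoc)
  next
    case (Disj p q)
    then show ?case by (simp add: tok tok2 add.assoc)
  qed
  from this[of q 0 False out] show ?thesis
    using n length_leaves_le[of q] unfolding pass_def exec.simps step_def[symmetric] F_def
    by (simp add: st_def)
qed

section \<open>The passes over the formula\<close>

definition finish_leaf :: "vars com" where
  "finish_leaf = Seq (clear 6) increment"

lemma exec_finish_leaf:
  assumes "k < length C" "length w \<le> length C"
  shows "exec finish_leaf (st ph c out F C k w) = st ph c out F C (Suc k) []"
proof -
  have "exec (clear 6) (st ph c out F C k w) = st ph c out F C k []"
    using assms(2) by (simp add: st_def exec_clear)
  then show ?thesis using assms(1) by (simp add: finish_leaf_def exec_increment)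
qed

lemma exec_push_current: "exec (push_current 6) (st ph c out F C k w) = st ph c out F C k (w @ [c])"
  by (simp add: push_current_def st_def)

lemma exec_if_current:
  "exec (if_current a b) (st ph c out F C k w) =
     (if c then exec a (st ph c out F C k w) else exec b (st ph c out F C k w))"
  by (simp add: if_current_def st_def)

definition no_tok :: "bool list \<Rightarrow> bool \<Rightarrow> bool \<Rightarrow> bool list" where
  "no_tok bs a b = (if a \<or> b then [] else bs)"

definition count_pass :: "vars com" where
  "count_pass = pass (no_tok []) (push_current 6) finish_leaf"

definition relabel_pass :: "vars com" where
  "relabel_pass = pass (\<lambda>a b. [a, b]) (push_current 6) (Seq emit_counter finish_leaf)"

definition rename_pass :: "vars com" where
  "rename_pass = pass (\<lambda>a b. [a, b]) (push_current 6) (Seq emit_name finish_leaf)"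

text \<open>\<open>push_current 6\<close> comes last because the literal for a bit is named by the
  prefix before it. The end of a leaf closes its \<open>matches\<close> with \<open>tt\<close> and
  adds the literal of the leaf.\<close>

definition selects_pass :: "bool \<Rightarrow> vars com" where
  "selects_pass b = pass (no_tok [True, True, True, False])
     (Seq (emit [True, False]) (Seq (if_current skip (emit [False, True]))
        (Seq (emit [False, False]) (Seq emit_name (push_current 6)))))
     (Seq (emit (enc_form tt @ (if b then [] else [False, True]) @ [False, False]))
        (Seq emit_counter finish_leaf))"

definition lex_pass :: "vars com" where
  "lex_pass = pass (no_tok []) (push_current 6)
     (Seq (emit [True, True, True, False, False, False]) (Seq emit_counter
     (Seq (emit [False, True, False, False]) (Seq emit_name
     (Seq (emit [True, False, True, True, False, False]) (Seq emit_counter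
     (Seq (emit [False, True, False, False]) (Seq emit_name finish_leaf))))))))"

primrec leaves_out :: "bool list \<Rightarrow> (bool list \<Rightarrow> bool \<Rightarrow> bool list) \<Rightarrow>
    (bool list \<Rightarrow> nat \<Rightarrow> bool list) \<Rightarrow> nat list \<Rightarrow> nat \<Rightarrow> bool list" where
  "leaves_out bs f g [] k = []"
| "leaves_out bs f g (i # is) k =
     bs @ bits_out f [] (enc_nat i) @ g (enc_nat i) k @ leaves_out bs f g is (Suc k)"

lemma leaves_out_append:
  "leaves_out bs f g (is @ js) k = leaves_out bs f g is k @ leaves_out bs f g js (k + length is)"
  by (induction "is" arbitrary: k) simp_all

text \<open>If connectives write nothing, the tree structure is invisible and only the sequence of
  leaves counts.\<close>

lemma pass_out_no_tok: "pass_out (no_tok bs) f g q k = leaves_out bs f g (leaves q) k"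
  by (induction q arbitrary: k) (simp_all add: no_tok_def leaves_out_append)

lemma bits_out_Nil [simp]: "bits_out (\<lambda>_ _. []) w bs = []"
  by (induction bs arbitrary: w) simp_all

lemma exec_count_pass:
  assumes "length C = n" "length (enc_form q) \<le> n"
  shows "exec count_pass (st Tok False out (enc_form q) C 0 []) =
    st Tok False out (enc_form q) C (length (leaves q)) []"
proof -
  have "handles n (push_current 6) finish_leaf (\<lambda>_ _. []) (\<lambda>_ _. [])"
    by (simp add: handles_def exec_push_current exec_finish_leaf)
  moreover have "leaves_out [] (\<lambda>_ _. []) (\<lambda>_ _. []) is k = []" for "is" k
    by (induction "is" arbitrary: k) simp_all
  ultimately show ?thesis using exec_pass[OF _ assms] by (simp add: count_pass_def pass_out_no_tok)
qed

lemma exec_relabel_pass: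
  assumes "length C = n" "length (enc_form q) \<le> n"
  shows "exec relabel_pass (st Tok False out (enc_form q) C 0 []) =
    st Tok False (out @ enc_form (relabel q 0)) (enc_form q) C (length (leaves q)) []"
proof -
  have "handles n (push_current 6) (Seq emit_counter finish_leaf) (\<lambda>_ _. []) (\<lambda>_ k. enc_nat k)"
    by (simp add: handles_def exec_push_current exec_emit_counter exec_finish_leaf)
  moreover have "pass_out (\<lambda>a b. [a, b]) (\<lambda>_ _. []) (\<lambda>_ k. enc_nat k) r k = enc_form (relabel r k)" for r k
    by (induction r arbitrary: k) simp_all
  ultimately show ?thesis using exec_pass[OF _ assms] by (simp add: relabel_pass_def)
qed

lemma exec_rename_pass:
  assumes "length C = n" "length (enc_form q) \<le> n"
  shows "exec rename_pass (st Tok False out (enc_form q) C 0 []) =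
    st Tok False (out @ enc_form (rename n q)) (enc_form q) C (length (leaves q)) []"
proof -
  have "handles n (push_current 6) (Seq emit_name finish_leaf) (\<lambda>_ _. []) (\<lambda>w _. enc_nat (name n w))"
    by (simp add: handles_def exec_push_current exec_emit_name exec_finish_leaf)
  moreover have "pass_out (\<lambda>a b. [a, b]) (\<lambda>_ _. []) (\<lambda>w _. enc_nat (name n w)) r k = enc_form (rename n r)" for r k
    by (induction r arbitrary: k) simp_all
  ultimately show ?thesis using exec_pass[OF _ assms] by (simp add: rename_pass_def)
qed

text \<open>The disjunctions nest to the right, so in prefix notation one \<open>ff\<close> after
  the last leaf closes all of them.\<close>

lemma exec_selects_pass:
  assumes "length C = n" "length (enc_form q) \<le> n"
  shows "exec (Seq (selects_pass b) (emit (enc_form ff))) (st Tok False out (enc_form q) C 0 []) =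
    st Tok False (out @ enc_form (selects n b (leaves q) 0)) (enc_form q) C (length (leaves q)) []"
proof -
  let ?f = "\<lambda>w b. [True, False] @ (if b then [] else [False, True]) @ [False, False] @ enc_nat (name n w)"
  let ?g = "\<lambda>_ k. enc_form tt @ (if b then [] else [False, True]) @ [False, False] @ enc_nat k"
  have "handles n (Seq (emit [True, False]) (Seq (if_current skip (emit [False, True]))
        (Seq (emit [False, False]) (Seq emit_name (push_current 6)))))
     (Seq (emit (enc_form tt @ (if b then [] else [False, True]) @ [False, False]))
        (Seq emit_counter finish_leaf)) ?f ?g"
    unfolding handles_def
    by (auto simp: exec_emit_st exec_push_current exec_if_current exec_emit_name
        exec_emit_counter exec_finish_leaf)
  moreover have m: "bits_out ?f v w @ enc_form tt @ cs = enc_form (matches n v w) @ cs" for v w cs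
    by (induction w arbitrary: v) (simp_all add: lit_def)
  have "leaves_out [True, True, True, False] ?f ?g is k @ enc_form ff = enc_form (selects n b is k)" for "is" k
    by (induction "is" arbitrary: k) (simp_all only: leaves_out.simps append.assoc m, simp_all add: lit_def)
  ultimately show ?thesis using exec_pass[OF _ assms]
    by (simp add: exec_emit_st selects_pass_def pass_out_no_tok)
qed

lemma exec_lex_pass:
  assumes "length C = n" "length (enc_form q) \<le> n"
  shows "exec (Seq lex_pass (emit (enc_form tt))) (st Tok False out (enc_form q) C 0 []) =
    st Tok False (out @ enc_form (lex_ge n (leaves q) 0)) (enc_form q) C (length (leaves q)) []"
proof -
  let ?g = "\<lambda>w k. [True, True, True, False, False, False] @ enc_nat k @
     [False, True, False, False] @ enc_nat (name n w) @ [True, False, True, True, False, False] @ enc_nat k @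
     [False, True, False, False] @ enc_nat (name n w)"
  have "handles n (push_current 6)
     (Seq (emit [True, True, True, False, False, False]) (Seq emit_counter
     (Seq (emit [False, True, False, False]) (Seq emit_name
     (Seq (emit [True, False, True, True, False, False]) (Seq emit_counter
     (Seq (emit [False, True, False, False]) (Seq emit_name finish_leaf)))))))) (\<lambda>_ _. []) ?g"
    unfolding handles_def
    by (auto simp: exec_emit_st exec_push_current exec_emit_name
        exec_emit_counter exec_finish_leaf)
  moreover have "leaves_out [] (\<lambda>_ _. []) ?g is k @ enc_form tt = enc_form (lex_ge n is k)" for "is" k
    by (induction "is" arbitrary: k) simp_all
  ultimately show ?thesis using exec_pass[OF _ assms]
    by (simp add: exec_emit_st lex_pass_def pass_out_no_tok)
qed

text \<open>Formula and clock both receive the guarded code, whose length is the \<open>n\<close> of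
  the names. Register 0 is emptied only after the clock has been filled, because the emptying is
  itself clocked.\<close>

definition load :: "vars com" where
  "load = Seq (For 0 set_current (Seq (push_current 2) (push_current 3)))
     (Seq (pushes 2 (rev guard_code)) (Seq (pushes 3 (rev guard_code))
     (Seq (clear 0) (Upd (\<lambda>_. (Tok, False, None, False))))))"

lemma exec_load:
  "exec load (v, (\<lambda>_. [])(0 := rev x)) = st Tok False [] (guard_code @ x) (guard_code @ x) 0 []"
proof -
  obtain ph c t y where v: "v = (ph, c, t, y)" by (metis prod_cases4)
  have e: "(\<lambda>_. [])(0 := a) = rg a [] [] [] [] []" for a
    by (auto simp: rg_def)
  have "\<exists>c'. fold (\<lambda>b s. exec (Seq (push_current 2) (push_current 3)) (set_current b (fst s), snd s)) xs
      ((ph, c, t, y), rg a F C [] [] []) = ((ph, c', t, y), rg a (rev xs @ F) (rev xs @ C) [] [] [])" for xs a F C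
    by (induction xs arbitrary: c F C) (simp_all add: set_current_def push_current_def)
  from this[of "rev x" "rev x" "[]" "[]"] show ?thesis
    by (auto simp: load_def e v st_def exec_clear exec_pushes)
qed

text \<open>The numeral of \<open>2 ^ (2 * n + 1)\<close> is 1 followed by \<open>2 * n + 1\<close>
  zeros: two per round of the clock and one in the closing string.\<close>

definition arity_prefix :: "vars com" where
  "arity_prefix = Seq count_pass (Seq emit_counter (Seq (clear 4)
     (Seq (emit [True, True]) (Seq (repeat (emit [True, False, True, False])) (emit [True, False, False])))))"

text \<open>The literal strings are the tokens of \<open>max_form\<close>: \<open>Conj\<close>, then
  \<open>Conj\<close>, \<open>Neg\<close>, \<open>Conj\<close>, then \<open>Disj\<close>,
  \<open>Neg\<close>. Each part between them is written by one pass that starts with leaf counter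
  0.\<close>

definition reduction :: "vars com" where
  "reduction = Seq load (Seq arity_prefix
     (Seq (emit [True, False]) (Seq relabel_pass (Seq (clear 4)
     (Seq (emit [True, False, False, True, True, False])
     (Seq (Seq (selects_pass True) (emit (enc_form ff))) (Seq (clear 4)
     (Seq (Seq (selects_pass False) (emit (enc_form ff))) (Seq (clear 4)
     (Seq (emit [True, True, False, True]) (Seq rename_pass (Seq (clear 4)
     (Seq lex_pass (emit (enc_form tt)))))))))))))))"

lemma exec_clear_counter:
  "k \<le> length C \<Longrightarrow> exec (clear 4) (st ph c out F C k w) = st ph c out F C 0 w"
  using length_bin_le[of k] by (simp add: st_def exec_clear)

lemma exec_arity_prefix:
  assumes "length C = n" "length (enc_form q) \<le> n"
  shows "exec arity_prefix (st Tok False [] (enc_form q) C 0 []) =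
    st Tok False (enc_nat (length (leaves q)) @ enc_nat (2 ^ (2 * n + 1))) (enc_form q) C 0 []"
proof -
  have "concat (replicate m [True, False, True, False]) = digits (replicate (2 * m) False)" for m
    by (induction m) simp_all
  moreover have "bin (2 ^ (2 * n + 1)) = True # replicate (2 * n + 1) False"
    using bin_num num_power by metis
  then have "enc_nat (2 ^ (2 * n + 1)) = digits (True # replicate (2 * n) False @ [False]) @ [False]"
    by (simp add: enc_nat_digits replicate_append_same)
  moreover have "length (leaves q) \<le> length C" using length_leaves_le[of q] assms by simp
  ultimately show ?thesis
    unfolding arity_prefix_def exec.simps using assms
    by (simp add: exec_count_pass exec_emit_counter exec_clear_counter)
       (simp add: st_def exec_repeat_emit exec_pushes)
qed

lemma exec_reduction:
  assumes "guard_code @ x = enc_form q"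
  shows "snd (exec reduction (v, (\<lambda>_. [])(0 := rev x))) 0 = rev (enc2 (UVAL2_instance (length (enc_form q)) q))"
proof -
  have l: "length (leaves q) \<le> length (enc_form q)" by (rule length_leaves_le)
  note steps = exec_load exec_arity_prefix[OF refl order_refl] exec_emit_st exec_relabel_pass[OF refl order_refl]
    exec_clear_counter[OF l] exec_selects_pass[OF refl order_refl] exec_rename_pass[OF refl order_refl]
    exec_lex_pass[OF refl order_refl]
  show ?thesis
    unfolding reduction_def exec.simps(4)[of load] exec.simps(4)[of arity_prefix] exec.simps(4)[of "emit bs" for bs]
      exec.simps(4)[of relabel_pass] exec.simps(4)[of "clear 4"] exec.simps(4)[of rename_pass]
      exec.simps(4)[of "Seq a b" for a b] exec_load assms steps(2-)
    by (simp add: st_def enc2_def UVAL2_instance_def max_form_def)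
qed

section \<open>Well-formedness of the program and conclusion\<close>

lemma com_pushes:
  "wf_com (pushes r bs)" "regs (pushes r bs) = (if bs = [] then {} else {r})"
  "writes (pushes r bs) = (if bs = [] then {} else {r})" "fors (pushes r bs) = {}"
  by (induction bs) (auto simp: pushes_def skip_def)

text \<open>What a handler may do inside the loop over register 2: loop over the clock alone, and
  touch neither the formula nor the contents of the clock.\<close>

definition inner_com :: "vars com \<Rightarrow> bool" where
  "inner_com c \<longleftrightarrow> wf_com c \<and> regs c \<subseteq> {0, 3, 4, 5, 6} \<and> writes c \<subseteq> {0, 4, 5, 6} \<and> fors c \<subseteq> {3}"

lemma inner_Seq: "inner_com a \<Longrightarrow> inner_com b \<Longrightarrow> inner_com (Seq a b)"
  by (auto simp: inner_com_def)

lemma inner_if_current: "inner_com a \<Longrightarrow> inner_com b \<Longrightarrow> inner_com (if_current a b)"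
  by (auto simp: inner_com_def if_current_def)

lemma inner_basic:
  "inner_com skip" "inner_com (emit bs)" "inner_com (push_current 6)"
  "inner_com emit_counter" "inner_com emit_name" "inner_com finish_leaf"
  by (auto simp: inner_com_def com_pushes skip_def push_current_def emit_counter_def emit_name_def
      finish_leaf_def clear_def increment_def repeat_def xfer_def put_popped_def emit_popped_def)

lemma wf_pass:
  assumes "inner_com on_bit" "inner_com on_leaf"
  shows "wf_com (pass tok on_bit on_leaf) \<and> regs (pass tok on_bit on_leaf) \<subseteq> {..<7}"
proof -
  have "inner_com (pass_body tok on_bit on_leaf)"
    using assms by (auto simp: inner_com_def pass_body_def if_current_def advance_def skip_def com_pushes)
  then have w: "wf_com (pass_body tok on_bit on_leaf)"
    and r: "regs (pass_body tok on_bit on_leaf) \<subseteq> {0, 3, 4, 5, 6}"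
    and d: "writes (pass_body tok on_bit on_leaf) \<inter> fors (pass_body tok on_bit on_leaf) = {}"
    by (auto simp: inner_com_def)
  have "2 \<notin> regs (pass_body tok on_bit on_leaf)" using r by auto
  then show ?thesis using w d r by (auto simp: pass_def)
qed

lemma wf_reduction: "wf_com reduction \<and> regs reduction \<subseteq> {..<7}"
proof -
  note inner = inner_Seq inner_if_current inner_basic
  have p: "wf_com count_pass \<and> regs count_pass \<subseteq> {..<7}" "wf_com relabel_pass \<and> regs relabel_pass \<subseteq> {..<7}"
    "wf_com rename_pass \<and> regs rename_pass \<subseteq> {..<7}" "wf_com lex_pass \<and> regs lex_pass \<subseteq> {..<7}"
    "wf_com (selects_pass b) \<and> regs (selects_pass b) \<subseteq> {..<7}" for b
    unfolding count_pass_def relabel_pass_def rename_pass_def selects_pass_def lex_pass_def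
    by (rule wf_pass; intro inner)+
  have i: "wf_com c \<and> regs c \<subseteq> {..<7}" if "inner_com c" for c
    using that by (auto simp: inner_com_def)
  have seq: "wf_com (Seq a b) \<and> regs (Seq a b) \<subseteq> {..<7}"
    if "wf_com a \<and> regs a \<subseteq> {..<7}" "wf_com b \<and> regs b \<subseteq> {..<7}" for a b :: "vars com"
    using that by simp
  have clr: "wf_com (clear 4) \<and> regs (clear 4) \<subseteq> {..<7}"
    and rep: "wf_com (repeat (emit bs)) \<and> regs (repeat (emit bs)) \<subseteq> {..<7}" for bs
    by (auto simp: clear_def repeat_def com_pushes)
  have load: "wf_com load \<and> regs load \<subseteq> {..<7}"
    by (auto simp: load_def push_current_def com_pushes clear_def repeat_def)
  show ?thesis
    unfolding reduction_def arity_prefix_def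
    by (intro seq load clr rep i[OF inner_basic(2)] i[OF inner_basic(4)] p)
qed

lemma MaxVAL_reduces_UVAL2: "MaxVAL \<propto> UVAL2"
proof -
  let ?v = "(Tok, False, None, False) :: vars"
  define \<mu> where "\<mu> x = rev (snd (exec reduction (?v, (\<lambda>_. [])(0 := rev x))) 0)" for x
  have "poly_time_computable \<mu>"
  proof (rule com_poly_time[of reduction 7 ?v])
    show "wf_com reduction" "regs reduction \<subseteq> {..<7}" using wf_reduction by simp_all
  qed (simp_all add: \<mu>_def)
  \<comment> \<open>This has to hold also for strings that encode no instance; the last command
    always writes the code of \<open>tt\<close>.\<close>
  moreover have "\<mu> x \<noteq> []" for x
    by (simp add: \<mu>_def reduction_def tt_def exec_pushes)
  moreover have "UVAL2 (\<mu> x) \<subseteq> MaxVAL x" for x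
  proof (cases "\<exists>P. valid1 P \<and> enc1 P = x")
    case True
    then obtain m p where v: "valid1 (m, p)" and x: "x = enc1 (m, p)" by auto
    have "guard_code @ x = enc_form (guard m p)" by (simp add: x enc_form_guard)
    from exec_reduction[OF this] have "\<mu> x = enc2 (UVAL2_instance (length (enc_form (guard m p))) (guard m p))"
      by (simp add: \<mu>_def)
    then show ?thesis using UVAL2_instance_MaxVAL[OF v refl] x by simp
  next
    case False
    then show ?thesis by (auto simp: MaxVAL_def)
  qed
  ultimately show ?thesis unfolding reduces_def by blast
qed

theorem theorem2:
  shows "red_class (pneg UVAL2) = red_class UVAL2 \<and> MaxVAL \<propto> UVAL2"
  using red_class_pneg_UVAL2 MaxVAL_reduces_UVAL2 by blast

end
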